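(* Let $\mathbb{F}_q$ be a finite field and let $G\le\operatorname{PGL}_2(\mathbb{F}_q)$ be a subgroup. For all integers $m>d(G)$, $$N_q(m)=\sum_{k\mid |G|}\omega_G\!\left(m\cdot\frac{|G|}{k},\,k\right),$$ where the sum runs over the positive divisors $k$ of $|G|$.
   Context: $\mathcal{I}_q$ is the set of monic irreducible polynomials in $\mathbb{F}_q[x]$, $\mathcal{I}_q^n$ the subset of those of degree $n$, and $N_q(n):=|\mathcal{I}_q^n|$. For $A=\begin{pmatrix}a&b\\c&d\end{pmatrix}\in\operatorname{GL}_2(\mathbb{F}_q)$, $[A]$ denotes its class in $\operatorname{PGL}_2(\mathbb{F}_q)$, $[A]\circ x=\frac{ax+b}{cx+d}$, and $[A]\circ v=\frac{av+b}{cv+d}$ for $v\in\overline{\mathbb{F}}_q\cup\{\infty\}$ is the usual action. Action on polynomials: $[A]\ast f(x)=\lambda_{A,f}(cx+d)^{\deg(f)}f\!\left(\frac{ax+b}{cx+d}\right)$, where $\lambda_{A,f}\in\mathbb{F}_q^{\ast}$ makes the result monic. Write $G\ast r=\{[A]\ast r\mid [A]\in G\}$ and $\prod G\ast r:=\prod_{t\in G\ast r}t$. Let $G\circ\infty$ be the $G$-orbit of $\infty$ and let $\mathcal{I}_q^G$ be the set of $r\in\mathcal{I}_q$ with no root in $G\circ\infty$; $G$ acts (on the right) via $\ast$ on $\mathcal{I}_q^G$ and on $\mathcal{I}_q^n$ for each $n\ge 2$. Orbit counts: $\omega_G(n,k):=\left|\{G\ast r\mid r\in\mathcal{I}_q^n\text{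 and }|G\ast r|=k\}\right|$, the number of $G$-orbits of size $k$ in $\mathcal{I}_q^n$. Quotient maps: let $\mathbb{F}_q(x)^G=\{Q\in\mathbb{F}_q(x)\mid Q([A]\circ x)=Q(x)\text{ for all }[A]\in G\}$. A quotient map for $G$ is a rational function $Q_G=g/h$ with $g,h\in\mathbb{F}_q[x]$ coprime, $g$ monic, $\deg(g)=|G|$, $0\le\deg(h)<\deg(g)$, and $\mathbb{F}_q(x)^G=\mathbb{F}_q(Q_G)$. For $F\in\mathbb{F}_q[x]$ put $F^{Q_G}(x):=h(x)^{\deg(F)}F\!\left(\frac{g(x)}{h(x)}\right)$. It is known that for every $F\in\mathcal{I}_q$ there are $r\in\mathcal{I}_q^G$ and an integer $k\ge 1$ with $F^{Q_G}=\left(\prod G\ast r\right)^k$. Definition of $d(G)$: $d(G)$ is the largest degree of a polynomial $F\in\mathcal{I}_q$ for which $F^{Q_G}=\left(\prod G\ast r\right)^k$ with $k>1$, and $d(G):=0$ if no such $F$ exists. One has $d(G)\in\{0,1,2\}$, and $d(G)$ does not depend on the choice of the quotient map $Q_G$. *)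

theory Defs
  imports
    "HOL-Analysis.Determinants"
    "HOL-Algebra.Coset"
    "HOL-Computational_Algebra.Polynomial"
    "HOL-Computational_Algebra.Fraction_Field"
begin

section \<open>The groups \<open>GL\<^sub>2\<close> and \<open>PGL\<^sub>2\<close>\<close>

definition GL2 :: "('a::field ^ 2 ^ 2) monoid" where
  "GL2 = \<lparr>carrier = {A. invertible A}, mult = (**), one = mat 1\<rparr>"

definition scalars2 :: "('a::field ^ 2 ^ 2) set" where
  "scalars2 = {mat c |c. c \<noteq> 0}"

definition PGL2 :: "('a::field ^ 2 ^ 2) set monoid" where
  "PGL2 = GL2 Mod scalars2"

definition pgl_class :: "'a::field ^ 2 ^ 2 \<Rightarrow> ('a ^ 2 ^ 2) set" where
  "pgl_class A = scalars2 #>\<^bsub>GL2\<^esub> A"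

lemma group_GL2: "group (GL2 :: ('a::field ^ 2 ^ 2) monoid)"
proof (rule groupI)
  fix A :: "'a ^ 2 ^ 2" assume "A \<in> carrier GL2"
  then obtain B where "A ** B = mat 1" "B ** A = mat 1"
    by (auto simp: GL2_def invertible_def)
  then show "\<exists>B\<in>carrier GL2. B \<otimes>\<^bsub>GL2\<^esub> A = \<one>\<^bsub>GL2\<^esub>"
    by (auto simp: GL2_def invertible_def)
qed (auto simp: GL2_def invertible_mult matrix_mul_assoc, auto simp: invertible_def)

lemma mat_mult_left: "mat c ** A = (\<chi> i j. c * A $ i $ j)" for A :: "'a::field ^ 2 ^ 2"
  by (simp add: matrix_matrix_mult_def mat_def vec_eq_iff forall_2 sum_2)

lemma mat_mult_right: "A ** mat c = (\<chi> i j. c * A $ i $ j)" for A :: "'a::field ^ 2 ^ 2"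
  by (simp add: matrix_matrix_mult_def mat_def vec_eq_iff forall_2 sum_2)

lemma mat_mult_mat: "mat c ** mat d = (mat (c * d) :: 'a::field ^ 2 ^ 2)"
  unfolding mat_mult_left by (simp add: mat_def vec_eq_iff forall_2)

lemma normal_scalars2: "scalars2 \<lhd> (GL2 :: ('a::field ^ 2 ^ 2) monoid)"
proof -
  interpret group "GL2 :: ('a ^ 2 ^ 2) monoid" by (rule group_GL2)
  have inv_mat: "mat c \<in> carrier GL2 \<and> inv\<^bsub>GL2\<^esub> (mat c) = (mat (inverse c) :: 'a ^ 2 ^ 2)"
    if "c \<noteq> 0" for c :: 'a
  proof -
    have ex: "mat c ** mat (inverse c) = (mat 1 :: 'a ^ 2 ^ 2)"
      "mat (inverse c) ** mat c = (mat 1 :: 'a ^ 2 ^ 2)"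
      using that by (simp_all add: mat_mult_mat)
    then have "mat c \<in> carrier (GL2 :: ('a ^ 2 ^ 2) monoid)"
      "mat (inverse c) \<in> carrier (GL2 :: ('a ^ 2 ^ 2) monoid)"
      unfolding GL2_def invertible_def by auto
    then show ?thesis
      using inv_equality[of "mat (inverse c)" "mat c"] ex by (simp add: GL2_def)
  qed
  have "subgroup scalars2 (GL2 :: ('a ^ 2 ^ 2) monoid)"
  proof
    show "\<one>\<^bsub>GL2\<^esub> \<in> (scalars2 :: ('a ^ 2 ^ 2) set)"
      unfolding scalars2_def GL2_def using zero_neq_one by force
  next
    fix x y :: "'a ^ 2 ^ 2" assume "x \<in> scalars2" "y \<in> scalars2"
    then obtain c d where "x = mat c" "c \<noteq> 0" "y = mat d" "d \<noteq> 0"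
      by (auto simp: scalars2_def)
    then show "x \<otimes>\<^bsub>GL2\<^esub> y \<in> scalars2"
      unfolding scalars2_def GL2_def by (auto simp: mat_mult_mat intro!: exI[of _ "c * d"])
  next
    fix x :: "'a ^ 2 ^ 2" assume "x \<in> scalars2"
    then obtain c where c: "x = mat c" "c \<noteq> 0"
      by (auto simp: scalars2_def)
    then show "inv\<^bsub>GL2\<^esub> x \<in> scalars2"
      using inv_mat[OF c(2)] unfolding scalars2_def by (auto intro!: exI[of _ "inverse c"])
  qed (use inv_mat in \<open>auto simp: scalars2_def\<close>)
  moreover have "scalars2 #>\<^bsub>GL2\<^esub> A = A <#\<^bsub>GL2\<^esub> scalars2" for A :: "'a ^ 2 ^ 2"
    by (auto simp: r_coset_def l_coset_def scalars2_def GL2_def mat_mult_left mat_mult_right)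
  ultimately show ?thesis
    by (simp add: normal_def normal_axioms_def group_GL2)
qed

section \<open>Homogeneous substitution\<close>

text \<open>\<open>hom_subst F u v\<close> is the polynomial \<open>v\<^bsup>deg F\<^esup> F(u/v)\<close>; see \<open>Fract_hom_subst\<close> below.\<close>

definition hom_subst :: "'a::field poly \<Rightarrow> 'a poly \<Rightarrow> 'a poly \<Rightarrow> 'a poly" where
  "hom_subst F u v = (\<Sum>i\<le>degree F. smult (coeff F i) (u ^ i * v ^ (degree F - i)))"

definition poly_at :: "'a::field poly \<Rightarrow> 'a poly fract \<Rightarrow> 'a poly fract" where
  "poly_at p R = (\<Sum>i\<le>degree p. Fract [:coeff p i:] 1 * R ^ i)"

lemma Fract_hom_subst:
  assumes "v \<noteq> 0"
  shows "Fract (hom_subst F u v) 1 = Fract v 1 ^ degree F * poly_at F (Fract u v)"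
proof -
  have add: "Fract (x + y) 1 = Fract x 1 + Fract y 1" for x y :: "'a poly"
    by simp
  have sum: "Fract (sum f A) 1 = (\<Sum>i\<in>A. Fract (f i) 1)" for f :: "nat \<Rightarrow> 'a poly" and A
    by (induction A rule: infinite_finite_induct)
      (simp_all add: Zero_fract_def add del: add_fract)
  have pow: "Fract x y ^ n = Fract (x ^ n) (y ^ n)" if "y \<noteq> 0" for x y :: "'a poly" and n
    using that by (induction n) (simp_all add: One_fract_def)
  show ?thesis
    unfolding hom_subst_def poly_at_def sum sum_distrib_left
  proof (rule sum.cong[OF refl])
    fix i assume "i \<in> {..degree F}"
    then have "v ^ degree F = v ^ i * v ^ (degree F - i)"
      by (simp flip: power_add)
    then show "Fract (smult (coeff F i) (u ^ i * v ^ (degree F - i))) 1 =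
      Fract v 1 ^ degree F * (Fract [:coeff F i:] 1 * Fract u v ^ i)"
      using assms by (simp add: pow eq_fract algebra_simps)
  qed
qed

section \<open>Actions of \<open>PGL\<^sub>2\<close>\<close>

text \<open>
  \<open>None\<close> stands for \<open>\<infinity>\<close>. As only the orbit of \<open>\<infinity>\<close> is needed, and it is contained in the projective
  line over the ground field, no algebraic closure is required.
\<close>

fun moebius :: "'a::field ^ 2 ^ 2 \<Rightarrow> 'a option \<Rightarrow> 'a option" where
  "moebius A None = (if A $ 2 $ 1 = 0 then None else Some (A $ 1 $ 1 / A $ 2 $ 1))"
| "moebius A (Some v) =
    (if A $ 2 $ 1 * v + A $ 2 $ 2 = 0 then None
     else Some ((A $ 1 $ 1 * v + A $ 1 $ 2) / (A $ 2 $ 1 * v + A $ 2 $ 2)))"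

definition moebius_x :: "'a::field ^ 2 ^ 2 \<Rightarrow> 'a poly fract" where
  "moebius_x A = Fract [:A $ 1 $ 2, A $ 1 $ 1:] [:A $ 2 $ 2, A $ 2 $ 1:]"

definition poly_act :: "'a::field ^ 2 ^ 2 \<Rightarrow> 'a poly \<Rightarrow> 'a poly" where
  "poly_act A f =
    (let p = hom_subst f [:A $ 1 $ 2, A $ 1 $ 1:] [:A $ 2 $ 2, A $ 2 $ 1:]
     in smult (inverse (lead_coeff p)) p)"

definition poly_orbit :: "('a::field ^ 2 ^ 2) set set \<Rightarrow> 'a poly \<Rightarrow> 'a poly set" where
  "poly_orbit G r = {poly_act A r |A. A \<in> carrier GL2 \<and> pgl_class A \<in> G}"

definition infinity_orbit :: "('a::field ^ 2 ^ 2) set set \<Rightarrow> 'a option set" where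
  "infinity_orbit G = {moebius A None |A. A \<in> carrier GL2 \<and> pgl_class A \<in> G}"

section \<open>Irreducible polynomials and orbit counts\<close>

definition monic_irreds :: "'a::field poly set" where
  "monic_irreds = {f. lead_coeff f = 1 \<and> irreducible f}"

definition monic_irreds_deg :: "nat \<Rightarrow> 'a::field poly set" where
  "monic_irreds_deg n = {f \<in> monic_irreds. degree f = n}"

definition num_irreds :: "'a::field itself \<Rightarrow> nat \<Rightarrow> nat" where
  "num_irreds TYPE('a) n = card (monic_irreds_deg n :: 'a poly set)"

definition monic_irreds_off :: "('a::field ^ 2 ^ 2) set set \<Rightarrow> 'a poly set" where
  "monic_irreds_off G = {r \<in> monic_irreds. \<forall>v. Some v \<in> infinity_orbit G \<longrightarrow> poly r v \<noteq> 0}"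

definition orbit_count :: "('a::field ^ 2 ^ 2) set set \<Rightarrow> nat \<Rightarrow> nat \<Rightarrow> nat" where
  "orbit_count G n k =
    card {poly_orbit G r |r. r \<in> monic_irreds_deg n \<and> card (poly_orbit G r) = k}"

section \<open>Quotient maps and \<open>d(G)\<close>\<close>

text \<open>
  The value of a rational function \<open>p/s\<close> at the non-constant rational function \<open>moebius_x A\<close> does
  not depend on the representation \<open>p/s\<close>, and the denominator does not vanish there.
\<close>

definition invariant_field :: "('a::field ^ 2 ^ 2) set set \<Rightarrow> 'a poly fract set" where
  "invariant_field G =
    {Fract p s |p s. s \<noteq> 0 \<and>
      (\<forall>A\<in>carrier GL2. pgl_class A \<in> G \<longrightarrow>
        poly_at p (moebius_x A) / poly_at s (moebius_x A) = Fract p s)}"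

definition generated_field :: "'a::field poly fract \<Rightarrow> 'a poly fract set" where
  "generated_field Q = {poly_at p Q / poly_at s Q |p s. poly_at s Q \<noteq> 0}"

definition is_quotient_map ::
    "('a::field ^ 2 ^ 2) set set \<Rightarrow> 'a poly \<Rightarrow> 'a poly \<Rightarrow> bool" where
  "is_quotient_map G g h \<longleftrightarrow>
    coprime g h \<and> h \<noteq> 0 \<and> lead_coeff g = 1 \<and> degree g = card G \<and> degree h < degree g \<and>
    invariant_field G = generated_field (Fract g h)"

definition ramified_degrees ::
    "('a::field ^ 2 ^ 2) set set \<Rightarrow> 'a poly \<Rightarrow> 'a poly \<Rightarrow> nat set" where
  "ramified_degrees G g h =
    {degree F |F. F \<in> monic_irreds \<and>
      (\<exists>r\<in>monic_irreds_off G. \<exists>k::nat. k > 1 \<and> hom_subst F g h = (\<Prod>t\<in>poly_orbit G r. t) ^ k)}"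

text \<open>
  Quotient maps exist for all subgroups of \<open>PGL\<^sub>2\<close> over a finite field, and the set of degrees does
  not depend on which of them is chosen.
\<close>

definition d_of :: "('a::field ^ 2 ^ 2) set set \<Rightarrow> nat" where
  "d_of G =
    (let (g, h) = (SOME (g, h). is_quotient_map G g h); D = ramified_degrees G g h
     in if D = {} then 0 else Max D)"

end

theory Submission
  imports Defs "HOL-Computational_Algebra.Polynomial_Factorial"
begin

text \<open>
  For a quotient map \<open>Q = g/h\<close> the monic irreducible divisors of \<open>F\<^bsup>Q\<^esup>\<close> form a single orbit of
  polynomials prime to \<open>h\<close>, and \<open>F\<close> is determined by any one of them. So \<open>F\<close> corresponds to an
  orbit, and comparing degrees in \<open>F\<^bsup>Q\<^esup> = (\<Prod>G * r)\<^sup>k\<close> gives the theorem as long as \<open>k = 1\<close>.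
  All this follows from two facts: the polynomial \<open>g(Y) - Q h(Y)\<close> is the product of the \<open>Y - A \<circ> x\<close>
  over the group, and consequently every invariant rational function is a function of \<open>Q\<close>.
  Differentiating that product at \<open>Y = x\<close> shows that \<open>k > 1\<close> happens exactly when the orbit consists of
  divisors of the Wronskian \<open>g' h - g h'\<close>; there are finitely many of these, which makes the maximum in
  \<open>d_of\<close> well defined. A linear polynomial with root in the orbit of \<open>\<infinity>\<close> does not take part in the
  correspondence, and has to be excluded separately when \<open>m = 1\<close>.
\<close>

section \<open>Polynomials over finite fields\<close>

text \<open>\<open>d_of\<close> selects a quotient map by \<open>SOME\<close> and takes a maximum,
  so the existence of quotient maps and the finiteness of the set of ramified degrees are part of
  the proof. The argument stays inside F_q(x): a polynomial over F_q(x) of degree below |G| that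
  vanishes at all the |G| elements A \<circ> x is zero. To apply this to an invariant S, one writes
  S = c(x) with deg c < |G| and coefficients in K = F_q(Q). This is possible because K[x] is already
  the whole field: an irreducible r divides h or some \<open>h ^ deg F * F(Q)\<close>, and both of
  these are invertible in K[x]. Such an F is the minimal polynomial of the residue of Q modulo r,
  and finiteness of the field provides it by the pigeonhole principle. The technical obstacle is
  loss of degree: the formula for A * f drops the degree when A \<circ> \<infinity> is a root of f.
  Among irreducible polynomials only linear ones can suffer this, and away from them the formula is
  a genuine group action.\<close>

lemma bezout_poly:
  fixes p q :: "'a::field poly"
  assumes "coprime p q"
  obtains a b where "a * p + b * q = 1"
proof -
  have "\<exists>a b. a * p + b * q = 1" using assms
  \<comment> \<open>The measure ranks the zero polynomial below the nonzero constants, so that the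
    last step of the Euclidean algorithm decreases it too.\<close>
  proof (induction "if q = 0 then 0 else Suc (degree q)" arbitrary: p q rule: less_induct)
    case less
    show ?case
    proof (cases "q = 0")
      case True
      then have "p dvd 1" using less.prems by simp
      then obtain c where "1 = p * c" by (elim dvdE)
      then show ?thesis using True by (metis add.right_neutral mult.commute mult_zero_right)
    next
      case False
      have "coprime q (p mod q)"
        using less.prems by (metis False coprime_commute coprime_mod_left_iff)
      moreover have "p mod q = 0 \<or> degree (p mod q) < degree q"
        using False degree_mod_less by blast
      ultimately have "\<exists>a b. a * q + b * (p mod q) = 1"
        using less.hyps[of "p mod q" q] False by auto
      then obtain a b where ab: "a * q + b * (p mod q) = 1" by blast
      have "p mod q = p - q * (p div q)"
        by (simp add: minus_mult_div_eq_mod)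
      then have "b * p + (a - b * (p div q)) * q = 1"
        using ab by algebra
      then show ?thesis by blast
    qed
  qed
  then show ?thesis using that by blast
qed

lemma not_dvd_imp_coprime:
  fixes r p :: "'a::field poly"
  assumes "irreducible r" "\<not> r dvd p"
  shows "coprime r p"
proof (rule coprimeI)
  fix c assume "c dvd r" "c dvd p"
  then show "is_unit c" using assms
    by (metis dvdE dvd_trans irreducibleD mult_unit_dvd_iff dvd_refl)
qed

lemma exists_monic_irreducible_factor:
  fixes p :: "'a::field poly"
  assumes "degree p > 0"
  obtains r where "r \<in> monic_irreds" "r dvd p"
proof -
  have "\<exists>r. r \<in> monic_irreds \<and> r dvd p" using assms
  proof (induction "degree p" arbitrary: p rule: less_induct)
    case less
    then have p0: "p \<noteq> 0" by auto
    show ?case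
    proof (cases "irreducible p")
      case True
      let ?r = "smult (inverse (lead_coeff p)) p"
      have "irreducible ?r"
      proof -
        have "?r = [:inverse (lead_coeff p):] * p" by simp
        moreover have "is_unit [:inverse (lead_coeff p):]"
          using p0 by (simp add: is_unit_const_poly_iff dvd_field_iff)
        ultimately show ?thesis using True irreducible_mult_unit_left by metis
      qed
      then show ?thesis using p0 by (intro exI[of _ ?r]) (auto simp: monic_irreds_def smult_dvd_iff)
    next
      case False
      have "\<not> is_unit p" using less.prems by (simp add: is_unit_iff_degree p0)
      then obtain a b where ab: "p = a * b" "\<not> is_unit a" "\<not> is_unit b"
        using False p0 unfolding irreducible_def by auto
      then have "degree a > 0" "degree b > 0" "degree p = degree a + degree b"
        using p0 by (auto simp: is_unit_iff_degree degree_mult_eq)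
      then show ?thesis using less.hyps[of a] ab by auto
    qed
  qed
  then show ?thesis using that by blast
qed

lemma monic_irreds_degree_pos: "r \<in> monic_irreds \<Longrightarrow> degree r > 0"
  by (auto simp: monic_irreds_def irreducible_def is_unit_iff_degree)

lemma monic_irreds_prime: "r \<in> monic_irreds \<Longrightarrow> prime_elem r"
  by (simp add: monic_irreds_def field_poly_irreducible_imp_prime)

lemma monic_irreds_dvd_eq:
  assumes "r \<in> monic_irreds" "s \<in> monic_irreds" "r dvd s"
  shows "r = s"
proof -
  obtain c where c: "s = r * c" using assms by (elim dvdE)
  have "\<not> is_unit r" using assms by (auto simp: monic_irreds_def irreducible_def)
  then have "is_unit c" using assms(2) c irreducibleD unfolding monic_irreds_def by blast
  then obtain d where d: "c = [:d:]" by (meson is_unit_polyE)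
  have "lead_coeff s = lead_coeff r * lead_coeff c" using c by (simp add: lead_coeff_mult)
  then have "d = 1" using assms d by (simp add: monic_irreds_def)
  then show ?thesis using c d by simp
qed

lemma finite_degree_less: "finite {p :: 'a::{finite,zero} poly. degree p < n}"
proof -
  have "{p :: 'a poly. degree p < n} \<subseteq> Poly ` {xs. set xs \<subseteq> UNIV \<and> length xs \<le> n}"
  proof
    fix p :: "'a poly" assume "p \<in> {p. degree p < n}"
    then have "length (coeffs p) \<le> n"
      by (cases "p = 0") (auto simp: length_coeffs_degree)
    then show "p \<in> Poly ` {xs. set xs \<subseteq> UNIV \<and> length xs \<le> n}"
      by (intro image_eqI[of _ _ "coeffs p"]) auto
  qed
  then show ?thesis
    using finite_surj[OF finite_lists_length_le[of "UNIV :: 'a set" n]] by simp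
qed

lemma finite_divisors_poly:
  fixes p :: "'a::{finite,field} poly"
  assumes "p \<noteq> 0"
  shows "finite {r. r dvd p}"
  by (rule finite_subset[OF _ finite_degree_less[of "Suc (degree p)"]])
    (auto simp: assms dvd_imp_degree_le less_Suc_eq_le)

text \<open>Pigeonhole on the finitely many residues modulo \<open>r\<close>. As \<open>w\<close>
  may be a non-unit modulo \<open>r\<close>, the repetition need not start at exponent 0.\<close>

lemma powers_repeat_mod:
  fixes r w :: "'a::{finite,field} poly"
  assumes "r \<noteq> 0"
  obtains i j where "i < j" "r dvd w ^ j - w ^ i"
proof -
  have "finite (range (\<lambda>i::nat. w ^ i mod r))"
  proof (rule finite_subset)
    show "range (\<lambda>i::nat. w ^ i mod r) \<subseteq> insert 0 {p. degree p < degree r}"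
      using degree_mod_less[OF assms] by blast
  qed (use finite_degree_less in auto)
  then have "\<not> inj (\<lambda>i::nat. w ^ i mod r)"
    using finite_imageD by auto
  then obtain i j where "w ^ i mod r = w ^ j mod r" "i \<noteq> j"
    by (auto simp: inj_def)
  then have "r dvd w ^ j - w ^ i" "r dvd w ^ i - w ^ j" "i \<noteq> j"
    by (metis mod_eq_dvd_iff)+
  then show ?thesis using that by (meson nat_neq_iff)
qed

text \<open>\<open>F\<close> divides some \<open>X\<^sup>N - 1\<close>; for the least such \<open>N\<close> the characteristic does not divide \<open>N\<close>, so
  \<open>X\<^sup>N - 1\<close> has no multiple factors.\<close>

lemma irreducible_pderiv_nonzero:
  fixes F :: "'a::{finite,field} poly"
  assumes F: "irreducible F"
  shows "pderiv F \<noteq> 0"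
proof
  assume F': "pderiv F = 0"
  let ?X = "[:0, 1:] :: 'a poly"
  have prime: "prime_elem F" using F by (rule field_poly_irreducible_imp_prime)
  have notX: "\<not> F dvd ?X"
  proof
    assume "F dvd ?X"
    then obtain c where c: "?X = F * c" by (elim dvdE)
    have "irreducible ?X" by (rule irreducible_linear_field_poly) simp
    then have "is_unit c" using c irreducibleD F irreducible_not_unit by blast
    then obtain d where "c = [:d:]" by (meson is_unit_polyE)
    then have "pderiv ?X = 0" using c F' by (simp add: pderiv_smult)
    then show False by (simp add: pderiv_pCons)
  qed
  then have notXn: "\<not> F dvd ?X ^ k" for k
    using prime prime_elem_dvd_power by blast
  obtain i j :: nat where ij: "i < j" "F dvd ?X ^ j - ?X ^ i"
    using powers_repeat_mod F irreducible_def by metis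
  have "?X ^ j - ?X ^ i = ?X ^ i * (?X ^ (j - i) - 1)"
    using ij by (simp add: algebra_simps flip: power_add)
  then have ex: "\<exists>n>0. F dvd ?X ^ n - 1"
    using ij notXn prime by (metis prime_elem_dvd_multD zero_less_diff)
  define N where "N = (LEAST n. n > 0 \<and> F dvd ?X ^ n - 1)"
  have N: "N > 0" "F dvd ?X ^ N - 1" and least: "\<And>n. n > 0 \<Longrightarrow> F dvd ?X ^ n - 1 \<Longrightarrow> N \<le> n"
    using LeastI_ex[OF ex] Least_le[of "\<lambda>n. n > 0 \<and> F dvd ?X ^ n - 1"] by (auto simp: N_def)
  have char: "prime CHAR('a)"
    by (intro prime_CHAR_semidom finite_imp_CHAR_pos) simp
  have "of_nat N \<noteq> (0::'a)"
  proof
    assume "of_nat N = (0::'a)"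
    then obtain n where n: "N = n * CHAR('a)"
      by (metis of_nat_eq_0_iff_char_dvd dvdE mult.commute)
    \<comment> \<open>With p the characteristic and N = n p, Frobenius makes X^N - 1 the p-th power
      of X^n - 1, so the prime \<open>F\<close> already divides the latter, against the minimality
      of \<open>N\<close>.\<close>
    have "(?X ^ n - 1 + 1) ^ CHAR('a) = (?X ^ n - 1) ^ CHAR('a) + 1 ^ CHAR('a)"
      using char by (intro freshmans_dream) simp_all
    then have "?X ^ N - 1 = (?X ^ n - 1) ^ CHAR('a)"
      by (simp add: n power_mult)
    then have "F dvd ?X ^ n - 1" using N prime prime_elem_dvd_power by metis
    moreover have "n > 0" using N n by (cases n) auto
    ultimately have "N \<le> n" by (rule least[rotated])
    moreover have "CHAR('a) \<ge> 2" using char by (simp add: prime_ge_2_nat)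
    ultimately show False using \<open>n > 0\<close> n by (cases "CHAR('a)") auto
  qed
  obtain t where t: "?X ^ N - 1 = F * t" using N by (elim dvdE)
  have "pderiv (?X ^ N - 1) = smult (of_nat N) (?X ^ (N - 1))"
  proof -
    obtain k where k: "N = Suc k" using N(1) gr0_implies_Suc by blast
    have "pderiv ?X = 1" by (simp add: pderiv_pCons)
    then show ?thesis unfolding k by (simp only: pderiv_diff pderiv_power_Suc) simp
  qed
  moreover have "pderiv (?X ^ N - 1) = F * pderiv t"
    unfolding t by (simp add: pderiv_mult F')
  ultimately have "F dvd smult (of_nat N) (?X ^ (N - 1))" by (metis dvd_triv_left)
  then have "F dvd ?X ^ (N - 1)"
    using \<open>of_nat N \<noteq> 0\<close> by (simp add: dvd_smult_iff)
  then show False using notXn by blast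
qed

section \<open>Evaluation in the field of rational functions\<close>

abbreviation const_fract :: "'a::field \<Rightarrow> 'a poly fract" where
  "const_fract c \<equiv> to_fract [:c:]"

abbreviation fract_X :: "'a::field poly fract" where
  "fract_X \<equiv> to_fract [:0, 1:]"

lemma const_fract_add: "const_fract (c + d) = const_fract c + const_fract d"
  by (simp flip: to_fract_add)

lemma const_fract_mult: "const_fract (c * d) = const_fract c * const_fract d"
  by (simp flip: to_fract_mult)

lemma const_fract_one [simp]: "const_fract 1 = 1"
  by (simp flip: one_pCons)

lemma to_fract_power [simp]: "to_fract (p ^ n) = to_fract p ^ n"
  by (induction n) simp_all

lemma to_fract_prod: "to_fract (\<Prod>x\<in>A. f x) = (\<Prod>x\<in>A. to_fract (f x))"
  by (induction A rule: infinite_finite_induct) simp_all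

lemma to_fract_cases:
  obtains p s where "s \<noteq> 0" "R = to_fract p / to_fract s"
  by (metis Fract_cases_nonzero Fract_conv_to_fract div_0 one_neq_zero to_fract_0)

text \<open>Regards \<open>p\<close> as a polynomial in a new variable Y over F_q(x), where its
  roots in F_q(x) can be discussed.\<close>

definition poly_const :: "'a::field poly \<Rightarrow> 'a poly fract poly" where
  "poly_const p = map_poly const_fract p"

lemma coeff_poly_const: "coeff (poly_const p) i = const_fract (coeff p i)"
  by (simp add: poly_const_def coeff_map_poly)

lemma degree_poly_const [simp]: "degree (poly_const p) = degree p"
  by (simp add: poly_const_def degree_map_poly)

lemma poly_poly_const: "poly (poly_const p) R = poly_at p R"
  by (simp add: poly_altdef poly_at_def coeff_poly_const to_fract_def)

lemma poly_at_0 [simp]: "poly_at 0 R = 0"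
  by (simp add: poly_at_def to_fract_def[symmetric])

lemma poly_at_const [simp]: "poly_at [:c:] R = const_fract c"
  by (simp add: poly_at_def to_fract_def)

lemma poly_at_1 [simp]: "poly_at 1 R = 1"
  by (simp add: one_pCons)

lemma poly_at_pCons: "poly_at (pCons c p) R = const_fract c + R * poly_at p R"
proof -
  have "poly_const (pCons c p) = pCons (const_fract c) (poly_const p)"
    by (simp add: poly_const_def map_poly_pCons)
  then show ?thesis by (simp flip: poly_poly_const)
qed

lemma poly_at_add: "poly_at (p + q) R = poly_at p R + poly_at q R"
  by (induction p q rule: poly_induct2)
    (simp_all add: poly_at_pCons const_fract_add algebra_simps del: to_fract_eq_iff)

lemma poly_at_smult: "poly_at (smult c p) R = const_fract c * poly_at p R"
  by (induction p) (simp_all add: poly_at_pCons const_fract_mult algebra_simps)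

lemma poly_at_mult: "poly_at (p * q) R = poly_at p R * poly_at q R"
  by (induction p) (simp_all add: poly_at_pCons poly_at_add poly_at_smult algebra_simps)

lemma poly_at_minus: "poly_at (- p) R = - poly_at p R"
  using poly_at_add[of p "- p" R] by (simp add: eq_neg_iff_add_eq_0 add.commute)

lemma poly_at_diff: "poly_at (p - q) R = poly_at p R - poly_at q R"
  using poly_at_add[of p "- q" R] by (simp add: poly_at_minus)

lemma poly_at_power: "poly_at (p ^ n) R = poly_at p R ^ n"
  by (induction n) (simp_all add: poly_at_mult)

lemma poly_at_X [simp]: "poly_at p fract_X = to_fract p"
  by (induction p) (simp_all add: poly_at_pCons flip: to_fract_mult to_fract_add)

lemma to_fract_hom_subst:
  assumes "v \<noteq> 0"
  shows "to_fract (hom_subst F u v) = to_fract v ^ degree F * poly_at F (to_fract u / to_fract v)"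
  using Fract_hom_subst[OF assms, of F u] by (simp add: to_fract_def[symmetric] Fract_conv_to_fract)

lemma hom_subst_mult:
  assumes "v \<noteq> 0"
  shows "hom_subst (p * q) u v = hom_subst p u v * hom_subst q u v"
proof (cases "p = 0 \<or> q = 0")
  case False
  then have "to_fract (hom_subst (p * q) u v) = to_fract (hom_subst p u v * hom_subst q u v)"
    by (simp add: to_fract_hom_subst assms poly_at_mult degree_mult_eq power_add)
  then show ?thesis by (simp only: to_fract_eq_iff)
qed (auto simp: hom_subst_def)

lemma hom_subst_const [simp]: "hom_subst [:c:] u v = [:c:]"
  by (simp add: hom_subst_def)

lemma hom_subst_1 [simp]: "hom_subst 1 u v = 1"
  by (simp add: one_pCons)

lemma hom_subst_smult: "v \<noteq> 0 \<Longrightarrow> hom_subst (smult c p) u v = smult c (hom_subst p u v)"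
  using hom_subst_mult[of v "[:c:]" p u] by simp

lemma hom_subst_power: "v \<noteq> 0 \<Longrightarrow> hom_subst (p ^ n) u v = hom_subst p u v ^ n"
  by (induction n) (simp_all add: hom_subst_mult)

lemma hom_subst_dvd: "v \<noteq> 0 \<Longrightarrow> p dvd q \<Longrightarrow> hom_subst p u v dvd hom_subst q u v"
  by (auto simp: hom_subst_mult elim!: dvdE)

text \<open>Every term but the leading one carries a positive power of \<open>v\<close>.\<close>

lemma hom_subst_cong_denominator: "v dvd hom_subst p u v - smult (lead_coeff p) (u ^ degree p)"
proof -
  have "hom_subst p u v = smult (lead_coeff p) (u ^ degree p) +
    (\<Sum>i<degree p. smult (coeff p i) (u ^ i * v ^ (degree p - i)))"
    unfolding hom_subst_def by (simp add: lessThan_Suc_atMost[symmetric] add.commute)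
  moreover have "v dvd (\<Sum>i<degree p. smult (coeff p i) (u ^ i * v ^ (degree p - i)))"
    by (intro dvd_sum dvd_smult dvd_mult) (auto simp: dvd_power)
  ultimately show ?thesis by simp
qed

lemma hom_subst_pCons:
  assumes "p \<noteq> 0"
  shows "hom_subst (pCons c p) u v = smult c (v ^ Suc (degree p)) + u * hom_subst p u v"
  using assms by (simp add: hom_subst_def sum.atMost_Suc_shift sum_distrib_left del: sum.atMost_Suc)
   (simp add: algebra_simps)

lemma coprime_power_right_poly:
  fixes u v :: "'a::field poly"
  assumes "coprime u v"
  shows "coprime u (v ^ n)"
proof -
  obtain a b where "a * u + b * v = 1" using bezout_poly assms by blast
  then have "\<exists>a b. a * u + b * v ^ n = 1"
  proof (induction n)
    case (Suc n)
    then obtain c d where "c * u + d * v ^ n = 1" by blast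
    have "(c + d * v ^ n * a) * u + (d * b) * v ^ Suc n = c * u + d * v ^ n * (a * u + b * v)"
      by (simp add: algebra_simps)
    then have "(c + d * v ^ n * a) * u + (d * b) * v ^ Suc n = 1"
      using Suc.prems \<open>c * u + d * v ^ n = 1\<close> by simp
    then show ?case by blast
  qed (use mult_1 add_0 mult_zero_left power_0 in metis)
  then obtain c d where "c * u + d * v ^ n = 1" by blast
  then show ?thesis by (intro coprimeI) (metis dvd_add dvd_mult)
qed

text \<open>This is the transcendence of u/v. If \<open>v\<close> is not a unit, it would divide a
  power of \<open>u\<close> by the congruence above. If \<open>v\<close> is a unit, then
  \<open>u\<close> is nonconstant, and dividing by \<open>u\<close> again and again makes the
  coefficients of \<open>p\<close> vanish from the lowest one upwards.\<close>

lemma hom_subst_nonzero: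
  assumes "coprime u v" "degree u > 0 \<or> degree v > 0" "p \<noteq> 0"
  shows "hom_subst p u v \<noteq> 0"
proof
  assume 0: "hom_subst p u v = 0"
  show False
  proof (cases "is_unit v")
    case False
    have "v dvd smult (lead_coeff p) (u ^ degree p)"
      using hom_subst_cong_denominator[of v p u] 0 by simp
    then have "v dvd u ^ degree p" using assms by (simp add: dvd_smult_iff)
    moreover have "coprime v (u ^ degree p)"
      using assms(1) by (simp add: coprime_commute coprime_power_right_poly)
    ultimately show False using False coprime_absorb_left by blast
  next
    case True
    then have u: "degree u > 0"
      using assms(2) by (metis is_unit_iff_degree not_is_unit_0 not_gr_zero)
    then have "\<not> is_unit u" "u \<noteq> 0"
      by (metis is_unit_iff_degree not_is_unit_0 less_irrefl, auto)
    have "p = 0" if "hom_subst p u v = 0" for p using that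
    proof (induction p)
      case (pCons c p)
      show ?case
      proof (cases "p = 0")
        case False
        have eq: "smult c (v ^ Suc (degree p)) = - (u * hom_subst p u v)"
          using pCons.prems by (simp only: hom_subst_pCons[OF False] eq_neg_iff_add_eq_0)
        then have "u dvd smult c (v ^ Suc (degree p))" by simp
        moreover have "is_unit (v ^ Suc (degree p))" using True by (rule is_unit_power_iff[THEN iffD2, OF disjI1])
        ultimately have "c = 0"
          using \<open>\<not> is_unit u\<close> by (metis dvd_smult_iff dvd_unit_imp_unit)
        then have "u * hom_subst p u v = 0" using eq by simp
        then show ?thesis using pCons.IH \<open>c = 0\<close> \<open>u \<noteq> 0\<close> by simp
      qed (use pCons.prems in simp)
    qed simp
    then show False using assms 0 by blast
  qed
qed

section \<open>Substitution of transcendental elements\<close>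

definition transcendental :: "'a::field poly fract \<Rightarrow> bool" where
  "transcendental R \<longleftrightarrow> (\<forall>p. poly_at p R = 0 \<longrightarrow> p = 0)"

lemma transcendentalD: "transcendental R \<Longrightarrow> poly_at p R = 0 \<longleftrightarrow> p = 0"
  by (auto simp: transcendental_def)

lemma transcendental_quotient:
  assumes "coprime u v" "degree u > 0 \<or> degree v > 0" "v \<noteq> 0"
  shows "transcendental (to_fract u / to_fract v)"
  unfolding transcendental_def
proof (intro allI impI)
  fix p assume "poly_at p (to_fract u / to_fract v) = 0"
  then have "hom_subst p u v = 0"
    using to_fract_hom_subst[OF assms(3), of p u] by simp
  then show "p = 0" using hom_subst_nonzero assms by blast
qed

text \<open>The value of \<open>S\<close> at \<open>R\<close>; meaningful for transcendental \<open>R\<close> only, since otherwise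
  the value depends on the fraction chosen to represent \<open>S\<close>.\<close>

definition fract_subst :: "'a::field poly fract \<Rightarrow> 'a poly fract \<Rightarrow> 'a poly fract" where
  "fract_subst R S = (THE T. \<forall>p s. s \<noteq> 0 \<longrightarrow> S = to_fract p / to_fract s \<longrightarrow> T = poly_at p R / poly_at s R)"

lemma fract_subst_quotient:
  assumes R: "transcendental R" and "s \<noteq> 0"
  shows "fract_subst R (to_fract p / to_fract s) = poly_at p R / poly_at s R"
  unfolding fract_subst_def
proof (rule the_equality)
  show "\<forall>p' s'. s' \<noteq> 0 \<longrightarrow> to_fract p / to_fract s = to_fract p' / to_fract s' \<longrightarrow>
      poly_at p R / poly_at s R = poly_at p' R / poly_at s' R"
  proof (intro allI impI)
    fix p' s' :: "'a poly"
    assume s': "s' \<noteq> 0" "to_fract p / to_fract s = to_fract p' / to_fract s'"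
    then have "to_fract (p * s') = to_fract (p' * s)"
      using assms by (simp add: divide_simps split: if_splits)
    then have "p * s' = p' * s" by (simp only: to_fract_eq_iff)
    then have "poly_at p R * poly_at s' R = poly_at p' R * poly_at s R"
      by (metis poly_at_mult)
    then show "poly_at p R / poly_at s R = poly_at p' R / poly_at s' R"
      using transcendentalD[OF R] assms s' by (simp add: frac_eq_eq)
  qed
qed (use assms in blast)

lemma fract_subst_to_fract: "transcendental R \<Longrightarrow> fract_subst R (to_fract p) = poly_at p R"
  using fract_subst_quotient[of R 1 p] by simp

lemma fract_subst_0 [simp]: "transcendental R \<Longrightarrow> fract_subst R 0 = 0"
  using fract_subst_to_fract[of R 0] by simp

lemma fract_subst_1 [simp]: "transcendental R \<Longrightarrow> fract_subst R 1 = 1"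
  using fract_subst_to_fract[of R 1] by simp

lemma fract_subst_mult:
  assumes R: "transcendental R"
  shows "fract_subst R (S * T) = fract_subst R S * fract_subst R T"
proof -
  obtain p s where s: "s \<noteq> 0" "S = to_fract p / to_fract s" by (rule to_fract_cases)
  obtain q t where t: "t \<noteq> 0" "T = to_fract q / to_fract t" by (rule to_fract_cases)
  have "S * T = to_fract (p * q) / to_fract (s * t)" using s t by simp
  then show ?thesis
    using s t fract_subst_quotient[OF R, of "s * t" "p * q"]
    by (simp add: fract_subst_quotient[OF R] poly_at_mult del: to_fract_mult)
qed

lemma fract_subst_add:
  assumes R: "transcendental R"
  shows "fract_subst R (S + T) = fract_subst R S + fract_subst R T"
proof -
  obtain p s where s: "s \<noteq> 0" "S = to_fract p / to_fract s" by (rule to_fract_cases)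
  obtain q t where t: "t \<noteq> 0" "T = to_fract q / to_fract t" by (rule to_fract_cases)
  have "S + T = to_fract (p * t + q * s) / to_fract (s * t)" using s t by (simp add: add_frac_eq)
  then have "fract_subst R (S + T) = poly_at (p * t + q * s) R / poly_at (s * t) R"
    using s t by (simp only: fract_subst_quotient[OF R] mult_eq_0_iff simp_thms)
  also have "\<dots> = poly_at p R / poly_at s R + poly_at q R / poly_at t R"
    using s t transcendentalD[OF R] by (simp add: poly_at_mult poly_at_add field_simps)
  finally show ?thesis using s t by (simp add: fract_subst_quotient[OF R])
qed

lemma fract_subst_eq_0_iff:
  assumes R: "transcendental R"
  shows "fract_subst R S = 0 \<longleftrightarrow> S = 0"
proof -
  obtain p s where s: "s \<noteq> 0" "S = to_fract p / to_fract s" by (rule to_fract_cases)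
  then show ?thesis by (simp add: fract_subst_quotient[OF R] transcendentalD[OF R])
qed

lemma fract_subst_minus: "transcendental R \<Longrightarrow> fract_subst R (- S) = - fract_subst R S"
  using fract_subst_add[of R S "- S"] by (simp add: eq_neg_iff_add_eq_0 add.commute)

lemma fract_subst_diff: "transcendental R \<Longrightarrow> fract_subst R (S - T) = fract_subst R S - fract_subst R T"
  using fract_subst_add[of R S "- T"] by (simp add: fract_subst_minus)

lemma fract_subst_inj: "transcendental R \<Longrightarrow> inj (fract_subst R)"
  by (rule injI) (metis fract_subst_diff fract_subst_eq_0_iff right_minus_eq)

lemma fract_subst_divide:
  assumes "transcendental R"
  shows "fract_subst R (S / T) = fract_subst R S / fract_subst R T"
proof (cases "T = 0")
  case False
  have "fract_subst R (S / T) * fract_subst R T = fract_subst R S"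
    using False by (simp flip: fract_subst_mult[OF assms])
  then show ?thesis using False fract_subst_eq_0_iff[OF assms] by (simp add: field_simps)
qed (simp add: assms)

lemma fract_subst_power: "transcendental R \<Longrightarrow> fract_subst R (S ^ n) = fract_subst R S ^ n"
  by (induction n) (simp_all add: fract_subst_mult)

lemma fract_subst_prod:
  "transcendental R \<Longrightarrow> fract_subst R (\<Prod>x\<in>A. f x) = (\<Prod>x\<in>A. fract_subst R (f x))"
  by (induction A rule: infinite_finite_induct) (simp_all add: fract_subst_mult)

lemma fract_subst_poly_at:
  assumes "transcendental R"
  shows "fract_subst R (poly_at p S) = poly_at p (fract_subst R S)"
  by (induction p) (simp_all add: assms poly_at_pCons fract_subst_add fract_subst_mult fract_subst_to_fract)

lemma fract_subst_comp:
  assumes "transcendental R" "transcendental S"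
  shows "fract_subst R (fract_subst S T) = fract_subst (fract_subst R S) T"
proof -
  obtain p s where s: "s \<noteq> 0" "T = to_fract p / to_fract s" by (rule to_fract_cases)
  have "transcendental (fract_subst R S)"
    unfolding transcendental_def
    using assms by (metis fract_subst_poly_at fract_subst_eq_0_iff transcendentalD)
  then show ?thesis
    using s assms by (simp add: fract_subst_to_fract fract_subst_divide fract_subst_poly_at)
qed

lemma fract_subst_X [simp]: "fract_subst fract_X S = S"
proof -
  obtain p s where s: "s \<noteq> 0" "S = to_fract p / to_fract s" by (rule to_fract_cases)
  have "transcendental (fract_X :: 'a poly fract)" by (simp add: transcendental_def)
  then show ?thesis using s by (simp add: fract_subst_quotient)
qed

section \<open>Moebius substitutions\<close>

abbreviation num :: "'a::field ^ 2 ^ 2 \<Rightarrow> 'a poly" where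
  "num A \<equiv> [:A $ 1 $ 2, A $ 1 $ 1:]"

abbreviation den :: "'a::field ^ 2 ^ 2 \<Rightarrow> 'a poly" where
  "den A \<equiv> [:A $ 2 $ 2, A $ 2 $ 1:]"

abbreviation hsub :: "'a::field ^ 2 ^ 2 \<Rightarrow> 'a poly \<Rightarrow> 'a poly" where
  "hsub A p \<equiv> hom_subst p (num A) (den A)"

abbreviation fsub :: "'a::field ^ 2 ^ 2 \<Rightarrow> 'a poly fract \<Rightarrow> 'a poly fract" where
  "fsub A \<equiv> fract_subst (moebius_x A)"

text \<open>In \<open>PGL\<^sub>2\<close> the adjugate is the inverse.\<close>

definition adj2 :: "'a::field ^ 2 ^ 2 \<Rightarrow> 'a ^ 2 ^ 2" where
  "adj2 A = (\<chi> i j. if i = 1 then (if j = 1 then A $ 2 $ 2 else - A $ 1 $ 2)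
                      else (if j = 1 then - A $ 2 $ 1 else A $ 1 $ 1))"

lemma adj2_nth:
  "adj2 A $ 1 $ 1 = A $ 2 $ 2" "adj2 A $ 1 $ 2 = - A $ 1 $ 2"
  "adj2 A $ 2 $ 1 = - A $ 2 $ 1" "adj2 A $ 2 $ 2 = A $ 1 $ 1"
  by (simp_all add: adj2_def)

lemma mat_nth2:
  "mat c $ 1 $ (1::2) = c" "mat c $ 1 $ (2::2) = 0" "mat c $ 2 $ (1::2) = 0" "mat c $ 2 $ (2::2) = c"
  by (simp_all add: mat_def)

lemma mult_nth2:
  fixes A B :: "'a::field ^ 2 ^ 2"
  shows "(A ** B) $ i $ j = A $ i $ 1 * B $ 1 $ j + A $ i $ 2 * B $ 2 $ j"
  by (simp add: matrix_matrix_mult_def sum_2)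

lemma vec_eq2_iff:
  fixes A B :: "'a ^ 2 ^ 2"
  shows "A = B \<longleftrightarrow> A $ 1 $ 1 = B $ 1 $ 1 \<and> A $ 1 $ 2 = B $ 1 $ 2 \<and>
    A $ 2 $ 1 = B $ 2 $ 1 \<and> A $ 2 $ 2 = B $ 2 $ 2"
  by (auto simp: vec_eq_iff forall_2)

lemma mult_adj2: "A ** adj2 A = mat (det A)" "adj2 A ** A = mat (det A)"
  for A :: "'a::field ^ 2 ^ 2"
  by (auto simp: vec_eq2_iff mult_nth2 mat_nth2 adj2_nth det_2 algebra_simps)

lemma det_adj2 [simp]: "det (adj2 A) = det A" for A :: "'a::field ^ 2 ^ 2"
  by (simp add: det_2 adj2_nth algebra_simps)

lemma det_mat2 [simp]: "det (mat c :: 'a::field ^ 2 ^ 2) = c * c"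
  by (simp add: det_2 mat_nth2)

lemma GL2_iff: "A \<in> carrier GL2 \<longleftrightarrow> det A \<noteq> 0"
  by (simp add: GL2_def invertible_det_nz)

lemma den_nonzero: "det A \<noteq> 0 \<Longrightarrow> den A \<noteq> 0" for A :: "'a::field ^ 2 ^ 2"
  by (auto simp: det_2)

lemma coprime_num_den:
  fixes A :: "'a::field ^ 2 ^ 2"
  assumes "det A \<noteq> 0"
  shows "coprime (num A) (den A)"
proof (rule coprimeI)
  fix c assume c: "c dvd num A" "c dvd den A"
  have "smult (A $ 1 $ 1) (den A) - smult (A $ 2 $ 1) (num A) = [:det A:]"
    by (simp add: det_2 algebra_simps)
  moreover have "c dvd smult (A $ 1 $ 1) (den A) - smult (A $ 2 $ 1) (num A)"
    using c by (intro dvd_diff dvd_smult)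
  ultimately have "c dvd [:det A:]" by simp
  moreover have "is_unit [:det A:]" using assms by (simp add: is_unit_const_poly_iff dvd_field_iff)
  ultimately show "is_unit c" by (rule dvd_unit_imp_unit)
qed

lemma moebius_x_eq: "moebius_x A = to_fract (num A) / to_fract (den A)"
  by (simp add: moebius_x_def Fract_conv_to_fract)

lemma degree_num_den:
  assumes "det A \<noteq> 0"
  shows "degree (num A) > 0 \<or> degree (den A) > 0"
proof -
  have "A $ 1 $ 1 \<noteq> 0 \<or> A $ 2 $ 1 \<noteq> 0" using assms by (auto simp: det_2)
  then show ?thesis by auto
qed

lemma transcendental_moebius_x:
  fixes A :: "'a::field ^ 2 ^ 2"
  assumes "det A \<noteq> 0"
  shows "transcendental (moebius_x A)"
  unfolding moebius_x_eq
  by (rule transcendental_quotient[OF coprime_num_den[OF assms] degree_num_den[OF assms] den_nonzero[OF assms]])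

lemma moebius_x_mat [simp]: "c \<noteq> 0 \<Longrightarrow> moebius_x (mat c) = (fract_X :: 'a::field poly fract)"
proof -
  assume "c \<noteq> 0"
  have "to_fract [:0, c:] = fract_X * const_fract c"
    by (simp flip: to_fract_mult)
  then show ?thesis using \<open>c \<noteq> 0\<close> by (simp add: moebius_x_eq mat_nth2)
qed

text \<open>Homogeneous coordinates: the column (\<open>num\<close>, \<open>den\<close>) of
  \<open>B ** A\<close> is \<open>B\<close> applied to the column of \<open>A\<close>. Division by
  \<open>den A\<close> turns this into substitution.\<close>

lemma fsub_den:
  fixes A B :: "'a::field ^ 2 ^ 2"
  assumes "det A \<noteq> 0"
  shows "to_fract (den A) * fsub A (to_fract (den B)) = to_fract (den (B ** A))"
    and "to_fract (den A) * fsub A (to_fract (num B)) = to_fract (num (B ** A))"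
proof -
  have *: "to_fract (den A) * poly_at [:d, c:] (moebius_x A) = to_fract (smult d (den A) + smult c (num A))"
    for c d :: 'a
  proof -
    have "smult d (den A) + smult c (num A) = [:d:] * den A + [:c:] * num A" by simp
    then have "to_fract (smult d (den A) + smult c (num A)) =
      const_fract d * to_fract (den A) + const_fract c * to_fract (num A)"
      by (simp only: to_fract_add to_fract_mult)
    then show ?thesis
      using den_nonzero[OF assms] unfolding moebius_x_eq poly_at_pCons
      by (simp add: field_simps del: pCons_eq_0_iff)
  qed
  show "to_fract (den A) * fsub A (to_fract (den B)) = to_fract (den (B ** A))"
    "to_fract (den A) * fsub A (to_fract (num B)) = to_fract (num (B ** A))"
    unfolding fract_subst_to_fract[OF transcendental_moebius_x[OF assms]] *
    by (simp_all add: mult_nth2 algebra_simps)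
qed

lemma fsub_moebius_x:
  fixes A B :: "'a::field ^ 2 ^ 2"
  assumes "det A \<noteq> 0" "det B \<noteq> 0"
  shows "fsub A (moebius_x B) = moebius_x (B ** A)"
proof -
  have "det (B ** A) \<noteq> 0" using assms by (simp add: det_mul)
  then have nz: "to_fract (den A) \<noteq> 0" "to_fract (den (B ** A)) \<noteq> 0"
    using assms den_nonzero by (metis to_fract_eq_0_iff)+
  have "fsub A (moebius_x B) = fsub A (to_fract (num B)) / fsub A (to_fract (den B))"
    unfolding moebius_x_eq[of B] fract_subst_divide[OF transcendental_moebius_x[OF assms(1)]] ..
  also have "\<dots> = (to_fract (den A) * fsub A (to_fract (num B))) / (to_fract (den A) * fsub A (to_fract (den B)))"
    by (rule mult_divide_mult_cancel_left[OF nz(1), symmetric])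
  also have "\<dots> = moebius_x (B ** A)"
    unfolding fsub_den[OF assms(1)] moebius_x_eq[of "B ** A"] ..
  finally show ?thesis .
qed

text \<open>Substitution reverses products, which makes the action on polynomials a right
  action.\<close>

lemma fsub_fsub:
  fixes A B :: "'a::field ^ 2 ^ 2"
  assumes "det A \<noteq> 0" "det B \<noteq> 0"
  shows "fsub A (fsub B S) = fsub (B ** A) S"
  unfolding fract_subst_comp[OF transcendental_moebius_x[OF assms(1)] transcendental_moebius_x[OF assms(2)]]
    fsub_moebius_x[OF assms] ..

text \<open>Multiplication by the adjugate of \<open>B\<close> reduces the forward direction to a
  matrix \<open>C\<close> with C \<circ> x = x; comparing coefficients in
  \<open>num C = [:0, 1:] * den C\<close> makes \<open>C\<close> scalar.\<close>

lemma moebius_x_eq_iff: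
  fixes A B :: "'a::field ^ 2 ^ 2"
  assumes "det A \<noteq> 0" "det B \<noteq> 0"
  shows "moebius_x A = moebius_x B \<longleftrightarrow> (\<exists>c. c \<noteq> 0 \<and> A = mat c ** B)"
proof
  assume eq: "moebius_x A = moebius_x B"
  define C where "C = A ** adj2 B"
  have detC: "det C \<noteq> 0" using assms by (simp add: C_def det_mul)
  have "moebius_x C = fsub (adj2 B) (moebius_x A)"
    using assms by (simp add: C_def fsub_moebius_x)
  also have "\<dots> = moebius_x (B ** adj2 B)" using assms eq by (simp add: fsub_moebius_x)
  also have "\<dots> = fract_X" using assms by (simp add: mult_adj2)
  finally have "to_fract (num C) = fract_X * to_fract (den C)"
    using den_nonzero[OF detC] unfolding moebius_x_eq by (simp add: field_simps del: pCons_eq_0_iff)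
  then have "num C = [:0, 1:] * den C" by (simp only: to_fract_mult[symmetric] to_fract_eq_iff)
  then have C: "C = mat (C $ 1 $ 1)" by (simp add: vec_eq2_iff mat_nth2)
  have "mat (det B) ** A = A ** (adj2 B ** B)"
    by (simp only: mult_adj2 mat_mult_left mat_mult_right)
  also have "\<dots> = mat (C $ 1 $ 1) ** B"
    using C by (simp only: C_def matrix_mul_assoc)
  finally have *: "mat (det B) ** A = mat (C $ 1 $ 1) ** B" .
  have "A = mat (1 / det B) ** (mat (det B) ** A)"
    using assms by (simp add: matrix_mul_assoc mat_mult_mat)
  also have "\<dots> = mat (C $ 1 $ 1 / det B) ** B"
    by (simp add: * matrix_mul_assoc mat_mult_mat)
  finally have A: "A = mat (C $ 1 $ 1 / det B) ** B" .
  moreover have "C $ 1 $ 1 \<noteq> 0" using detC C by (metis det_mat2 mult_zero_left)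
  ultimately show "\<exists>c. c \<noteq> 0 \<and> A = mat c ** B" using assms by (metis divide_eq_0_iff)
next
  assume "\<exists>c. c \<noteq> 0 \<and> A = mat c ** B"
  then obtain c where c: "c \<noteq> 0" "A = mat c ** B" by blast
  have "moebius_x A = fsub B (moebius_x (mat c))"
    using c assms by (subst fsub_moebius_x) auto
  also have "\<dots> = moebius_x B"
    using c fract_subst_to_fract[OF transcendental_moebius_x[OF assms(2)], of "[:0, 1:]"]
    by (simp add: poly_at_pCons)
  finally show "moebius_x A = moebius_x B" .
qed

lemma pgl_class_eq_iff:
  fixes A B :: "'a::field ^ 2 ^ 2"
  assumes "det A \<noteq> 0" "det B \<noteq> 0"
  shows "pgl_class A = pgl_class B \<longleftrightarrow> moebius_x A = moebius_x B"
proof -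
  have pgl: "pgl_class A = {mat c ** A |c. c \<noteq> 0}" for A :: "'a ^ 2 ^ 2"
    by (auto simp: pgl_class_def r_coset_def GL2_def scalars2_def)
  have *: "mat c ** (mat d ** A) = mat (c * d) ** A" for c d and A :: "'a ^ 2 ^ 2"
    by (simp add: matrix_mul_assoc mat_mult_mat)
  show ?thesis
  proof
    assume "pgl_class A = pgl_class B"
    moreover have "A \<in> pgl_class A" unfolding pgl
      by (rule CollectI, rule exI[of _ 1]) simp
    ultimately show "moebius_x A = moebius_x B"
      using moebius_x_eq_iff[OF assms] by (auto simp: pgl)
  next
    assume "moebius_x A = moebius_x B"
    then obtain c where c: "c \<noteq> 0" "A = mat c ** B" using moebius_x_eq_iff[OF assms] by blast
    then have "B = mat (1 / c) ** A" by (simp add: *)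
    have "pgl_class A \<subseteq> pgl_class B" if "A = mat c ** B" "c \<noteq> 0" for A B :: "'a ^ 2 ^ 2" and c
      unfolding pgl using that by (auto simp: *)
    from this[OF c(2,1)] this[OF \<open>B = mat (1 / c) ** A\<close>] show "pgl_class A = pgl_class B"
      using c(1) by auto
  qed
qed

lemma to_fract_hsub:
  fixes A :: "'a::field ^ 2 ^ 2"
  assumes "det A \<noteq> 0"
  shows "to_fract (hsub A p) = to_fract (den A) ^ degree p * fsub A (to_fract p)"
  using to_fract_hom_subst[OF den_nonzero[OF assms]]
  by (simp only: fract_subst_to_fract[OF transcendental_moebius_x[OF assms]] moebius_x_eq[symmetric])

lemma degree_hsub_le:
  fixes A :: "'a::field ^ 2 ^ 2"
  shows "degree (hsub A p) \<le> degree p"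
proof -
  have "degree (smult c (num A ^ i * den A ^ (degree p - i))) \<le> degree p" if "i \<le> degree p" for i c
  proof -
    have "degree (num A ^ i * den A ^ (degree p - i)) \<le> degree (num A) * i + degree (den A) * (degree p - i)"
      by (rule order.trans[OF degree_mult_le]) (intro add_mono degree_power_le)
    also have "\<dots> \<le> 1 * i + 1 * (degree p - i)"
      by (intro add_mono mult_right_mono) auto
    also have "\<dots> = degree p" using that by simp
    finally show ?thesis by (rule order.trans[OF degree_smult_le])
  qed
  then show ?thesis unfolding hom_subst_def by (intro degree_sum_le) auto
qed

lemma hsub_nonzero:
  fixes A :: "'a::field ^ 2 ^ 2"
  assumes "det A \<noteq> 0" "p \<noteq> 0"
  shows "hsub A p \<noteq> 0"
  by (rule hom_subst_nonzero[OF coprime_num_den[OF assms(1)] degree_num_den[OF assms(1)] assms(2)])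

text \<open>\<open>hom_subst\<close> works with the actual degree of its argument, and
  \<open>hsub A p\<close> has smaller degree than \<open>p\<close> when A \<circ> \<infinity> is a
  root of \<open>p\<close>. The power of \<open>den B\<close> makes up for this loss.\<close>

lemma hsub_hsub:
  fixes A B :: "'a::field ^ 2 ^ 2"
  assumes "det A \<noteq> 0" "det B \<noteq> 0"
  shows "hsub B (hsub A p) * den B ^ (degree p - degree (hsub A p)) = hsub (A ** B) p"
proof -
  let ?f = "to_fract :: 'a poly \<Rightarrow> _"
  have tB: "transcendental (moebius_x B)" using assms transcendental_moebius_x by blast
  have detAB: "det (A ** B) \<noteq> 0" using assms by (simp add: det_mul)
  have "?f (hsub B (hsub A p) * den B ^ (degree p - degree (hsub A p))) =
    ?f (den B) ^ degree p * fsub B (?f (hsub A p))"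
    using degree_hsub_le[of p A]
    by (simp only: to_fract_mult to_fract_power to_fract_hsub[OF assms(2)])
      (simp add: mult.assoc mult.left_commute flip: power_add)
  also have "\<dots> = (?f (den B) * fsub B (?f (den A))) ^ degree p * fsub B (fsub A (?f p))"
    by (simp only: to_fract_hsub[OF assms(1)] fract_subst_mult[OF tB] fract_subst_power[OF tB]
        power_mult_distrib mult.assoc)
  also have "\<dots> = ?f (hsub (A ** B) p)"
    by (simp only: fsub_den[OF assms(2)] fsub_fsub[OF assms(2,1)] to_fract_hsub[OF detAB])
  finally show ?thesis by (simp only: to_fract_eq_iff)
qed

lemma hsub_mat:
  fixes c :: "'a::field"
  assumes "c \<noteq> 0"
  shows "hsub (mat c) p = smult (c ^ degree p) p"
proof -
  have "det (mat c :: 'a ^ 2 ^ 2) \<noteq> 0" using assms by simp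
  then have "to_fract (hsub (mat c) p) = to_fract (den (mat c)) ^ degree p * to_fract p"
    using to_fract_hsub[of "mat c" p] assms by simp
  also have "\<dots> = to_fract ([:c:] ^ degree p * p)" by (simp add: mat_nth2)
  also have "[:c:] ^ degree p * p = smult (c ^ degree p) p"
    by (simp add: poly_const_pow)
  finally show ?thesis by (simp only: to_fract_eq_iff)
qed

lemma hsub_den:
  fixes A B :: "'a::field ^ 2 ^ 2"
  assumes "det A \<noteq> 0" "degree (den B) = 1"
  shows "hsub A (den B) = den (B ** A)"
  using to_fract_hsub[OF assms(1), of "den B"] fsub_den[OF assms(1), of B]
  by (simp only: assms(2) power_one_right to_fract_eq_iff)

lemma poly_act_eq: "poly_act A p = smult (inverse (lead_coeff (hsub A p))) (hsub A p)"
  by (simp add: poly_act_def Let_def)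

lemma pgl_class_mult:
  fixes A B :: "'a::field ^ 2 ^ 2"
  assumes "det A \<noteq> 0" "det B \<noteq> 0"
  shows "pgl_class A \<otimes>\<^bsub>PGL2\<^esub> pgl_class B = pgl_class (A ** B)"
proof -
  interpret normal scalars2 "GL2 :: ('a ^ 2 ^ 2) monoid" by (rule normal_scalars2)
  show ?thesis
    using rcos_sum[of A B] assms unfolding pgl_class_def PGL2_def
    by (simp add: GL2_iff FactGroup_def) (simp add: GL2_def)
qed

lemma carrier_PGL2: "carrier PGL2 = pgl_class ` {A :: 'a::field ^ 2 ^ 2. det A \<noteq> 0}"
  unfolding PGL2_def FactGroup_def RCOSETS_def pgl_class_def GL2_iff[symmetric]
  by auto

lemma group_PGL2: "group (PGL2 :: ('a::field ^ 2 ^ 2) set monoid)"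
  unfolding PGL2_def by (rule normal.factorgroup_is_group[OF normal_scalars2])

lemma pgl_class_mat:
  fixes c :: "'a::field"
  assumes "c \<noteq> 0"
  shows "pgl_class (mat c) = \<one>\<^bsub>PGL2\<^esub>"
proof -
  interpret normal scalars2 "GL2 :: ('a ^ 2 ^ 2) monoid" by (rule normal_scalars2)
  have "mat c \<in> (scalars2 :: ('a ^ 2 ^ 2) set)" using assms by (auto simp: scalars2_def)
  then show ?thesis unfolding pgl_class_def PGL2_def by (simp add: FactGroup_def rcos_const)
qed

text \<open>\<open>f\<close> and \<open>g\<close> cut \<open>S\<close> into the same classes.
  Applied to \<open>moebius_x\<close> and \<open>pgl_class\<close>, which both identify matrices up
  to scalars, it yields the cardinality of \<open>pts\<close>.\<close>

lemma card_image_eq_card_image: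
  assumes "\<And>x y. x \<in> S \<Longrightarrow> y \<in> S \<Longrightarrow> f x = f y \<longleftrightarrow> g x = g y"
  shows "card (f ` S) = card (g ` S)"
proof -
  have "inj_on (\<lambda>z. g (inv_into S f z)) (f ` S)"
    by (rule inj_onI) (metis assms f_inv_into_f inv_into_into)
  moreover have "(\<lambda>z. g (inv_into S f z)) ` f ` S = g ` S"
  proof -
    have "g (inv_into S f (f x)) = g x" if "x \<in> S" for x
      using that by (metis assms f_inv_into_f inv_into_into imageI)
    then show ?thesis by (force simp: image_image)
  qed
  ultimately show ?thesis by (metis card_image)
qed

section \<open>A subgroup of PGL_2 and its lifts to GL_2\<close>

locale pgl2_subgroup =
  fixes G :: "('a::{field,finite} ^ 2 ^ 2) set set"
  assumes subgroup_G: "subgroup G PGL2"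
begin

text \<open>The full preimage of \<open>G\<close> in GL_2, scalar multiples included, so that it is
  closed under products and adjugates.\<close>

definition lifts :: "('a ^ 2 ^ 2) set" where
  "lifts = {A. det A \<noteq> 0 \<and> pgl_class A \<in> G}"

lemma lifts_iff: "A \<in> carrier GL2 \<and> pgl_class A \<in> G \<longleftrightarrow> A \<in> lifts"
  by (simp add: lifts_def GL2_iff)

lemma lifts_det: "A \<in> lifts \<Longrightarrow> det A \<noteq> 0"
  by (simp add: lifts_def)

lemma lifts_mult: "A \<in> lifts \<Longrightarrow> B \<in> lifts \<Longrightarrow> A ** B \<in> lifts"
  using subgroup.m_closed[OF subgroup_G]
  by (auto simp: lifts_def det_mul simp flip: pgl_class_mult)

lemma lifts_mat: "c \<noteq> 0 \<Longrightarrow> mat c \<in> lifts"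
  using subgroup.one_closed[OF subgroup_G]
  by (simp add: lifts_def pgl_class_mat)

lemma lifts_adj2:
  assumes "A \<in> lifts"
  shows "adj2 A \<in> lifts"
proof -
  interpret P: group "PGL2 :: ('a ^ 2 ^ 2) set monoid" by (rule group_PGL2)
  have "pgl_class (adj2 A) \<otimes>\<^bsub>PGL2\<^esub> pgl_class A = \<one>\<^bsub>PGL2\<^esub>"
    using lifts_det[OF assms] by (simp add: pgl_class_mult mult_adj2 pgl_class_mat)
  moreover have "pgl_class A \<in> carrier PGL2" "pgl_class (adj2 A) \<in> carrier PGL2"
    using lifts_det[OF assms] by (auto simp: carrier_PGL2)
  ultimately have "pgl_class (adj2 A) = inv\<^bsub>PGL2\<^esub> pgl_class A"
    by (rule P.inv_equality[symmetric])
  then show ?thesis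
    using subgroup.m_inv_closed[OF subgroup_G] assms by (simp add: lifts_def)
qed

text \<open>The class of \<open>A\<close> is encoded by the rational function \<open>A \<circ> x\<close>; in this encoding the group becomes
  the finite set \<open>pts\<close>, which the substitutions by its elements permute.\<close>

definition pts :: "'a poly fract set" where
  "pts = moebius_x ` lifts"

lemma finite_lifts: "finite lifts"
  by (rule finite_subset[OF subset_UNIV]) simp

lemma finite_pts: "finite pts"
  by (simp add: pts_def finite_lifts)

lemma card_pts: "card pts = card G"
proof -
  have "card (moebius_x ` lifts) = card (pgl_class ` lifts)"
    by (rule card_image_eq_card_image) (simp add: lifts_det pgl_class_eq_iff)
  moreover have "pgl_class ` lifts = G"
    using subgroup.subset[OF subgroup_G] by (auto simp: lifts_def carrier_PGL2)
  ultimately show ?thesis by (simp add: pts_def)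
qed

lemma card_G_pos: "card G > 0"
  using finite_pts lifts_mat[of 1] by (auto simp: card_pts[symmetric] card_gt_0_iff pts_def)

lemma X_in_pts: "fract_X \<in> pts"
  using lifts_mat[of 1] unfolding pts_def by (intro image_eqI[of _ _ "mat 1"]) auto

lemma transcendental_lifts: "A \<in> lifts \<Longrightarrow> transcendental (moebius_x A)"
  by (simp add: lifts_det transcendental_moebius_x)

lemma transcendental_pts: "R \<in> pts \<Longrightarrow> transcendental R"
  by (auto simp: pts_def transcendental_lifts)

lemma fsub_image_pts:
  assumes "A \<in> lifts"
  shows "fsub A ` pts = pts"
proof (rule endo_inj_surj[OF finite_pts])
  show "fsub A ` pts \<subseteq> pts"
    using assms by (auto simp: pts_def lifts_det fsub_moebius_x lifts_mult)
  show "inj_on (fsub A) pts"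
    using fract_subst_inj[OF transcendental_lifts[OF assms]] inj_on_subset by blast
qed

lemma fsub_pts_reindex:
  assumes "A \<in> lifts"
  shows "(\<Prod>R\<in>pts. f (fsub A R)) = (\<Prod>R\<in>pts. f R)"
proof -
  have "bij_betw (fsub A) pts pts"
    using fsub_image_pts[OF assms] fract_subst_inj[OF transcendental_lifts[OF assms]]
    by (auto simp: bij_betw_def intro: inj_on_subset)
  then show ?thesis by (rule prod.reindex_bij_betw)
qed

definition rep :: "'a poly fract \<Rightarrow> 'a ^ 2 ^ 2" where
  "rep R = (SOME A. A \<in> lifts \<and> moebius_x A = R)"

lemma rep: "R \<in> pts \<Longrightarrow> rep R \<in> lifts" "R \<in> pts \<Longrightarrow> moebius_x (rep R) = R"
  using someI_ex[of "\<lambda>A. A \<in> lifts \<and> moebius_x A = R"] by (auto simp: rep_def pts_def)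

subsection \<open>The action on irreducible polynomials\<close>

abbreviation off :: "'a poly set" where
  "off \<equiv> monic_irreds_off G"

lemma monic_irreds_degree_1:
  assumes "r \<in> monic_irreds" "poly r v = 0"
  shows "r = [:- v, 1:]"
proof -
  have "[:- v, 1:] \<in> monic_irreds"
    by (simp add: monic_irreds_def irreducible_linear_field_poly)
  moreover have "[:- v, 1:] dvd r" using assms(2) by (simp add: poly_eq_0_iff_dvd)
  ultimately show ?thesis using assms(1) monic_irreds_dvd_eq by metis
qed

text \<open>The root of \<open>den A\<close> is the point that \<open>A\<close> sends to
  \<infinity>, that is, the image of \<infinity> under \<open>adj2 A\<close>. As \<open>A\<close>
  runs through the lifts so does its adjugate, and these roots fill the finite part of the orbit of
  \<infinity>.\<close>

lemma off_iff: "r \<in> off \<longleftrightarrow> r \<in> monic_irreds \<and> (\<forall>A\<in>lifts. \<not> r dvd den A)"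
proof (cases "r \<in> monic_irreds")
  case r: True
  have orbit: "Some v \<in> infinity_orbit G \<longleftrightarrow> (\<exists>A\<in>lifts. A $ 2 $ 1 \<noteq> 0 \<and> v = A $ 1 $ 1 / A $ 2 $ 1)" for v
    unfolding infinity_orbit_def lifts_iff by (auto split: if_splits)
  have "(\<exists>v. Some v \<in> infinity_orbit G \<and> poly r v = 0) \<longleftrightarrow> (\<exists>A\<in>lifts. r dvd den A)"
  proof
    assume "\<exists>v. Some v \<in> infinity_orbit G \<and> poly r v = 0"
    then obtain A where A: "A \<in> lifts" "A $ 2 $ 1 \<noteq> 0" "poly r (A $ 1 $ 1 / A $ 2 $ 1) = 0"
      by (auto simp: orbit)
    then have "den (adj2 A) = smult (- A $ 2 $ 1) r"
      using monic_irreds_degree_1[OF r A(3)] by (simp add: adj2_nth)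
    then show "\<exists>A\<in>lifts. r dvd den A"
      using A lifts_adj2 by (metis dvd_refl dvd_smult)
  next
    assume "\<exists>A\<in>lifts. r dvd den A"
    then obtain A where A: "A \<in> lifts" "r dvd den A" by blast
    have "den A \<noteq> 0" using A lifts_det den_nonzero by blast
    then have deg: "degree r \<le> degree (den A)" using A dvd_imp_degree_le by blast
    then have c: "A $ 2 $ 1 \<noteq> 0" using monic_irreds_degree_pos[OF r] by auto
    obtain t where t: "den A = r * t" using A by (elim dvdE)
    then have "t \<noteq> 0" using \<open>den A \<noteq> 0\<close> by auto
    have "degree (den A) = 1" using c by simp
    then have "degree t = 0"
      using t \<open>den A \<noteq> 0\<close> monic_irreds_degree_pos[OF r] c degree_mult_eq[of r t] deg
      by (cases "r = 0") (auto split: if_splits)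
    then obtain e where e: "t = [:e:]" by (rule degree_eq_zeroE)
    have "poly (den A) (- A $ 2 $ 2 / A $ 2 $ 1) = 0" using c by simp
    then have "poly r (- A $ 2 $ 2 / A $ 2 $ 1) = 0"
      using t e \<open>t \<noteq> 0\<close> by (auto simp del: mult_pCons_right)
    moreover have "- A $ 2 $ 2 / A $ 2 $ 1 = adj2 A $ 1 $ 1 / adj2 A $ 2 $ 1"
      using c by (simp add: adj2_nth)
    ultimately show "\<exists>v. Some v \<in> infinity_orbit G \<and> poly r v = 0"
      using lifts_adj2[OF A(1)] c unfolding orbit by (metis adj2_nth(3) neg_equal_0_iff_equal)
  qed
  then show ?thesis using r by (auto simp: monic_irreds_off_def)
qed (simp add: monic_irreds_off_def)

lemma hsub_adj2_hsub:
  fixes A :: "'a ^ 2 ^ 2"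
  assumes "det A \<noteq> 0"
  shows "hsub (adj2 A) (hsub A p) * den (adj2 A) ^ (degree p - degree (hsub A p)) = smult (det A ^ degree p) p"
proof -
  have "det (adj2 A) \<noteq> 0" using assms by simp
  from hsub_hsub[OF assms this, of p] show ?thesis
    by (simp only: mult_adj2 hsub_mat[OF assms])
qed

text \<open>Transforming back with \<open>adj2 A\<close> recovers \<open>r\<close> up to a constant.
  If degree were lost, \<open>r\<close> would have to divide either a power of
  \<open>den (adj2 A)\<close>, which is excluded by \<open>off\<close>, or a nonzero polynomial of
  smaller degree.\<close>

lemma degree_hsub_off:
  assumes "r \<in> off" "A \<in> lifts"
  shows "degree (hsub A r) = degree r"
proof (rule antisym[OF degree_hsub_le])
  let ?p = "hsub A r" and ?B = "adj2 A"
  have det: "det A \<noteq> 0" using assms lifts_det by blast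
  show "degree r \<le> degree ?p"
  proof (rule ccontr)
    assume "\<not> degree r \<le> degree ?p"
    then obtain k where k: "degree r - degree ?p = Suc k" by (metis Suc_diff_Suc not_le)
    have eq: "hsub ?B ?p * den ?B ^ Suc k = smult (det A ^ degree r) r"
      using hsub_adj2_hsub[OF det, of r] k by simp
    have nd: "\<not> r dvd den ?B" using assms off_iff lifts_adj2 by blast
    then have "\<not> r dvd den ?B ^ Suc k"
      using assms off_iff monic_irreds_prime prime_elem_dvd_power by blast
    moreover have "r dvd hsub ?B ?p * den ?B ^ Suc k" unfolding eq by (simp add: dvd_smult)
    ultimately have "r dvd hsub ?B ?p"
      using assms off_iff monic_irreds_prime prime_elem_dvd_multD by blast
    moreover have "hsub ?B ?p \<noteq> 0"
      using det assms by (intro hsub_nonzero) (auto simp: off_iff monic_irreds_def)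
    ultimately have "degree r \<le> degree ?p"
      by (intro order.trans[OF dvd_imp_degree_le degree_hsub_le])
    then show False using \<open>\<not> degree r \<le> degree ?p\<close> by simp
  qed
qed

lemma hsub_hsub_off:
  assumes "r \<in> off" "A \<in> lifts" "B \<in> lifts"
  shows "hsub B (hsub A r) = hsub (A ** B) r"
  using hsub_hsub[of A B r] assms degree_hsub_off by (simp add: lifts_det)

lemma poly_act_off_assoc:
  assumes "r \<in> off" "A \<in> lifts"
  obtains c where "c \<noteq> 0" "poly_act A r = smult c (hsub A r)"
proof -
  have "hsub A r \<noteq> 0" using assms by (intro hsub_nonzero) (auto simp: off_iff monic_irreds_def lifts_det)
  then show ?thesis using that poly_act_eq by (metis inverse_zero_imp_zero leading_coeff_0_iff)
qed

lemma degree_poly_act: "r \<in> off \<Longrightarrow> A \<in> lifts \<Longrightarrow> degree (poly_act A r) = degree r"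
  by (metis poly_act_off_assoc degree_hsub_off degree_smult_eq)

lemma poly_act_off:
  assumes r: "r \<in> off" and A: "A \<in> lifts"
  shows "poly_act A r \<in> off"
proof -
  let ?p = "hsub A r" and ?B = "adj2 A"
  have det: "det A \<noteq> 0" using A lifts_det by blast
  have r0: "degree r > 0" "irreducible r" "r \<noteq> 0"
    using r off_iff monic_irreds_degree_pos by (auto simp: monic_irreds_def)
  have p: "?p \<noteq> 0" "degree ?p = degree r"
    using r A det r0 by (auto simp: hsub_nonzero degree_hsub_off)
  have bk: "hsub ?B ?p = smult (det A ^ degree r) r"
    using hsub_adj2_hsub[OF det, of r] p by simp
  have irr: "irreducible ?p"
  proof (rule irreducibleI)
    show "\<not> is_unit ?p" using p r0 by (simp add: is_unit_iff_degree)
    fix a b assume ab: "?p = a * b"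
    have nz: "a \<noteq> 0" "b \<noteq> 0" using ab p by auto
    have prod: "hsub ?B a * hsub ?B b = smult (det A ^ degree r) r"
      using bk ab det by (simp only: hom_subst_mult[OF den_nonzero] det_adj2 simp_thms)
    have nz': "hsub ?B a \<noteq> 0" "hsub ?B b \<noteq> 0" using nz det by (simp_all add: hsub_nonzero)
    have degs: "degree r = degree (hsub ?B a) + degree (hsub ?B b)"
      using arg_cong[OF prod, of degree] det degree_mult_eq[OF nz'] by simp
    have degs': "degree r = degree a + degree b" using p(2) degree_mult_eq[OF nz] unfolding ab by simp
    \<comment> \<open>Both pairs of degrees add up to \<open>degree r\<close>, so neither factor
      loses degree on the way back, and a factor that becomes constant was constant before.\<close>
    have le: "degree (hsub ?B a) \<le> degree a" "degree (hsub ?B b) \<le> degree b"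
      by (rule degree_hsub_le)+
    have "r = hsub ?B a * smult (inverse (det A ^ degree r)) (hsub ?B b)"
      using prod det by simp
    then have "is_unit (hsub ?B a) \<or> is_unit (smult (inverse (det A ^ degree r)) (hsub ?B b))"
      using r0 irreducibleD by blast
    then have "degree (hsub ?B a) = 0 \<or> degree (hsub ?B b) = 0"
      using nz' det by (auto simp: is_unit_iff_degree)
    then show "is_unit a \<or> is_unit b"
      using degs degs' le nz by (auto simp: is_unit_iff_degree)
  qed (use p in simp)
  obtain c where c: "c \<noteq> 0" "poly_act A r = smult c ?p" by (rule poly_act_off_assoc[OF r A])
  have "poly_act A r \<in> monic_irreds"
  proof -
    have "poly_act A r = [:c:] * ?p" using c by simp
    moreover have "is_unit [:c:]" using c by (simp add: is_unit_const_poly_iff dvd_field_iff)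
    ultimately have "irreducible (poly_act A r)" using irr irreducible_mult_unit_left by metis
    moreover have "lead_coeff ?p \<noteq> 0" using p(1) by simp
    ultimately show ?thesis by (simp add: monic_irreds_def poly_act_eq del: leading_coeff_neq_0)
  qed
  moreover have "\<not> poly_act A r dvd den C" if C: "C \<in> lifts" for C
  proof
    assume "poly_act A r dvd den C"
    then have dvd: "?p dvd den C" using c by (simp add: smult_dvd_iff)
    then have "degree ?p \<le> degree (den C)" using den_nonzero[OF lifts_det[OF C]] by (rule dvd_imp_degree_le)
    then have deg: "degree (den C) = 1" using p r0 by (auto split: if_splits)
    have "hsub ?B ?p dvd hsub ?B (den C)" using dvd det by (intro hom_subst_dvd den_nonzero) auto
    also have "hsub ?B (den C) = den (C ** ?B)" using det deg by (intro hsub_den) auto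
    finally have "r dvd den (C ** ?B)" unfolding bk using det by (simp add: smult_dvd_iff)
    then show False using r C A off_iff lifts_mult lifts_adj2 by blast
  qed
  ultimately show ?thesis by (simp add: off_iff)
qed

lemma poly_act_poly_act:
  assumes "r \<in> off" "A \<in> lifts" "B \<in> lifts"
  shows "poly_act B (poly_act A r) = poly_act (A ** B) r"
proof -
  obtain c where c: "c \<noteq> 0" "poly_act A r = smult c (hsub A r)" by (rule poly_act_off_assoc[OF assms(1,2)])
  have "hsub B (poly_act A r) = smult c (hsub (A ** B) r)"
    unfolding c(2) using assms
    by (simp only: hom_subst_smult[OF den_nonzero] lifts_det hsub_hsub_off simp_thms)
  then show ?thesis
    unfolding poly_act_eq[of B "poly_act A r"] poly_act_eq[of "A ** B" r] using c(1)
    by (simp add: field_simps)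
qed

lemma poly_act_mat:
  assumes "r \<in> off" "c \<noteq> 0"
  shows "poly_act (mat c) r = r"
  using assms unfolding poly_act_eq hsub_mat[OF assms(2)] off_iff by (simp add: monic_irreds_def)

lemma poly_act_cong:
  assumes "A \<in> lifts" "B \<in> lifts" "moebius_x A = moebius_x B" "r \<in> off"
  shows "poly_act A r = poly_act B r"
proof -
  obtain c where c: "c \<noteq> 0" "A = mat c ** B"
    using assms moebius_x_eq_iff lifts_det by blast
  then show ?thesis
    using poly_act_poly_act[of r "mat c" B] assms lifts_mat by (simp add: poly_act_mat)
qed

lemma poly_orbit_eq: "poly_orbit G r = (\<lambda>A. poly_act A r) ` lifts"
  unfolding poly_orbit_def lifts_iff by auto

lemma finite_poly_orbit: "finite (poly_orbit G r)"
  by (simp add: poly_orbit_eq finite_lifts)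

lemma poly_orbit_off: "r \<in> off \<Longrightarrow> s \<in> poly_orbit G r \<Longrightarrow> s \<in> off \<and> degree s = degree r"
  by (auto simp: poly_orbit_eq poly_act_off degree_poly_act)

lemma poly_orbit_refl: "r \<in> off \<Longrightarrow> r \<in> poly_orbit G r"
  unfolding poly_orbit_eq using lifts_mat[of 1] by (intro image_eqI[of _ _ "mat 1"]) (simp_all add: poly_act_mat)

lemma poly_act_adj2: "r \<in> off \<Longrightarrow> A \<in> lifts \<Longrightarrow> poly_act (adj2 A) (poly_act A r) = r"
  by (simp add: poly_act_poly_act lifts_adj2 mult_adj2 poly_act_mat lifts_det)

text \<open>Orbit-stabilizer carried out on \<open>pts\<close>: the substitution
  \<open>fsub C\<close> maps the stabilizer of \<open>r\<close> bijectively onto the elements that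
  take \<open>r\<close> to \<open>poly_act C r\<close>, so all fibres over the orbit have the same
  size.\<close>

lemma card_poly_orbit_dvd:
  assumes r: "r \<in> off"
  shows "card (poly_orbit G r) dvd card G"
proof -
  define act where "act R = poly_act (rep R) r" for R
  have act: "act (moebius_x A) = poly_act A r" if "A \<in> lifts" for A
    using that r rep[of "moebius_x A"] unfolding act_def
    by (intro poly_act_cong) (auto simp: pts_def)
  have orbit: "poly_orbit G r = act ` pts"
    using act by (auto simp: poly_orbit_eq pts_def image_iff)
  let ?F = "\<lambda>t. {R \<in> pts. act R = t}"
  have "card (?F t) = card (?F r)" if t: "t \<in> poly_orbit G r" for t
  proof -
    obtain C where C: "C \<in> lifts" "t = poly_act C r" using t by (auto simp: poly_orbit_eq)
    have "fsub C ` ?F r = ?F t"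
    proof (intro equalityI subsetI)
      fix R assume "R \<in> fsub C ` ?F r"
      then obtain A where A: "A \<in> lifts" "act (moebius_x A) = r" "R = fsub C (moebius_x A)"
        by (auto simp: pts_def)
      then have "R = moebius_x (A ** C)" using C by (simp add: lifts_det fsub_moebius_x)
      then show "R \<in> ?F t"
        using A C r act poly_act_poly_act[of r A C] lifts_mult[of A C] by (auto simp: pts_def)
    next
      fix R assume "R \<in> ?F t"
      then obtain B where B: "B \<in> lifts" "poly_act B r = t" "R = moebius_x B"
        using act by (auto simp: pts_def)
      let ?A = "B ** adj2 C"
      have A: "?A \<in> lifts" using B C lifts_mult lifts_adj2 by blast
      have "act (moebius_x ?A) = r"
        using act[OF A] B C r lifts_adj2[OF C(1)] poly_act_poly_act[of r B "adj2 C"] poly_act_adj2 by simp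
      moreover have "fsub C (moebius_x ?A) = R"
      proof -
        have "?A ** C = mat (det C) ** B"
          by (simp only: matrix_mul_assoc[symmetric] mult_adj2) (simp add: mat_mult_left mat_mult_right)
        moreover have "moebius_x (mat (det C) ** B) = moebius_x B"
          using B C lifts_det lifts_mult lifts_mat by (subst moebius_x_eq_iff) auto
        ultimately show ?thesis using A B C by (simp add: lifts_det fsub_moebius_x)
      qed
      ultimately show "R \<in> fsub C ` ?F r" using A by (auto simp: pts_def image_iff)
    qed
    moreover have "inj_on (fsub C) (?F r)"
      using fract_subst_inj[OF transcendental_lifts[OF C(1)]] inj_on_subset by blast
    ultimately show ?thesis using card_image[of "fsub C" "?F r"] by simp
  qed
  then have "(\<Sum>t\<in>act ` pts. card (?F t)) = card (poly_orbit G r) * card (?F r)"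
    unfolding orbit[symmetric] by simp
  moreover have "(\<Sum>t\<in>act ` pts. card (?F t)) = card pts"
    using sum.image_gen[OF finite_pts, of "\<lambda>_. 1::nat" act] by simp
  ultimately have "card pts = card (poly_orbit G r) * card (?F r)" by (rule trans[OF sym, rotated])
  then show ?thesis by (simp add: card_pts)
qed

end

section \<open>Substituting a rational function\<close>

locale rational_map =
  fixes g h :: "'a::{field,finite} poly"
  assumes coprime_gh: "coprime g h" and h_nonzero: "h \<noteq> 0"
    and monic_g: "lead_coeff g = 1" and degree_less: "degree h < degree g"
begin

abbreviation Q :: "'a poly fract" where
  "Q \<equiv> to_fract g / to_fract h"

abbreviation pull :: "'a poly \<Rightarrow> 'a poly" where
  "pull F \<equiv> hom_subst F g h"

lemma transcendental_Q: "transcendental Q"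
  using coprime_gh h_nonzero degree_less by (intro transcendental_quotient) auto

lemma to_fract_pull: "to_fract (pull F) = to_fract h ^ degree F * poly_at F Q"
  by (rule to_fract_hom_subst[OF h_nonzero])

lemma pull_mult: "pull (F * F') = pull F * pull F'"
  by (rule hom_subst_mult[OF h_nonzero])

lemma pull_nonzero: "F \<noteq> 0 \<Longrightarrow> pull F \<noteq> 0"
  using hom_subst_nonzero[OF coprime_gh] degree_less by auto

lemma monic_pull:
  assumes "lead_coeff F = 1"
  shows "lead_coeff (pull F) = 1" "degree (pull F) = degree F * degree g"
proof -
  let ?m = "degree F"
  let ?R = "\<Sum>i<?m. smult (coeff F i) (g ^ i * h ^ (?m - i))"
  have "{..?m} = insert ?m {..<?m}" by auto
  then have eq: "pull F = g ^ ?m + ?R"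
    using assms by (simp add: hom_subst_def)
  have degg: "degree (g ^ i) = i * degree g" for i
    using monic_g by (metis degree_power_eq leading_coeff_0_iff mult.commute one_neq_zero)
  have lead: "lead_coeff (g ^ ?m) = 1" using monic_g by (simp add: lead_coeff_power)
  have "degree (smult (coeff F i) (g ^ i * h ^ (?m - i))) < ?m * degree g" if "i < ?m" for i
  proof -
    have "degree (g ^ i * h ^ (?m - i)) \<le> degree (g ^ i) + degree (h ^ (?m - i))" by (rule degree_mult_le)
    also have "\<dots> \<le> i * degree g + degree h * (?m - i)" by (simp add: degg degree_power_le)
    also have "\<dots> < i * degree g + degree g * (?m - i)" using that degree_less by simp
    also have "\<dots> = ?m * degree g"
      using that by (metis add_mult_distrib2 le_add_diff_inverse less_imp_le mult.commute)
    finally show ?thesis using degree_smult_le le_less_trans by blast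
  qed
  then have R: "?R = 0 \<or> degree ?R < ?m * degree g"
  proof (cases "?m = 0")
    case False
    then have "0 < ?m * degree g" using degree_less by simp
    with \<open>\<And>i. i < ?m \<Longrightarrow> _\<close> show ?thesis by (intro disjI2 degree_sum_less) auto
  qed simp
  show "degree (pull F) = ?m * degree g"
    using R unfolding eq by (auto simp: degg degree_add_eq_left)
  moreover have "coeff ?R (?m * degree g) = 0" using R by (auto intro: coeff_eq_0)
  ultimately show "lead_coeff (pull F) = 1" using lead unfolding eq by (simp add: degg)
qed

text \<open>Modulo \<open>h\<close> only the leading term of \<open>pull F\<close> survives, so a
  common prime of \<open>h\<close> and \<open>pull F\<close> would divide \<open>g\<close> as
  well.\<close>

lemma pull_not_dvd_h:
  assumes "F \<noteq> 0" "prime_elem r" "r dvd pull F"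
  shows "\<not> r dvd h"
proof
  assume "r dvd h"
  then have "r dvd pull F - smult (lead_coeff F) (g ^ degree F)"
    using hom_subst_cong_denominator dvd_trans by blast
  then have "r dvd smult (lead_coeff F) (g ^ degree F)"
    using assms(3) by (metis dvd_diff_right_iff)
  then have "r dvd g" using assms by (auto simp: dvd_smult_iff dest: prime_elem_dvd_power)
  then show False using \<open>r dvd h\<close> coprime_gh assms(2)
    by (meson coprime_common_divisor prime_elem_def)
qed

lemma prime_dvd_pull_factor:
  assumes "prime_elem r" "P \<noteq> 0" "r dvd pull P"
  obtains F where "F \<in> monic_irreds" "F dvd P" "r dvd pull F"
proof -
  have "\<exists>F. F \<in> monic_irreds \<and> F dvd P \<and> r dvd pull F" using assms(2,3)
  proof (induction "degree P" arbitrary: P rule: less_induct)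
    case less
    have "degree P > 0"
    proof (rule ccontr)
      assume "\<not> degree P > 0"
      then obtain c where c: "P = [:c:]" using degree_eq_zeroE by blast
      then have "is_unit (pull P)" using less.prems by (simp add: is_unit_const_poly_iff dvd_field_iff)
      then show False using less.prems assms(1) by (meson dvd_unit_imp_unit prime_elem_def)
    qed
    then obtain F where F: "F \<in> monic_irreds" "F dvd P" by (rule exists_monic_irreducible_factor)
    then obtain P' where P': "P = F * P'" by (elim dvdE)
    then have nz: "F \<noteq> 0" "P' \<noteq> 0" using less.prems by auto
    have "r dvd pull F \<or> r dvd pull P'"
      using less.prems(2) assms(1) unfolding P' pull_mult by (simp add: prime_elem_dvd_mult_iff)
    then show ?case
    proof
      assume "r dvd pull P'"
      moreover have "degree P' < degree P"
        using monic_irreds_degree_pos[OF F(1)] unfolding P' by (simp add: degree_mult_eq nz)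
      ultimately show ?thesis using less.hyps nz unfolding P' by (meson dvd_mult)
    qed (use F in blast)
  qed
  then show ?thesis using that by blast
qed

text \<open>Modulo \<open>r\<close> the fraction g/h is an element of a finite ring, hence a root of
  some X^i (X^k - 1). The polynomial \<open>F\<close> is an irreducible factor of this, namely the
  minimal polynomial of that residue.\<close>

lemma exists_pull_multiple:
  assumes r: "r \<in> monic_irreds" "\<not> r dvd h"
  obtains F where "F \<in> monic_irreds" "r dvd pull F"
proof -
  have prime: "prime_elem r" using r by (simp add: monic_irreds_prime)
  have "coprime r h" using r not_dvd_imp_coprime by (auto simp: monic_irreds_def)
  then obtain u v where uv: "u * r + v * h = 1" by (rule bezout_poly)
  \<comment> \<open>\<open>v\<close> inverts \<open>h\<close> modulo \<open>r\<close>, so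
    \<open>?w\<close> represents the residue of g/h.\<close>
  let ?w = "g * v"
  obtain i j where ij: "i < j" "r dvd ?w ^ j - ?w ^ i"
    using powers_repeat_mod r by (metis monic_irreds_def mem_Collect_eq irreducible_def)
  define k where "k = j - i"
  have k: "k > 0" "j = i + k" using ij by (auto simp: k_def)
  let ?X = "[:0, 1:] :: 'a poly"
  let ?P = "?X ^ i * (?X ^ k - 1)"
  have degX: "degree (?X ^ l) = l" for l by (simp add: degree_power_eq)
  have degP: "degree (?X ^ k - 1) = k"
    using degX[of k] k degree_add_eq_left[of "- 1 :: 'a poly" "?X ^ k"] by simp
  have "to_fract (pull (?X ^ k - 1)) = to_fract (g ^ k - h ^ k)"
    using h_nonzero unfolding to_fract_pull degP
    by (simp add: poly_at_diff poly_at_power poly_at_pCons field_simps)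
  then have "pull (?X ^ k - 1) = g ^ k - h ^ k" by (simp only: to_fract_eq_iff)
  moreover have "pull (?X ^ i) = g ^ i"
  proof -
    have "to_fract (pull (?X ^ i)) = to_fract (g ^ i)"
      using h_nonzero unfolding to_fract_pull degX by (simp add: poly_at_power poly_at_pCons field_simps)
    then show ?thesis by (simp only: to_fract_eq_iff)
  qed
  ultimately have P: "pull ?P = g ^ i * (g ^ k - h ^ k)" by (simp only: pull_mult)
  have gv: "(g * v * h) mod r = g mod r"
  proof -
    have "g * v * h - g = r * (- g * u)" using uv by algebra
    then show ?thesis by (metis dvd_triv_left mod_eq_dvd_iff)
  qed
  \<comment> \<open>Multiplication by \<open>h ^ j\<close> removes the inverse \<open>v\<close>:
    modulo \<open>r\<close>, \<open>?w * h\<close> is \<open>g\<close>. What remains is the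
    homogeneous form of X^j - X^i, which is \<open>pull ?P\<close>.\<close>
  have "r dvd h ^ j * (?w ^ j - ?w ^ i)" using ij by simp
  also have "h ^ j * (?w ^ j - ?w ^ i) = (?w * h) ^ j - (?w * h) ^ i * h ^ k"
    unfolding k(2) by (simp add: power_mult_distrib power_add algebra_simps)
  finally have "((?w * h) ^ j) mod r = ((?w * h) ^ i * h ^ k) mod r" by (simp add: mod_eq_dvd_iff)
  then have "(g ^ j) mod r = (g ^ i * h ^ k) mod r"
    by (metis gv power_mod mod_mult_left_eq)
  then have "r dvd g ^ j - g ^ i * h ^ k" by (simp add: mod_eq_dvd_iff)
  then have "r dvd pull ?P" unfolding P k(2) by (simp add: algebra_simps power_add)
  moreover have "?P \<noteq> 0" using degP k by auto
  ultimately show ?thesis using that prime_dvd_pull_factor[OF prime] by blast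
qed

text \<open>A Bezout identity for two different \<open>F\<close> and \<open>F'\<close>, evaluated at
  Q and cleared of denominators, makes a power of \<open>h\<close> a combination of the two
  pullbacks. A common prime would then divide \<open>h\<close>.\<close>

lemma pull_unique:
  assumes F: "F \<in> monic_irreds" "F' \<in> monic_irreds" and r: "prime_elem r" "r dvd pull F" "r dvd pull F'"
  shows "F = F'"
proof (rule ccontr)
  assume "F \<noteq> F'"
  then have "coprime F F'"
    using F monic_irreds_dvd_eq not_dvd_imp_coprime by (metis monic_irreds_def mem_Collect_eq)
  then obtain a b where "a * F + b * F' = 1" by (rule bezout_poly)
  then have eq: "poly_at a Q * poly_at F Q + poly_at b Q * poly_at F' Q = 1"
    by (metis poly_at_add poly_at_mult poly_at_1)
  let ?n = "degree a + degree F" and ?m = "degree b + degree F'"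
  have "to_fract (h ^ (?n + ?m)) = to_fract (pull a * pull F * h ^ ?m + pull b * pull F' * h ^ ?n)"
    (is "_ = ?R")
  proof -
    have "?R = to_fract h ^ (?n + ?m) * (poly_at a Q * poly_at F Q + poly_at b Q * poly_at F' Q)"
      by (simp add: to_fract_pull power_add algebra_simps)
    then show ?thesis by (simp add: eq)
  qed
  then have "h ^ (?n + ?m) = pull a * pull F * h ^ ?m + pull b * pull F' * h ^ ?n"
    by (simp only: to_fract_eq_iff)
  then have "r dvd h ^ (?n + ?m)" using r by simp
  then have "r dvd h" using r prime_elem_dvd_power by blast
  moreover have "F \<noteq> 0" using F by (auto simp: monic_irreds_def)
  ultimately show False using pull_not_dvd_h r by blast
qed

text \<open>The field generated by \<open>Q\<close> is the image of a field embedding, hence closed under the field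
  operations.\<close>

lemma generated_field_eq: "generated_field Q = range (fract_subst Q)"
proof (intro equalityI subsetI)
  fix S assume "S \<in> generated_field Q"
  then obtain p s where ps: "S = poly_at p Q / poly_at s Q" "poly_at s Q \<noteq> 0"
    by (auto simp: generated_field_def)
  then have "s \<noteq> 0" by auto
  then show "S \<in> range (fract_subst Q)"
    using ps fract_subst_quotient[OF transcendental_Q] by (metis rangeI)
next
  fix S assume "S \<in> range (fract_subst Q)"
  then obtain T where T: "S = fract_subst Q T" by blast
  obtain p s where "s \<noteq> 0" "T = to_fract p / to_fract s" by (rule to_fract_cases)
  then have "S = poly_at p Q / poly_at s Q" "poly_at s Q \<noteq> 0"
    using T fract_subst_quotient[OF transcendental_Q] transcendentalD[OF transcendental_Q] by auto
  then show "S \<in> generated_field Q" by (auto simp: generated_field_def)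
qed

section \<open>The field extension F_q(x) of K = F_q(Q)\<close>

abbreviation K :: "'a poly fract set" where
  "K \<equiv> range (fract_subst Q)"

lemma K_add: "S \<in> K \<Longrightarrow> T \<in> K \<Longrightarrow> S + T \<in> K"
  by (auto simp flip: fract_subst_add[OF transcendental_Q])

lemma K_diff: "S \<in> K \<Longrightarrow> T \<in> K \<Longrightarrow> S - T \<in> K"
  by (auto simp flip: fract_subst_diff[OF transcendental_Q])

lemma K_mult: "S \<in> K \<Longrightarrow> T \<in> K \<Longrightarrow> S * T \<in> K"
  by (auto simp flip: fract_subst_mult[OF transcendental_Q])

lemma K_divide: "S \<in> K \<Longrightarrow> T \<in> K \<Longrightarrow> S / T \<in> K"
  by (auto simp flip: fract_subst_divide[OF transcendental_Q])

lemma K_poly_at: "poly_at p Q \<in> K"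
  by (simp flip: fract_subst_to_fract[OF transcendental_Q])

lemma K_const: "const_fract c \<in> K"
  using K_poly_at[of "[:c:]"] by simp

lemma K_Q: "Q \<in> K"
  using K_poly_at[of "[:0, 1:]"] by (simp add: poly_at_pCons)

lemma K_sum: "(\<And>x. x \<in> A \<Longrightarrow> f x \<in> K) \<Longrightarrow> sum f A \<in> K"
  using K_const[of 0] by (induction A rule: infinite_finite_induct) (auto intro: K_add)

definition K_polys :: "'a poly fract poly set" where
  "K_polys = {c. \<forall>i. coeff c i \<in> K}"

lemma K_polys_mult: "c \<in> K_polys \<Longrightarrow> d \<in> K_polys \<Longrightarrow> c * d \<in> K_polys"
  by (auto simp: K_polys_def coeff_mult intro!: K_sum K_mult)

lemma K_polys_add: "c \<in> K_polys \<Longrightarrow> d \<in> K_polys \<Longrightarrow> c + d \<in> K_polys"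
  by (auto simp: K_polys_def intro!: K_add)

lemma K_polys_diff: "c \<in> K_polys \<Longrightarrow> d \<in> K_polys \<Longrightarrow> c - d \<in> K_polys"
  by (auto simp: K_polys_def intro!: K_diff)

lemma K_polys_const: "poly_const p \<in> K_polys"
  by (auto simp: K_polys_def coeff_poly_const K_const)

lemma K_polys_monom: "S \<in> K \<Longrightarrow> monom S k \<in> K_polys"
  using K_const[of 0] by (auto simp: K_polys_def)

lemma K_polys_smult: "S \<in> K \<Longrightarrow> c \<in> K_polys \<Longrightarrow> smult S c \<in> K_polys"
  by (auto simp: K_polys_def intro!: K_mult)

text \<open>The ring K[x]. The lemmas below prove it to be all of F_q(x), so that every rational
  function is a polynomial expression in x over K.\<close>

definition adjoin_X :: "'a poly fract set" where
  "adjoin_X = {poly c fract_X |c. c \<in> K_polys}"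

lemma adjoin_X_mult: "S \<in> adjoin_X \<Longrightarrow> T \<in> adjoin_X \<Longrightarrow> S * T \<in> adjoin_X"
  unfolding adjoin_X_def using K_polys_mult by (smt (verit) mem_Collect_eq poly_mult)

lemma adjoin_X_add: "S \<in> adjoin_X \<Longrightarrow> T \<in> adjoin_X \<Longrightarrow> S + T \<in> adjoin_X"
  unfolding adjoin_X_def using K_polys_add by (smt (verit) mem_Collect_eq poly_add)

lemma adjoin_X_K: "S \<in> K \<Longrightarrow> S \<in> adjoin_X"
  unfolding adjoin_X_def using K_polys_monom[of S 0] by (force simp: poly_monom)

lemma adjoin_X_to_fract: "to_fract p \<in> adjoin_X"
  unfolding adjoin_X_def using K_polys_const[of p] by (force simp: poly_poly_const)

lemma adjoin_X_power: "S \<in> adjoin_X \<Longrightarrow> S ^ n \<in> adjoin_X"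
  using adjoin_X_to_fract[of 1] by (induction n) (auto intro: adjoin_X_mult)

text \<open>Divide the Bezout identity a g + b h = 1 by h: the inverse of h is a Q + b.\<close>

lemma adjoin_X_inverse_h: "1 / to_fract h \<in> adjoin_X"
proof -
  obtain a b where "a * g + b * h = 1" using bezout_poly[OF coprime_gh] .
  then have "to_fract a * to_fract g + to_fract b * to_fract h = 1"
    by (metis to_fract_1 to_fract_add to_fract_mult)
  then have "1 / to_fract h = to_fract a * Q + to_fract b"
    using h_nonzero by (simp add: field_simps)
  then show ?thesis
    by (simp only: adjoin_X_add adjoin_X_mult adjoin_X_to_fract adjoin_X_K[OF K_Q])
qed

text \<open>It suffices to invert irreducible factors \<open>r\<close>. Each of them divides
  \<open>h\<close> or some \<open>pull F = h ^ deg F * F(Q)\<close>, where h is invertible by the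
  preceding lemma and F(Q) is a nonzero element of the field K.\<close>

lemma adjoin_X_inverse: "s \<noteq> 0 \<Longrightarrow> 1 / to_fract s \<in> adjoin_X"
proof (induction "degree s" arbitrary: s rule: less_induct)
  case less
  show ?case
  proof (cases "degree s = 0")
    case True
    then obtain c where c: "s = [:c:]" by (rule degree_eq_zeroE)
    have "const_fract 1 / const_fract c \<in> K" by (intro K_divide K_const)
    then show ?thesis using c adjoin_X_K by simp
  next
    case False
    then obtain r where r: "r \<in> monic_irreds" "r dvd s"
      using exists_monic_irreducible_factor by blast
    then obtain t where t: "s = r * t" by (elim dvdE)
    have nz: "r \<noteq> 0" "t \<noteq> 0" using t less.prems by auto
    have "degree t < degree s"
      using monic_irreds_degree_pos[OF r(1)] by (simp add: t degree_mult_eq nz)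
    then have "1 / to_fract t \<in> adjoin_X" using less.hyps nz by blast
    moreover have "1 / to_fract r \<in> adjoin_X"
    proof (cases "r dvd h")
      case True
      then obtain d where "h = r * d" by (elim dvdE)
      then have "1 / to_fract r = to_fract d * (1 / to_fract h)" using h_nonzero by simp
      then show ?thesis by (simp only: adjoin_X_mult adjoin_X_to_fract adjoin_X_inverse_h)
    next
      case False
      then obtain F where F: "F \<in> monic_irreds" "r dvd pull F" using exists_pull_multiple r by blast
      then obtain d where d: "pull F = r * d" by (elim dvdE)
      have "pull F \<noteq> 0" using F by (intro pull_nonzero) (auto simp: monic_irreds_def)
      then have "1 / to_fract r = to_fract d * (1 / to_fract (pull F))" unfolding d by simp
      also have "\<dots> = to_fract d * (1 / to_fract h) ^ degree F * (1 / poly_at F Q)"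
        by (simp add: to_fract_pull power_one_over)
      also have "\<dots> \<in> adjoin_X"
        using K_divide[OF K_const[of 1] K_poly_at[of F]]
        by (intro adjoin_X_mult adjoin_X_power adjoin_X_to_fract adjoin_X_inverse_h adjoin_X_K) simp
      finally show ?thesis .
    qed
    moreover have "1 / to_fract s = (1 / to_fract r) * (1 / to_fract t)" by (simp add: t)
    ultimately show ?thesis using adjoin_X_mult by metis
  qed
qed

lemma adjoin_X_UNIV: "S \<in> adjoin_X"
proof -
  obtain p s where "s \<noteq> 0" "S = to_fract p / to_fract s" by (rule to_fract_cases)
  then show ?thesis
    using adjoin_X_mult[OF adjoin_X_to_fract[of p] adjoin_X_inverse[of s]] by simp
qed

definition min_poly :: "'a poly fract poly" where
  "min_poly = poly_const g - smult Q (poly_const h)"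

lemma min_poly:
  "degree min_poly = degree g" "lead_coeff min_poly = 1" "min_poly \<in> K_polys"
  "poly min_poly R = poly_at g R - Q * poly_at h R"
proof -
  have less: "degree (smult Q (poly_const h)) < degree (poly_const g)"
    using degree_less degree_smult_le[of Q "poly_const h"] by simp
  then show deg: "degree min_poly = degree g"
    unfolding min_poly_def using degree_add_eq_left[of "- smult Q (poly_const h)" "poly_const g"] by simp
  show "lead_coeff min_poly = 1"
    unfolding deg unfolding min_poly_def
    using degree_less monic_g by (simp add: coeff_poly_const coeff_eq_0)
  show "min_poly \<in> K_polys"
    unfolding min_poly_def by (intro K_polys_diff K_polys_smult K_polys_const K_Q)
qed (simp add: min_poly_def poly_poly_const)

lemma poly_min_poly_X: "poly min_poly fract_X = 0"
  using h_nonzero by (simp add: min_poly)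

text \<open>Division with remainder by \<open>min_poly\<close>, which is monic with coefficients in
  K and vanishes at x.\<close>

lemma exists_reduced_representation:
  obtains c where "c \<in> K_polys" "degree c < degree g" "S = poly c fract_X"
proof -
  have "\<exists>c'. c' \<in> K_polys \<and> degree c' < degree g \<and> poly c fract_X = poly c' fract_X"
    if "c \<in> K_polys" for c using that
  proof (induction "degree c" arbitrary: c rule: less_induct)
    case less
    show ?case
    proof (cases "degree c < degree g")
      case False
      let ?m = "monom (lead_coeff c) (degree c - degree g)"
      let ?d = "c - ?m * min_poly"
      have "?m \<in> K_polys" using less.prems by (intro K_polys_monom) (auto simp: K_polys_def)
      then have d: "?d \<in> K_polys" using less.prems min_poly by (intro K_polys_diff K_polys_mult)
      have c0: "c \<noteq> 0" using False degree_less by auto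
      then have deg: "degree (?m * min_poly) = degree c"
        using False min_poly by (subst degree_mult_eq) (auto simp: degree_monom_eq monom_eq_0_iff)
      moreover have "lead_coeff (?m * min_poly) = lead_coeff c"
        unfolding lead_coeff_mult using min_poly(2) c0 by (simp add: degree_monom_eq)
      ultimately have "coeff ?d (degree c) = 0" by simp
      moreover have "degree ?d \<le> degree c" using deg by (intro degree_diff_le) auto
      moreover have "degree c > 0" using False degree_less by simp
      ultimately have "degree ?d < degree c"
        by (metis degree_0 leading_coeff_0_iff le_neq_implies_less)
      then obtain c' where "c' \<in> K_polys" "degree c' < degree g" "poly ?d fract_X = poly c' fract_X"
        using less.hyps d by blast
      then show ?thesis using poly_min_poly_X by auto
    qed (use less.prems in blast)
  qed
  then show ?thesis using that adjoin_X_UNIV[of S] by (auto simp: adjoin_X_def)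
qed

end

lemma prime_elem_dvd_prodE:
  fixes p :: "'a::algebraic_semidom"
  assumes "prime_elem p" "p dvd (\<Prod>x\<in>A. f x)"
  obtains x where "x \<in> A" "p dvd f x"
proof -
  have "\<exists>x\<in>A. p dvd f x" using assms
    by (induction A rule: infinite_finite_induct) (auto simp: prime_elem_dvd_mult_iff)
  then show ?thesis using that by blast
qed

text \<open>The degree bounds let the reduced fraction inherit the bound |G| when a quotient map is
  constructed.\<close>

lemma coprime_representation:
  fixes p s :: "'a::field poly"
  assumes "s \<noteq> 0"
  obtains p' s' where "coprime p' s'" "s' \<noteq> 0" "degree s' \<le> degree s" "degree p' \<le> degree p"
    "to_fract p / to_fract s = to_fract p' / to_fract s'"
proof -
  have "\<exists>p' s'. coprime p' s' \<and> s' \<noteq> 0 \<and> degree s' \<le> degree s \<and> degree p' \<le> degree p \<and>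
    to_fract p / to_fract s = to_fract p' / to_fract s'" using assms
  proof (induction "degree s" arbitrary: p s rule: less_induct)
    case less
    show ?case
    proof (cases "coprime p s")
      case False
      then obtain c where c: "c dvd p" "c dvd s" "\<not> is_unit c" by (auto simp: coprime_def)
      obtain p1 s1 where eq: "p = c * p1" "s = c * s1" using c by (auto elim!: dvdE)
      have nz: "c \<noteq> 0" "s1 \<noteq> 0" using eq less.prems by auto
      have "degree c > 0" using c nz by (auto simp: is_unit_iff_degree)
      then have deg: "degree s1 < degree s" using nz by (simp add: eq degree_mult_eq)
      have "degree p1 \<le> degree p" using nz by (cases "p1 = 0") (simp_all add: eq degree_mult_eq)
      moreover have "to_fract p / to_fract s = to_fract p1 / to_fract s1" using nz by (simp add: eq)
      ultimately show ?thesis using less.hyps[OF deg nz(2), of p1] deg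
        by (metis le_trans less_imp_le)
    qed (use less.prems in blast)
  qed
  then show ?thesis using that by blast
qed

section \<open>The polynomial with the roots A \<circ> x and its invariant coefficients\<close>

context pgl2_subgroup
begin

definition pts_poly :: "'a poly fract poly" where
  "pts_poly = (\<Prod>R\<in>pts. [:- R, 1:])"

lemma lead_coeff_pts_poly: "lead_coeff pts_poly = 1"
  by (simp add: pts_poly_def lead_coeff_prod)

lemma degree_pts_poly: "degree pts_poly = card G"
  unfolding pts_poly_def by (subst degree_prod_eq_sum_degree) (simp_all add: card_pts)

lemma poly_pts_poly: "R \<in> pts \<Longrightarrow> poly pts_poly R = 0"
  unfolding pts_poly_def poly_prod using finite_pts by (intro prod_zero) auto

lemma poly_zero_on_pts:
  assumes "degree p < card G" "\<And>R. R \<in> pts \<Longrightarrow> poly p R = 0"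
  shows "p = 0"
proof (rule ccontr)
  assume "p \<noteq> 0"
  then have "card {x. poly p x = 0} \<le> degree p" "finite {x. poly p x = 0}"
    by (simp_all add: card_poly_roots_bound poly_roots_finite)
  moreover have "pts \<subseteq> {x. poly p x = 0}" using assms by auto
  ultimately have "card pts \<le> degree p" using card_mono le_trans by blast
  then show False using assms by (simp add: card_pts)
qed

lemma pts_poly_unique:
  assumes "lead_coeff p = 1" "degree p = card G" "\<And>R. R \<in> pts \<Longrightarrow> poly p R = 0"
  shows "p = pts_poly"
proof -
  let ?d = "p - pts_poly"
  have "degree ?d \<le> card G" using assms degree_pts_poly by (intro degree_diff_le) auto
  moreover have "coeff ?d (card G) = 0"
    using assms lead_coeff_pts_poly degree_pts_poly by simp
  ultimately have "degree ?d < card G"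
    using card_G_pos by (metis degree_0 leading_coeff_0_iff le_neq_implies_less)
  then have "?d = 0" using assms poly_pts_poly by (intro poly_zero_on_pts) auto
  then show ?thesis by simp
qed

text \<open>A common denominator for all coefficients of \<open>pts_poly\<close>.\<close>

definition dens :: "'a poly" where
  "dens = (\<Prod>R\<in>pts. den (rep R))"

lemma den_rep_nonzero: "R \<in> pts \<Longrightarrow> den (rep R) \<noteq> 0"
  by (intro den_nonzero lifts_det rep)

lemma dens_nonzero: "dens \<noteq> 0"
  unfolding dens_def using den_rep_nonzero finite_pts by (simp del: pCons_eq_0_iff)

lemma pts_eq: "R \<in> pts \<Longrightarrow> to_fract (num (rep R)) = R * to_fract (den (rep R))"
  using rep(2)[of R] den_rep_nonzero[of R] unfolding moebius_x_eq
  by (simp add: field_simps del: pCons_eq_0_iff)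

text \<open>Multiplied by its denominator, the factor Y - R becomes den Y - num, whose coefficients
  have degree at most 1 in x. Each factor thus raises the degree in x by at most 1.\<close>

lemma dens_coeff:
  obtains p where "degree p \<le> card G" "to_fract dens * coeff pts_poly i = to_fract p"
proof -
  have "\<exists>p. degree p \<le> card S \<and>
      to_fract (\<Prod>R\<in>S. den (rep R)) * coeff (\<Prod>R\<in>S. [:- R, 1:]) i = to_fract p"
    if "S \<subseteq> pts" for S
    using finite_subset[OF that finite_pts] that
  proof (induction S arbitrary: i rule: finite_induct)
    case empty
    show ?case by (rule exI[of _ "if i = 0 then 1 else 0"]) simp
  next
    case (insert R S)
    let ?D = "\<Prod>R\<in>S. den (rep R)" and ?P = "\<Prod>R\<in>S. [:- R, 1:]"
    obtain p where p: "degree p \<le> card S" "to_fract ?D * coeff ?P i = to_fract p"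
      using insert by blast
    obtain q where q: "degree q \<le> card S" "to_fract ?D * (if i = 0 then 0 else coeff ?P (i - 1)) = to_fract q"
    proof (cases i)
      case 0
      then show ?thesis using that[of 0] by simp
    next
      case (Suc j)
      obtain q where "degree q \<le> card S" "to_fract ?D * coeff ?P j = to_fract q"
        using insert by blast
      then show ?thesis using that Suc by simp
    qed
    have c: "coeff ([:- R, 1:] * ?P) i = (if i = 0 then 0 else coeff ?P (i - 1)) - R * coeff ?P i"
      by (cases i) simp_all
    have R: "to_fract (num (rep R)) = R * to_fract (den (rep R))" using insert by (intro pts_eq) auto
    have "to_fract (\<Prod>R\<in>insert R S. den (rep R)) * coeff (\<Prod>R\<in>insert R S. [:- R, 1:]) i =
      to_fract (den (rep R)) * (to_fract ?D * (if i = 0 then 0 else coeff ?P (i - 1))) -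
      (R * to_fract (den (rep R))) * (to_fract ?D * coeff ?P i)"
      unfolding prod.insert[OF insert.hyps] c to_fract_mult by (simp only: algebra_simps)
    also have "\<dots> = to_fract (den (rep R) * q - num (rep R) * p)"
      unfolding p q R[symmetric] by (simp only: to_fract_mult to_fract_diff)
    finally have eq: "to_fract (\<Prod>R\<in>insert R S. den (rep R)) * coeff (\<Prod>R\<in>insert R S. [:- R, 1:]) i =
      to_fract (den (rep R) * q - num (rep R) * p)" .
    have "degree (den (rep R) * q) \<le> 1 + card S" "degree (num (rep R) * p) \<le> 1 + card S"
      using p q by (intro order.trans[OF degree_mult_le] add_mono; simp)+
    then have "degree (den (rep R) * q - num (rep R) * p) \<le> card (insert R S)"
      using insert.hyps by (intro degree_diff_le) simp_all
    then show ?case using eq by blast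
  qed
  from this[of pts] show ?thesis using that unfolding dens_def pts_poly_def card_pts by blast
qed

lemma degree_dens: "degree dens \<le> card G"
proof -
  obtain p where "degree p \<le> card G" "to_fract dens * coeff pts_poly (card G) = to_fract p"
    by (rule dens_coeff)
  then show ?thesis using lead_coeff_pts_poly degree_pts_poly by simp
qed

text \<open>Substitution of a group element into the coefficients permutes the roots, and a monic
  polynomial of degree |G| is determined by vanishing on \<open>pts\<close>.\<close>

lemma fsub_coeff_pts_poly:
  assumes "A \<in> lifts"
  shows "fsub A (coeff pts_poly i) = coeff pts_poly i"
proof -
  note t = transcendental_lifts[OF assms]
  let ?p = "map_poly (fsub A) pts_poly"
  have coeff: "coeff ?p j = fsub A (coeff pts_poly j)" for j by (simp add: coeff_map_poly t)
  have deg: "degree ?p = card G"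
    using degree_map_poly[of "fsub A" pts_poly] fract_subst_eq_0_iff[OF t] by (simp add: degree_pts_poly)
  have poly: "poly ?p (fsub A R) = fsub A (poly pts_poly R)" for R
  proof -
    have "fsub A (poly p R) = poly (map_poly (fsub A) p) (fsub A R)" for p
      by (induction p) (simp_all add: t map_poly_pCons fract_subst_add fract_subst_mult)
    then show ?thesis by simp
  qed
  have "?p = pts_poly"
  proof (rule pts_poly_unique[OF _ deg])
    show "lead_coeff ?p = 1"
      unfolding deg coeff using lead_coeff_pts_poly degree_pts_poly t by simp
    fix R assume "R \<in> pts"
    then obtain S where "S \<in> pts" "R = fsub A S" using fsub_image_pts[OF assms] by blast
    then show "poly ?p R = 0" using poly poly_pts_poly t by simp
  qed
  then show ?thesis using coeff by metis
qed

text \<open>With constant coefficients only, \<open>pts_poly\<close> would be a nonzero polynomial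
  over F_q with the root x.\<close>

lemma exists_nonconst_coeff: "\<exists>i. \<forall>c. coeff pts_poly i \<noteq> const_fract c"
proof (rule ccontr)
  assume "\<not> ?thesis"
  then obtain c where c: "\<And>i. coeff pts_poly i = const_fract (c i)" by metis
  let ?p = "\<Sum>i\<le>card G. monom (c i) i"
  have "poly_const ?p = pts_poly"
  proof (rule poly_eqI)
    fix j
    show "coeff (poly_const ?p) j = coeff pts_poly j"
      using degree_pts_poly coeff_eq_0[of pts_poly j]
      by (auto simp: coeff_poly_const coeff_sum c sum.delta)
  qed
  then have "poly_at ?p fract_X = 0" by (metis poly_poly_const poly_pts_poly X_in_pts)
  then have "?p = 0" by (simp only: poly_at_X to_fract_eq_0_iff)
  then have "pts_poly = 0" using \<open>poly_const ?p = pts_poly\<close> by (simp add: poly_const_def)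
  then show False using lead_coeff_pts_poly by simp
qed

lemma invariant_field_eq: "invariant_field G = {S. \<forall>A\<in>lifts. fsub A S = S}"
proof (intro equalityI subsetI)
  fix S assume "S \<in> invariant_field G"
  then obtain p s where "S = to_fract p / to_fract s" "s \<noteq> 0"
    "\<forall>A\<in>carrier GL2. pgl_class A \<in> G \<longrightarrow>
      poly_at p (moebius_x A) / poly_at s (moebius_x A) = to_fract p / to_fract s"
    unfolding invariant_field_def Fract_conv_to_fract by blast
  moreover from this(3) have "poly_at p (moebius_x A) / poly_at s (moebius_x A) = to_fract p / to_fract s"
    if "A \<in> lifts" for A
    using that lifts_iff by blast
  ultimately show "S \<in> {S. \<forall>A\<in>lifts. fsub A S = S}"
    by (simp add: fract_subst_quotient transcendental_lifts)
next
  fix S assume S: "S \<in> {S. \<forall>A\<in>lifts. fsub A S = S}"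
  obtain p s where ps: "s \<noteq> 0" "S = to_fract p / to_fract s" by (rule to_fract_cases)
  then have "\<forall>A\<in>carrier GL2. pgl_class A \<in> G \<longrightarrow>
      poly_at p (moebius_x A) / poly_at s (moebius_x A) = Fract p s"
    using S lifts_iff unfolding Fract_conv_to_fract
    by (metis (mono_tags, lifting) fract_subst_quotient mem_Collect_eq transcendental_lifts)
  then show "S \<in> invariant_field G"
    using ps unfolding invariant_field_def Fract_conv_to_fract by blast
qed

end

text \<open>The field equation of \<open>is_quotient_map\<close> is replaced by invariance of Q,
  which can be checked directly on a constructed fraction. \<open>is_quotient_map\<close> and
  \<open>quotient_mapI\<close> pass between the two forms.\<close>

locale quotient_map = pgl2_subgroup G + rational_map g h
  for G :: "('a::{field,finite} ^ 2 ^ 2) set set" and g h :: "'a poly" +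
  assumes degree_g: "degree g = card G"
    and fsub_Q: "\<And>A. A \<in> lifts \<Longrightarrow> fsub A Q = Q"

text \<open>A nonconstant coefficient of \<open>pts_poly\<close> is an invariant of degree at most \<open>|G|\<close>. A translation
  and an inversion move one of its poles to \<open>\<infinity>\<close>. Its degree is at least \<open>|G|\<close> because the equation
  of \<open>x\<close> over it has the \<open>|G|\<close> roots \<open>pts\<close>.\<close>

lemma (in pgl2_subgroup) exists_quotient_map: "\<exists>g h. quotient_map G g h"
proof -
  obtain i where i: "\<And>c. coeff pts_poly i \<noteq> const_fract c" using exists_nonconst_coeff by blast
  define S where "S = coeff pts_poly i"
  obtain p where p: "degree p \<le> card G" "to_fract dens * S = to_fract p"
    unfolding S_def by (rule dens_coeff)
  have "S = to_fract p / to_fract dens" using p(2) dens_nonzero by (simp add: field_simps)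
  moreover obtain u v where uv: "coprime u v" "v \<noteq> 0" "degree v \<le> degree dens" "degree u \<le> degree p"
    "to_fract p / to_fract dens = to_fract u / to_fract v"
    by (rule coprime_representation[OF dens_nonzero])
  ultimately have S: "S = to_fract u / to_fract v" "degree u \<le> card G" "degree v \<le> card G"
    using p(1) degree_dens by auto
  have inv: "fsub A S = S" if "A \<in> lifts" for A
    using fsub_coeff_pts_poly[OF that] by (simp add: S_def)
  have "\<exists>u v. coprime u v \<and> v \<noteq> 0 \<and> degree v < degree u \<and> degree u \<le> card G \<and>
    (\<forall>A\<in>lifts. fsub A (to_fract u / to_fract v) = to_fract u / to_fract v)"
  proof (cases "degree v < degree u")
    case True
    then show ?thesis using uv S inv by auto
  next
    case False
    \<comment> \<open>\<open>c\<close> is the value of S at \<infinity>, so that 1/(S - c) = v/w has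
      a pole there.\<close>
    define c where "c = (if degree u = degree v then lead_coeff u / lead_coeff v else 0)"
    define w where "w = u - smult c v"
    have "to_fract w = to_fract u - const_fract c * to_fract v"
    proof -
      have "w = u - [:c:] * v" by (simp add: w_def)
      then show ?thesis by (simp only: to_fract_diff to_fract_mult)
    qed
    then have w: "to_fract w = (S - const_fract c) * to_fract v"
      using uv(2) by (simp add: S algebra_simps)
    then have "w \<noteq> 0" using i[of c] uv(2) by (metis S_def mult_eq_0_iff right_minus_eq to_fract_eq_0_iff)
    have "degree w < degree v"
    proof (cases "degree u = degree v")
      case True
      have "degree w \<le> degree v" unfolding w_def using True by (intro degree_diff_le) (auto simp: degree_smult_le)
      moreover have "coeff w (degree v) = 0" using uv(2) True by (simp add: w_def c_def)
      moreover have "degree v \<noteq> 0"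
      proof
        assume "degree v = 0"
        then obtain a b where "u = [:a:]" "v = [:b:]" using True by (metis degree_eq_zeroE)
        then have "w = 0" using uv(2) by (simp add: w_def c_def)
        then show False using \<open>w \<noteq> 0\<close> by simp
      qed
      ultimately show ?thesis using \<open>w \<noteq> 0\<close> by (metis leading_coeff_0_iff le_neq_implies_less)
    next
      case neq: False
      then show ?thesis using False by (simp add: w_def c_def)
    qed
    moreover have "coprime v w"
    proof (rule coprimeI)
      fix d assume d: "d dvd v" "d dvd w"
      then have "d dvd w + smult c v" by (intro dvd_add dvd_smult)
      then show "is_unit d" using d uv(1) by (auto simp: w_def intro: coprime_common_divisor)
    qed
    moreover have "fsub A (to_fract v / to_fract w) = to_fract v / to_fract w" if "A \<in> lifts" for A
    proof -
      have "to_fract v / to_fract w = 1 / (S - const_fract c)" using w uv(2) by simp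
      then show ?thesis using inv[OF that] transcendental_lifts[OF that]
        by (simp add: fract_subst_divide fract_subst_diff fract_subst_to_fract)
    qed
    ultimately show ?thesis using S \<open>w \<noteq> 0\<close> by blast
  qed
  then obtain u v where uv: "coprime u v" "v \<noteq> 0" "degree v < degree u" "degree u \<le> card G"
    "\<And>A. A \<in> lifts \<Longrightarrow> fsub A (to_fract u / to_fract v) = to_fract u / to_fract v" by blast
  define a where "a = inverse (lead_coeff u)"
  have "u \<noteq> 0" using uv(3) by auto
  then have a: "a \<noteq> 0" by (simp add: a_def)
  have Q: "to_fract (smult a u) / to_fract (smult a v) = to_fract u / to_fract v"
  proof -
    have "to_fract (smult a p) = const_fract a * to_fract p" for p
      by (simp flip: to_fract_mult)
    then show ?thesis using a by simp
  qed
  interpret r: rational_map "smult a u" "smult a v"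
  proof
    show "coprime (smult a u) (smult a v)"
    proof (rule coprimeI)
      fix d assume "d dvd smult a u" "d dvd smult a v"
      then show "is_unit d" using uv(1) a by (auto simp: dvd_smult_iff intro: coprime_common_divisor)
    qed
    show "lead_coeff (smult a u) = 1" using \<open>u \<noteq> 0\<close> by (simp add: a_def)
  qed (use uv a in auto)
  have zero: "poly r.min_poly R = 0" if R: "R \<in> pts" for R
  proof -
    obtain A where A: "A \<in> lifts" "R = moebius_x A" using R by (auto simp: pts_def)
    have nz: "poly_at (smult a v) R \<noteq> 0"
      using transcendentalD[OF transcendental_pts[OF R]] uv(2) a by simp
    have "smult a v \<noteq> 0" using uv(2) a by simp
    then have "poly_at (smult a u) R / poly_at (smult a v) R = r.Q"
      using uv(5)[OF A(1)] A fract_subst_quotient[OF transcendental_lifts[OF A(1)]] unfolding Q[symmetric]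
      by metis
    then show ?thesis using nz unfolding r.min_poly(4) by (simp add: field_simps)
  qed
  have "degree (smult a u) = card G"
  proof (rule ccontr)
    assume "degree (smult a u) \<noteq> card G"
    then have "degree r.min_poly < card G" using uv(4) a r.min_poly(1) by simp
    then have "r.min_poly = 0" using zero by (rule poly_zero_on_pts)
    then show False using r.min_poly(2) by simp
  qed
  then have "quotient_map G (smult a u) (smult a v)"
    using uv(5) unfolding Q[symmetric] by unfold_locales auto
  then show ?thesis by blast
qed

section \<open>Derivatives, the Wronskian and multiple factors\<close>

lemma monic_irreds_nonzero: "F \<in> monic_irreds \<Longrightarrow> F \<noteq> 0"
  by (auto simp: monic_irreds_def)

lemma degree_pderiv_less:
  assumes "degree F > 0"
  shows "degree (pderiv F) < degree F"
proof (rule ccontr)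
  assume "\<not> ?thesis"
  then have "degree F \<le> degree (pderiv F)" by simp
  then have "lead_coeff (pderiv F) = 0" by (simp add: coeff_pderiv coeff_eq_0)
  then show False using \<open>degree F \<le> degree (pderiv F)\<close> assms by simp
qed

lemma coprime_dvd_multD_poly:
  fixes a b c :: "'a::field poly"
  assumes "coprime a b" "a dvd c * b"
  shows "a dvd c"
proof -
  obtain u v where uv: "u * a + v * b = 1" by (rule bezout_poly[OF assms(1)])
  have "c = c * u * a + v * (c * b)" using arg_cong[OF uv, of "\<lambda>x. c * x"] by (simp add: algebra_simps)
  then show ?thesis using assms(2) by (metis dvd_add dvd_mult dvd_triv_right)
qed

context rational_map
begin

definition wronskian :: "'a poly" where
  "wronskian = pderiv g * h - g * pderiv h"

text \<open>The chain rule for \<open>h ^ deg F * F(g/h)\<close>, with the value of \<open>h ^ (deg F - 1) * F'(g/h)\<close> called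
  \<open>E\<close>.\<close>

lemma pderiv_pull:
  obtains E where
    "h * pderiv (pull F) = of_nat (degree F) * pderiv h * pull F + wronskian * E"
    "to_fract (h * E) = to_fract h ^ degree F * poly_at (pderiv F) Q"
proof -
  have "\<exists>E. h * pderiv (pull F) = of_nat (degree F) * pderiv h * pull F + wronskian * E \<and>
    to_fract (h * E) = to_fract h ^ degree F * poly_at (pderiv F) Q"
  proof (induction F)
    case 0
    show ?case by (rule exI[of _ 0]) (simp add: hom_subst_def)
  next
    case (pCons c F)
    show ?case
    proof (cases "F = 0")
      case True
      then show ?thesis by (intro exI[of _ 0]) (simp add: pderiv_pCons)
    next
      case False
      let ?m = "degree F"
      obtain E where E: "h * pderiv (pull F) = of_nat ?m * pderiv h * pull F + wronskian * E"
        "to_fract (h * E) = to_fract h ^ ?m * poly_at (pderiv F) Q"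
        using pCons.IH by blast
      \<comment> \<open>The derivative of c + X F is F + X F'; \<open>?E\<close> is its value at Q
        multiplied by \<open>h ^ degree F\<close>.\<close>
      let ?E = "pull F + g * E"
      have pull: "pull (pCons c F) = smult c (h ^ Suc ?m) + g * pull F" by (rule hom_subst_pCons[OF False])
      have "h * pderiv (smult c (h ^ Suc ?m)) = of_nat (Suc ?m) * pderiv h * smult c (h ^ Suc ?m)"
        by (simp add: pderiv_smult pderiv_power_Suc of_nat_poly del: of_nat_Suc power_Suc) 
          (simp add: algebra_simps smult_add_left)
      then have "h * pderiv (pull (pCons c F)) =
        of_nat (Suc ?m) * pderiv h * smult c (h ^ Suc ?m) + h * pderiv g * pull F + g * (h * pderiv (pull F))"
        unfolding pull by (simp only: pderiv_add pderiv_mult algebra_simps)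
      also have "\<dots> = of_nat (degree (pCons c F)) * pderiv h * pull (pCons c F) + wronskian * ?E"
        unfolding E pull wronskian_def using False by (simp add: algebra_simps)
      finally have 1: "h * pderiv (pull (pCons c F)) =
        of_nat (degree (pCons c F)) * pderiv h * pull (pCons c F) + wronskian * ?E" .
      have "to_fract (h * ?E) = to_fract h * to_fract (pull F) + to_fract g * to_fract (h * E)"
        by (simp add: algebra_simps)
      also have "\<dots> = to_fract h ^ Suc ?m * (poly_at F Q + Q * poly_at (pderiv F) Q)"
        unfolding E(2) to_fract_pull using h_nonzero by (simp add: field_simps)
      also have "\<dots> = to_fract h ^ degree (pCons c F) * poly_at (pderiv (pCons c F)) Q"
        using False by (simp add: pderiv_pCons poly_at_add poly_at_pCons)
      finally show ?thesis using 1 by blast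
    qed
  qed
  then show ?thesis using that by blast
qed

text \<open>A double factor \<open>r\<close> divides the derivative of \<open>pull F\<close>. If it
  did not divide the Wronskian, the chain rule would make it divide \<open>pull (pderiv F)\<close>;
  then \<open>F\<close> would divide its own derivative, which separability forbids.\<close>

lemma ramified_dvd_wronskian:
  assumes F: "F \<in> monic_irreds" and r: "r \<in> monic_irreds" "r\<^sup>2 dvd pull F"
  shows "r dvd wronskian"
proof (rule ccontr)
  assume not: "\<not> r dvd wronskian"
  have prime: "prime_elem r" using r by (simp add: monic_irreds_prime)
  have rF: "r dvd pull F" using r(2) by (metis dvd_mult_left power2_eq_square)
  obtain t where "pull F = r\<^sup>2 * t" using r(2) by (elim dvdE)
  then have t: "pull F = r * (r * t)" by (simp only: power2_eq_square mult.assoc)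
  have "pderiv (pull F) = r * (pderiv r * t + pderiv (r * t))"
    unfolding t pderiv_mult[of r "r * t"] by (simp add: algebra_simps)
  then have r': "r dvd h * pderiv (pull F)" by simp
  obtain E where E: "h * pderiv (pull F) = of_nat (degree F) * pderiv h * pull F + wronskian * E"
    "to_fract (h * E) = to_fract h ^ degree F * poly_at (pderiv F) Q"
    by (rule pderiv_pull)
  have "r dvd of_nat (degree F) * pderiv h * pull F" using rF by simp
  then have "r dvd wronskian * E" using r' unfolding E(1) by (simp add: dvd_add_right_iff)
  then have rE: "r dvd E" using not prime prime_elem_dvd_multD by blast
  have F': "pderiv F \<noteq> 0" using F irreducible_pderiv_nonzero by (auto simp: monic_irreds_def)
  \<comment> \<open>In positive characteristic \<open>degree (pderiv F)\<close> can be less than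
    \<open>degree F - 1\<close>. Powers of \<open>h\<close> on both sides avoid the exact exponent,
    and they do no harm since \<open>r\<close> does not divide \<open>h\<close>.\<close>
  have "to_fract (h ^ degree (pderiv F) * (h * E)) = to_fract (h ^ degree F * pull (pderiv F))"
    unfolding to_fract_mult[of "h ^ _"] to_fract_power E(2) to_fract_pull by (simp add: algebra_simps)
  then have "h ^ degree (pderiv F) * (h * E) = h ^ degree F * pull (pderiv F)"
    by (simp only: to_fract_eq_iff)
  then have "r dvd h ^ degree F * pull (pderiv F)" using rE by (metis dvd_mult)
  moreover have "\<not> r dvd h"
    by (rule pull_not_dvd_h[OF monic_irreds_nonzero[OF F] prime rF])
  ultimately have "r dvd pull (pderiv F)"
    using prime prime_elem_dvd_multD prime_elem_dvd_power by blast
  then obtain F2 where F2: "F2 \<in> monic_irreds" "F2 dvd pderiv F" "r dvd pull F2"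
    using prime_dvd_pull_factor[OF prime F'] by blast
  then have "F2 = F" using pull_unique F prime rF by blast
  then have "degree F \<le> degree (pderiv F)" using F2 F' dvd_imp_degree_le by blast
  moreover have "degree (pderiv F) < degree F"
    by (rule degree_pderiv_less[OF monic_irreds_degree_pos[OF F]])
  ultimately show False by simp
qed

text \<open>By the chain rule \<open>r\<close> divides the derivative of
  \<open>pull F = r * t\<close>, hence \<open>t * pderiv r\<close>. It is prime to
  \<open>pderiv r\<close> by separability, so it divides \<open>t\<close>.\<close>

lemma dvd_wronskian_ramified:
  assumes F: "F \<in> monic_irreds" and r: "r \<in> monic_irreds" "r dvd pull F" "r dvd wronskian"
  shows "r\<^sup>2 dvd pull F"
proof -
  have prime: "prime_elem r" using r by (simp add: monic_irreds_prime)
  obtain E where E: "h * pderiv (pull F) = of_nat (degree F) * pderiv h * pull F + wronskian * E"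
    by (rule pderiv_pull)
  have "r dvd h * pderiv (pull F)" unfolding E using r by (intro dvd_add) simp_all
  moreover have "\<not> r dvd h"
    by (rule pull_not_dvd_h[OF monic_irreds_nonzero[OF F] prime r(2)])
  ultimately have r': "r dvd pderiv (pull F)" using prime prime_elem_dvd_multD by blast
  obtain t where t: "pull F = r * t" using r by (elim dvdE)
  have "pderiv (pull F) = r * pderiv t + t * pderiv r" unfolding t by (simp add: pderiv_mult)
  then have "r dvd t * pderiv r" using r' by (simp add: dvd_add_right_iff)
  moreover have "\<not> r dvd pderiv r"
  proof
    assume "r dvd pderiv r"
    moreover have "pderiv r \<noteq> 0" using r irreducible_pderiv_nonzero by (auto simp: monic_irreds_def)
    ultimately have "degree r \<le> degree (pderiv r)" by (rule dvd_imp_degree_le)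
    moreover have "degree (pderiv r) < degree r"
      by (rule degree_pderiv_less[OF monic_irreds_degree_pos[OF r(1)]])
    ultimately show False by simp
  qed
  ultimately have "r dvd t" using prime prime_elem_dvd_multD by blast
  then show ?thesis unfolding t power2_eq_square by simp
qed

end

lemma prime_power_dvd_cancel:
  fixes t :: "'a::field poly"
  assumes "prime_elem t" "\<not> t dvd m" "t ^ k dvd m * c"
  shows "t ^ k dvd c"
proof -
  obtain a b where ab: "a + b = k" "t ^ a dvd m" "t ^ b dvd c"
    using prime_elem_power_dvd_prod[OF assms(3,1)] by blast
  have "a = 0"
  proof (rule ccontr)
    assume "a \<noteq> 0"
    then have "t dvd t ^ a" by (simp add: dvd_power)
    then show False using ab assms(2) dvd_trans by blast
  qed
  then show ?thesis using ab by simp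
qed

lemma prod_monic_irreds_power_dvd:
  assumes "finite S" "S \<subseteq> monic_irreds" "\<And>t. t \<in> S \<Longrightarrow> t ^ k dvd P"
  shows "(\<Prod>t\<in>S. t) ^ k dvd P"
  using assms
proof (induction S rule: finite_induct)
  case (insert t S)
  then obtain c where c: "P = (\<Prod>t\<in>S. t) ^ k * c" by (auto elim: dvdE)
  have prime: "prime_elem t" using insert by (simp add: monic_irreds_prime)
  have "\<not> t dvd (\<Prod>t\<in>S. t) ^ k"
  proof
    assume "t dvd (\<Prod>t\<in>S. t) ^ k"
    then have "t dvd (\<Prod>t\<in>S. t)" using prime prime_elem_dvd_power by blast
    then obtain s where "s \<in> S" "t dvd s" using prime_elem_dvd_prodE[OF prime] by blast
    then have "t = s" using insert.prems monic_irreds_dvd_eq by auto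
    then show False using \<open>s \<in> S\<close> insert.hyps by simp
  qed
  then have "t ^ k dvd c" using prime_power_dvd_cancel[OF prime] insert.prems c by auto
  then show ?case using insert.hyps by (simp add: c power_mult_distrib mult.commute mult_dvd_mono)
qed simp

section \<open>Invariant rational functions and the fibres of Q\<close>

context quotient_map
begin

text \<open>Invariance of Q says g(R) = Q h(R) for every R in \<open>pts\<close>, so each of these
  is a root.\<close>

lemma min_poly_eq: "min_poly = pts_poly"
proof (rule pts_poly_unique)
  fix R assume R: "R \<in> pts"
  then obtain A where A: "A \<in> lifts" "R = moebius_x A" by (auto simp: pts_def)
  have "poly_at g R / poly_at h R = Q"
    using fsub_Q[OF A(1)] A(2) fract_subst_quotient[OF transcendental_pts[OF R] h_nonzero] by metis
  moreover have "poly_at h R \<noteq> 0" using transcendentalD[OF transcendental_pts[OF R]] h_nonzero by simp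
  ultimately show "poly min_poly R = 0" unfolding min_poly(4) by (simp add: field_simps)
qed (use min_poly degree_g in auto)

text \<open>Write \<open>S = c(x)\<close> with \<open>c\<close> of degree less than \<open>|G|\<close> over \<open>K\<close>. Then \<open>c - S\<close> vanishes on \<open>pts\<close>, so \<open>c\<close> is
  constant.\<close>

lemma invariant_field_subset_K:
  assumes "\<And>A. A \<in> lifts \<Longrightarrow> fsub A S = S"
  shows "S \<in> K"
proof -
  obtain c where c: "c \<in> K_polys" "degree c < degree g" "S = poly c fract_X"
    by (rule exists_reduced_representation)
  have "fsub A T = T" if A: "A \<in> lifts" "T \<in> K" for A T
  proof -
    obtain U where "T = fract_subst Q U" using A by blast
    then show ?thesis
      using fract_subst_comp[OF transcendental_lifts[OF A(1)] transcendental_Q] fsub_Q[OF A(1)] by simp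
  qed
  then have fix_c: "fsub A (coeff c i) = coeff c i" if "A \<in> lifts" for A i
    using c(1) that by (auto simp: K_polys_def)
  have "poly c R = S" if R: "R \<in> pts" for R
  proof -
    obtain A where A: "A \<in> lifts" "R = moebius_x A" using R by (auto simp: pts_def)
    note t = transcendental_lifts[OF A(1)]
    have "fsub A (poly d fract_X) = poly (map_poly (fsub A) d) (moebius_x A)" for d
      by (induction d)
        (simp_all add: t map_poly_pCons fract_subst_add fract_subst_mult fract_subst_to_fract poly_at_pCons)
    moreover have "map_poly (fsub A) c = c"
      by (rule poly_eqI) (simp add: coeff_map_poly t fix_c A)
    ultimately show ?thesis using assms[OF A(1)] c(3) A(2) by metis
  qed
  then have "c - [:S:] = 0"
    using c(2) degree_g card_G_pos by (intro poly_zero_on_pts) (auto intro!: degree_diff_less)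
  then have "c = [:S:]" by simp
  then have "S = coeff c 0" by simp
  then show ?thesis using c(1) by (simp add: K_polys_def)
qed

lemma is_quotient_map: "is_quotient_map G g h"
proof -
  have "invariant_field G = K"
  proof (intro equalityI subsetI)
    fix S assume "S \<in> K"
    then obtain U where "S = fract_subst Q U" by blast
    then show "S \<in> invariant_field G"
      using fract_subst_comp[OF transcendental_lifts transcendental_Q] fsub_Q
      by (auto simp: invariant_field_eq)
  qed (auto simp: invariant_field_eq intro: invariant_field_subset_K)
  then show ?thesis
    using coprime_gh h_nonzero monic_g degree_g degree_less
    by (simp add: is_quotient_map_def Fract_conv_to_fract generated_field_eq)
qed

subsection \<open>The fibres of a quotient map\<close>

text \<open>\<open>A\<close> permutes the poles of Q. The pole at \<infinity> has order deg g - deg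
  h, and the power of \<open>den A\<close> is its transform. Formally, coprimality makes
  \<open>g\<close> divide \<open>hsub A g\<close>, and the degree bound leaves only a constant
  quotient.\<close>

lemma hsub_h:
  assumes A: "A \<in> lifts"
  obtains c where "c \<noteq> 0" "hsub A h * den A ^ (degree g - degree h) = smult c h"
proof -
  have det: "det A \<noteq> 0" using A by (rule lifts_det)
  note t = transcendental_lifts[OF A]
  have "fsub A (to_fract g) / fsub A (to_fract h) = Q"
    using fsub_Q[OF A] by (simp add: fract_subst_divide t)
  moreover have "fsub A (to_fract h) \<noteq> 0" using h_nonzero by (simp add: fract_subst_eq_0_iff t)
  ultimately have eq: "fsub A (to_fract g) * to_fract h = to_fract g * fsub A (to_fract h)"
    using h_nonzero by (simp add: field_simps)
  have "to_fract (den A) ^ degree g = to_fract (den A) ^ degree h * to_fract (den A) ^ (degree g - degree h)"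
    using degree_less by (simp flip: power_add)
  then have *: "to_fract (hsub A h * den A ^ (degree g - degree h)) = to_fract (den A) ^ degree g * fsub A (to_fract h)"
    by (simp only: to_fract_mult to_fract_power to_fract_hsub[OF det] mult_ac)
  have "to_fract (hsub A g * h) = to_fract (den A) ^ degree g * (fsub A (to_fract g) * to_fract h)"
    by (simp only: to_fract_mult to_fract_hsub[OF det] mult_ac)
  also have "\<dots> = to_fract g * to_fract (hsub A h * den A ^ (degree g - degree h))"
    unfolding eq * by (simp only: mult_ac)
  also have "\<dots> = to_fract (g * (hsub A h * den A ^ (degree g - degree h)))"
    by (simp only: to_fract_mult)
  finally have "to_fract (hsub A g * h) = to_fract (g * (hsub A h * den A ^ (degree g - degree h)))" .
  then have eq': "hsub A g * h = g * (hsub A h * den A ^ (degree g - degree h))"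
    by (simp only: to_fract_eq_iff)
  then have "g dvd hsub A g * h" by simp
  then have "g dvd hsub A g" by (rule coprime_dvd_multD_poly[OF coprime_gh])
  then obtain b where b: "hsub A g = g * b" by (elim dvdE)
  have g0: "g \<noteq> 0" using degree_less by auto
  have "hsub A g \<noteq> 0" by (rule hsub_nonzero[OF det g0])
  then have b0: "b \<noteq> 0" using b by auto
  have "degree (g * b) \<le> degree g" using degree_hsub_le[of g A] by (simp only: b)
  then have "degree b = 0" using g0 b0 by (simp add: degree_mult_eq)
  then obtain c where c: "b = [:c:]" by (rule degree_eq_zeroE)
  have "g * (hsub A h * den A ^ (degree g - degree h)) = g * smult c h"
    using eq' b c by (simp add: mult.commute)
  then have "hsub A h * den A ^ (degree g - degree h) = smult c h"
    using g0 by (simp only: mult_cancel_left) simp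
  then show ?thesis using that c b0 by simp
qed

lemma hsub_pull:
  assumes A: "A \<in> lifts" and F: "lead_coeff F = 1"
  obtains c where "c \<noteq> 0" "hsub A (pull F) = smult c (pull F)"
proof -
  have det: "det A \<noteq> 0" using A by (rule lifts_det)
  note t = transcendental_lifts[OF A]
  obtain c where c: "c \<noteq> 0" "hsub A h * den A ^ (degree g - degree h) = smult c h"
    using hsub_h[OF A] .
  have "to_fract (den A) ^ degree g * fsub A (to_fract h) = to_fract (hsub A h * den A ^ (degree g - degree h))"
    using degree_less by (simp only: to_fract_mult to_fract_power to_fract_hsub[OF det])
      (simp add: mult.left_commute mult.commute flip: power_add)
  also have "\<dots> = const_fract c * to_fract h" unfolding c(2) by (simp flip: to_fract_mult)
  finally have *: "to_fract (den A) ^ degree g * fsub A (to_fract h) = const_fract c * to_fract h" .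
  have "to_fract (hsub A (pull F)) =
    to_fract (den A) ^ (degree F * degree g) * fsub A (to_fract (pull F))"
    by (simp only: to_fract_hsub[OF det] monic_pull(2)[OF F])
  also have "\<dots> = (to_fract (den A) ^ degree g * fsub A (to_fract h)) ^ degree F * poly_at F Q"
    by (simp only: to_fract_pull fract_subst_mult[OF t] fract_subst_power[OF t] fract_subst_poly_at[OF t]
        fsub_Q[OF A] power_mult_distrib power_mult[symmetric] mult.commute[of "degree F"] mult.assoc)
  also have "\<dots> = const_fract c ^ degree F * to_fract (pull F)"
    unfolding * by (simp add: to_fract_pull power_mult_distrib)
  also have "\<dots> = to_fract ([:c:] ^ degree F * pull F)" by simp
  finally have "hsub A (pull F) = [:c:] ^ degree F * pull F" by (simp only: to_fract_eq_iff)
  then have "hsub A (pull F) = smult (c ^ degree F) (pull F)" by (simp add: poly_const_pow)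
  then show ?thesis using that[of "c ^ degree F"] c(1) by simp
qed

text \<open>At Y^deg h the coefficient of \<open>pts_poly\<close> is a constant minus a nonzero
  multiple of g/h, so \<open>h\<close> is its exact denominator and divides every common
  denominator.\<close>

lemma h_dvd_dens: "h dvd dens"
proof -
  let ?i = "degree h"
  obtain p where p: "to_fract dens * coeff pts_poly ?i = to_fract p" by (rule dens_coeff)
  have "coeff pts_poly ?i = const_fract (coeff g ?i) - Q * const_fract (lead_coeff h)"
    unfolding min_poly_eq[symmetric] min_poly_def by (simp add: coeff_poly_const)
  then have "to_fract h * const_fract (coeff g ?i) - to_fract g * const_fract (lead_coeff h) =
      to_fract h * coeff pts_poly ?i"
    using h_nonzero by (simp add: field_simps)
  then have "to_fract dens * to_fract h * const_fract (coeff g ?i) -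
      to_fract dens * to_fract g * const_fract (lead_coeff h) = to_fract h * to_fract p"
    unfolding p[symmetric] mult.left_commute[of "to_fract h" "to_fract dens"]
    by (metis (no_types) mult.assoc right_diff_distrib)
  then have "to_fract (dens * h * [:coeff g ?i:] - dens * g * [:lead_coeff h:]) = to_fract (h * p)"
    by (simp only: to_fract_mult to_fract_diff)
  then have "dens * h * [:coeff g ?i:] - dens * g * [:lead_coeff h:] = h * p"
    by (simp only: to_fract_eq_iff)
  then have "dens * g * [:lead_coeff h:] = h * (dens * [:coeff g ?i:] - p)" by (simp add: algebra_simps)
  then have "h dvd dens * g * [:lead_coeff h:]" by (simp only: dvd_triv_left)
  then have "h dvd smult (lead_coeff h) (dens * g)" by simp
  then have "h dvd dens * g" using h_nonzero by (simp add: dvd_smult_iff)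
  then show ?thesis using coprime_gh by (intro coprime_dvd_multD_poly[of h g dens]) (simp_all add: coprime_commute)
qed

text \<open>The zeros of \<open>h\<close> are the finite points of the orbit of \<infinity>. One
  inclusion is \<open>h_dvd_dens\<close>; the other reads off the factor \<open>den A\<close> in
  \<open>hsub_h\<close>, whose exponent is positive because deg h < deg g.\<close>

lemma off_iff_not_dvd_h: "r \<in> off \<longleftrightarrow> r \<in> monic_irreds \<and> \<not> r dvd h"
proof (cases "r \<in> monic_irreds")
  case r: True
  then have prime: "prime_elem r" by (rule monic_irreds_prime)
  have "(\<exists>A\<in>lifts. r dvd den A) \<longleftrightarrow> r dvd h"
  proof
    assume "r dvd h"
    then have "r dvd dens" using h_dvd_dens dvd_trans by blast
    then obtain R where "R \<in> pts" "r dvd den (rep R)"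
      unfolding dens_def using prime_elem_dvd_prodE[OF prime] by blast
    then show "\<exists>A\<in>lifts. r dvd den A" using rep by blast
  next
    assume "\<exists>A\<in>lifts. r dvd den A"
    then obtain A where A: "A \<in> lifts" "r dvd den A" by blast
    obtain c where c: "c \<noteq> 0" "hsub A h * den A ^ (degree g - degree h) = smult c h"
      by (rule hsub_h[OF A(1)])
    have "den A dvd den A ^ (degree g - degree h)" using degree_less by (intro dvd_power) simp
    then have "r dvd hsub A h * den A ^ (degree g - degree h)"
      using A(2) by (intro dvd_mult) (rule dvd_trans)
    then have "r dvd smult c h" by (simp only: c(2))
    then show "r dvd h" using c(1) by (simp add: dvd_smult_iff)
  qed
  then show ?thesis unfolding off_iff using r by blast
qed (simp add: off_iff)

lemma poly_act_power_dvd_pull: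
  assumes "F \<in> monic_irreds" "r \<in> off" "r ^ k dvd pull F" "A \<in> lifts"
  shows "poly_act A r ^ k dvd pull F"
proof -
  have det: "det A \<noteq> 0" using assms by (simp add: lifts_det)
  obtain c where c: "c \<noteq> 0" "hsub A (pull F) = smult c (pull F)"
    using hsub_pull[OF assms(4)] assms(1) by (auto simp: monic_irreds_def)
  obtain d where d: "d \<noteq> 0" "poly_act A r = smult d (hsub A r)"
    using poly_act_off_assoc assms by blast
  have "hsub A (r ^ k) dvd hsub A (pull F)"
    using assms(3) den_nonzero[OF det] by (rule hom_subst_dvd[rotated])
  then have "hsub A r ^ k dvd pull F"
    unfolding hom_subst_power[OF den_nonzero[OF det]] c(2) using c(1) by (simp add: dvd_smult_iff)
  then show ?thesis unfolding d(2) using d(1) by (simp add: smult_power smult_dvd_iff)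
qed

text \<open>The norm of \<open>r\<close> is invariant, hence a rational function \<open>U/V\<close> of \<open>Q\<close>. As \<open>r\<close> divides its
  numerator, \<open>F\<close> divides \<open>U\<close>, so \<open>s\<close> divides the norm as well.\<close>

lemma fibre_subset_orbit:
  assumes F: "F \<in> monic_irreds" and r: "r \<in> monic_irreds" "r dvd pull F"
    and s: "s \<in> monic_irreds" "s dvd pull F"
  shows "s \<in> poly_orbit G r"
proof -
  have F0: "F \<noteq> 0" using F by (auto simp: monic_irreds_def)
  have prime: "prime_elem r" "prime_elem s" using r s by (auto intro: monic_irreds_prime)
  have not_h: "\<not> r dvd h" "\<not> s dvd h" using pull_not_dvd_h F0 prime r s by blast+
  then have off: "r \<in> off" "s \<in> off" using r s by (auto simp: off_iff_not_dvd_h)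
  have r0: "r \<noteq> 0" using prime by auto
  let ?S = "\<Prod>R\<in>pts. fract_subst R (to_fract r)"
  let ?N = "\<Prod>R\<in>pts. hsub (rep R) r"
  have "fsub A ?S = ?S" if A: "A \<in> lifts" for A
  proof -
    note t = transcendental_lifts[OF A]
    have "fsub A ?S = (\<Prod>R\<in>pts. fract_subst (fsub A R) (to_fract r))"
      unfolding fract_subst_prod[OF t]
      by (intro prod.cong refl fract_subst_comp[OF t] transcendental_pts)
    also have "\<dots> = ?S" by (rule fsub_pts_reindex[OF A])
    finally show ?thesis .
  qed
  then have "?S \<in> K" by (rule invariant_field_subset_K)
  then obtain T where T: "?S = fract_subst Q T" by blast
  obtain U' V' where "V' \<noteq> 0" "T = to_fract U' / to_fract V'" by (rule to_fract_cases)
  then obtain U V where UV: "coprime U V" "V \<noteq> 0" "T = to_fract U / to_fract V"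
    using coprime_representation by metis
  have S: "?S * poly_at V Q = poly_at U Q"
    using transcendentalD[OF transcendental_Q] UV(2)
    unfolding T UV(3) fract_subst_quotient[OF transcendental_Q UV(2)] by simp
  have "to_fract ?N = (\<Prod>R\<in>pts. to_fract (den (rep R)) ^ degree r * fract_subst R (to_fract r))"
    unfolding to_fract_prod
  proof (rule prod.cong[OF refl])
    fix R assume R: "R \<in> pts"
    show "to_fract (hsub (rep R) r) = to_fract (den (rep R)) ^ degree r * fract_subst R (to_fract r)"
      using to_fract_hsub[OF lifts_det[OF rep(1)[OF R]]] rep(2)[OF R] by simp
  qed
  also have "\<dots> = to_fract dens ^ degree r * ?S"
    unfolding prod.distrib prod_power_distrib[symmetric] dens_def to_fract_prod by simp
  finally have N: "to_fract ?N = to_fract dens ^ degree r * ?S" .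
  \<comment> \<open>The equation norm = U(Q)/V(Q), cleared of the denominators \<open>dens\<close>
    and \<open>h\<close>.\<close>
  have "to_fract (?N * pull V * h ^ degree U) = to_fract (dens ^ degree r * pull U * h ^ degree V)"
    unfolding to_fract_mult to_fract_power N to_fract_pull S[symmetric] by (simp add: algebra_simps)
  then have eq: "?N * pull V * h ^ degree U = dens ^ degree r * pull U * h ^ degree V"
    by (simp only: to_fract_eq_iff)
  have act: "hsub (rep R) r dvd poly_act (rep R) r" "poly_act (rep R) r dvd hsub (rep R) r" if R: "R \<in> pts" for R
  proof -
    obtain d where "d \<noteq> 0" "poly_act (rep R) r = smult d (hsub (rep R) r)"
      using poly_act_off_assoc[OF off(1) rep(1)[OF R]] .
    then show "hsub (rep R) r dvd poly_act (rep R) r" "poly_act (rep R) r dvd hsub (rep R) r"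
      by (simp_all add: smult_dvd_iff dvd_smult)
  qed
  \<comment> \<open>The chosen representative of the identity class can be any nonzero scalar
    matrix, but it acts like \<open>mat 1\<close>.\<close>
  have "poly_act (rep fract_X) r = poly_act (mat 1) r"
    using rep[OF X_in_pts] lifts_mat[of 1] off by (intro poly_act_cong) auto
  then have "r dvd hsub (rep fract_X) r"
    using act(2)[OF X_in_pts] off by (simp add: poly_act_mat del: poly_act_eq)
  also have "hsub (rep fract_X) r dvd ?N" by (rule dvd_prodI[OF finite_pts X_in_pts])
  finally have "r dvd dens ^ degree r * pull U * h ^ degree V"
    unfolding eq[symmetric] by (intro dvd_mult2)
  moreover have "\<not> r dvd dens"
  proof
    assume "r dvd dens"
    then obtain R where "R \<in> pts" "r dvd den (rep R)"
      unfolding dens_def using prime_elem_dvd_prodE[OF prime(1)] by blast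
    then show False using off(1) rep(1) off_iff by blast
  qed
  ultimately have rU: "r dvd pull U"
    using not_h(1) prime_elem_dvd_power[OF prime(1)] by (auto simp: prime_elem_dvd_mult_iff[OF prime(1)])
  have "?S \<noteq> 0"
    using finite_pts r0 fract_subst_eq_0_iff[OF transcendental_pts] by simp
  then have U0: "U \<noteq> 0" using T UV(3) transcendental_Q by auto
  obtain F1 where F1: "F1 \<in> monic_irreds" "F1 dvd U" "r dvd pull F1"
    using prime_dvd_pull_factor[OF prime(1) U0 rU] .
  then have FU: "F dvd U" using pull_unique F prime(1) r(2) by blast
  have "s dvd pull U" using s(2) hom_subst_dvd[OF h_nonzero FU] dvd_trans by blast
  then have "s dvd ?N * pull V * h ^ degree U" unfolding eq by simp
  \<comment> \<open>Otherwise \<open>F\<close> would divide \<open>V\<close> as well as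
    \<open>U\<close>.\<close>
  moreover have "\<not> s dvd pull V"
  proof
    assume "s dvd pull V"
    then obtain F2 where "F2 \<in> monic_irreds" "F2 dvd V" "s dvd pull F2"
      using prime_dvd_pull_factor[OF prime(2) UV(2)] by blast
    then have "F dvd V" using pull_unique F prime(2) s(2) by blast
    then show False using FU UV(1) F by (meson coprime_common_divisor monic_irreds_prime prime_elem_def)
  qed
  ultimately have "s dvd ?N"
    using not_h(2) prime_elem_dvd_power[OF prime(2)] by (auto simp: prime_elem_dvd_mult_iff[OF prime(2)])
  then obtain R where R: "R \<in> pts" "s dvd hsub (rep R) r" by (rule prime_elem_dvd_prodE[OF prime(2)])
  then have "s dvd poly_act (rep R) r" using act dvd_trans by blast
  moreover have "poly_act (rep R) r \<in> monic_irreds"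
    using poly_act_off[OF off(1) rep(1)[OF R(1)]] by (simp add: off_iff)
  ultimately have "s = poly_act (rep R) r" using s(1) monic_irreds_dvd_eq by blast
  then show ?thesis using rep(1)[OF R(1)] by (auto simp: poly_orbit_eq)
qed

text \<open>\<open>k\<close> is the multiplicity of \<open>r\<close>, and the action gives every
  member of the orbit the same multiplicity. The last conclusion records this meaning of
  \<open>k\<close>, so that a square factor can later be recognized as ramification.\<close>

lemma pull_eq_orbit_power:
  assumes F: "F \<in> monic_irreds" and r: "r \<in> monic_irreds" "r dvd pull F"
  obtains k where "k > 0" "pull F = (\<Prod>t\<in>poly_orbit G r. t) ^ k"
    "\<And>j. r ^ j dvd pull F \<longleftrightarrow> j \<le> k"
proof -
  have F0: "F \<noteq> 0" "lead_coeff F = 1" using F by (auto simp: monic_irreds_def)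
  have prime: "prime_elem r" using r by (auto intro: monic_irreds_prime)
  have off: "r \<in> off" using pull_not_dvd_h F0 prime r by (auto simp: off_iff_not_dvd_h)
  have bound: "j \<le> degree (pull F)" if "r ^ j dvd pull F" for j
  proof -
    have "degree (r ^ j) \<le> degree (pull F)" using that pull_nonzero F0 by (intro dvd_imp_degree_le)
    moreover have "degree (r ^ j) = j * degree r" using prime by (intro degree_power_eq) auto
    ultimately show ?thesis using monic_irreds_degree_pos[OF r(1)]
      by (metis One_nat_def Suc_leI le_trans mult.right_neutral mult_le_mono2)
  qed
  define k where "k = Max {j. r ^ j dvd pull F}"
  have fin: "finite {j. r ^ j dvd pull F}" by (rule finite_subset[of _ "{..degree (pull F)}"]) (use bound in auto)
  have k: "r ^ k dvd pull F" 
  proof -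
    have "0 \<in> {j. r ^ j dvd pull F}" by simp
    then show ?thesis using Max_in[OF fin] unfolding k_def by blast
  qed
  have iff: "r ^ j dvd pull F \<longleftrightarrow> j \<le> k" for j
    using Max_ge[OF fin] k le_imp_power_dvd[of j k r] dvd_trans unfolding k_def by blast
  have "k > 0" using iff[of 1] r(2) by simp
  let ?O = "poly_orbit G r"
  have monics: "?O \<subseteq> monic_irreds" using poly_orbit_off[OF off] by (auto simp: off_iff)
  have "t ^ k dvd pull F" if "t \<in> ?O" for t
    using that k F off poly_act_power_dvd_pull by (auto simp: poly_orbit_eq)
  then have "(\<Prod>t\<in>?O. t) ^ k dvd pull F"
    using finite_poly_orbit monics by (intro prod_monic_irreds_power_dvd)
  then obtain c where c: "pull F = (\<Prod>t\<in>?O. t) ^ k * c" by (elim dvdE)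
  have "degree c = 0"
  proof (rule ccontr)
    assume "degree c \<noteq> 0"
    then obtain s where s: "s \<in> monic_irreds" "s dvd c" using exists_monic_irreducible_factor by blast
    then have sF: "s dvd pull F" using c by simp
    have sO: "s \<in> ?O" by (rule fibre_subset_orbit[OF F r s(1) sF])
    \<comment> \<open>A further factor \<open>s\<close> lies in the orbit, and moving it back to
      \<open>r\<close> raises the multiplicity of \<open>r\<close> above \<open>k\<close>.\<close>
    then obtain A where A: "A \<in> lifts" "s = poly_act A r" by (auto simp: poly_orbit_eq)
    have "s dvd (\<Prod>t\<in>?O. t)" using dvd_prodI[OF finite_poly_orbit sO, of "\<lambda>t. t"] by simp
    then have "s ^ k * s dvd pull F" unfolding c using s(2) by (intro mult_dvd_mono dvd_power_same)
    then have "s ^ Suc k dvd pull F" by (simp add: mult.commute)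
    moreover have "s \<in> off" using poly_orbit_off[OF off sO] by simp
    ultimately have "poly_act (adj2 A) s ^ Suc k dvd pull F"
      using F A(1) lifts_adj2 by (intro poly_act_power_dvd_pull)
    then have "r ^ Suc k dvd pull F" using A off by (simp only: poly_act_adj2)
    then show False using iff by (metis Suc_n_not_le_n)
  qed
  then obtain d where d: "c = [:d:]" by (rule degree_eq_zeroE)
  have "lead_coeff ((\<Prod>t\<in>?O. t) ^ k) = 1"
  proof -
    have "lead_coeff t = 1" if "t \<in> ?O" for t using monics that by (auto simp: monic_irreds_def)
    then show ?thesis by (simp add: lead_coeff_power lead_coeff_prod)
  qed
  then have "d = 1"
    using monic_pull(1)[OF F0(2)] unfolding c lead_coeff_mult d by simp
  then have "pull F = (\<Prod>t\<in>?O. t) ^ k" using c d by (simp add: one_pCons[symmetric])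
  then show ?thesis using that \<open>k > 0\<close> iff by blast
qed

end

text \<open>The roots of \<open>fixp A\<close> are the finite fixed points of \<open>A\<close>.\<close>

abbreviation fixp :: "'a::field ^ 2 ^ 2 \<Rightarrow> 'a poly" where
  "fixp A \<equiv> [:- A $ 1 $ 2, A $ 2 $ 2 - A $ 1 $ 1, A $ 2 $ 1:]"

section \<open>Fixed points as zeros of the Wronskian\<close>

lemma to_fract_fixp:
  fixes A :: "'a::field ^ 2 ^ 2"
  assumes "det A \<noteq> 0"
  shows "to_fract (fixp A) = (fract_X - moebius_x A) * to_fract (den A)"
proof -
  have "fixp A = [:0, 1:] * den A - num A" by simp
  then have "to_fract (fixp A) = fract_X * to_fract (den A) - to_fract (num A)"
    by (simp only: to_fract_mult to_fract_diff)
  then show ?thesis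
    using den_nonzero[OF assms] unfolding moebius_x_eq
    by (simp add: left_diff_distrib del: pCons_eq_0_iff)
qed

lemma to_fract_of_nat: "to_fract (of_nat n) = of_nat n"
  by (induction n) simp_all

lemma pderiv_poly_const:
  fixes p :: "'a::field poly"
  shows "pderiv (poly_const p) = poly_const (pderiv p)"
proof (rule poly_eqI)
  fix i
  have "const_fract (of_nat (Suc i) :: 'a) = of_nat (Suc i)"
    by (metis of_nat_poly to_fract_of_nat)
  then show "coeff (pderiv (poly_const p)) i = coeff (poly_const (pderiv p)) i"
    by (simp only: coeff_pderiv coeff_poly_const const_fract_mult)
qed

lemma moebius_x_mult_cancel:
  fixes A B :: "'a::field ^ 2 ^ 2"
  assumes "det A \<noteq> 0" "det B \<noteq> 0" "moebius_x (A ** B) = moebius_x A"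
  shows "moebius_x B = fract_X"
proof -
  have detAB: "det (A ** B) \<noteq> 0" using assms by (simp add: det_mul)
  have "moebius_x B = moebius_x (mat (det A) ** B)"
    using assms by (subst moebius_x_eq_iff) (auto simp: det_mul intro!: exI[of _ "1 / det A"]
        simp: matrix_mul_assoc mat_mult_mat)
  also have "mat (det A) ** B = adj2 A ** (A ** B)" by (simp only: matrix_mul_assoc mult_adj2)
  also have "moebius_x \<dots> = fsub (A ** B) (moebius_x (adj2 A))"
    by (rule fsub_moebius_x[symmetric]) (use assms detAB in simp_all)
  also have "\<dots> = moebius_x (adj2 A ** A)"
    unfolding assms(3) by (rule fsub_moebius_x) (use assms in simp_all)
  also have "\<dots> = fract_X" using assms by (simp add: mult_adj2)
  finally show ?thesis .
qed

lemma moebius_x_eq_X: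
  fixes A :: "'a::field ^ 2 ^ 2"
  assumes "det A \<noteq> 0" "moebius_x A = fract_X"
  shows "A $ 2 $ 1 = 0"
proof -
  have "moebius_x A = moebius_x (mat 1)" using assms by simp
  then obtain c where "A = mat c ** mat 1" using assms moebius_x_eq_iff[of A "mat 1"] by auto
  then show ?thesis by (simp add: mat_nth2)
qed

context quotient_map
begin

text \<open>This is the derivative at \<open>x\<close> of the identity \<open>min_poly = pts_poly\<close>.\<close>

lemma wronskian_prod:
  "wronskian * (\<Prod>R\<in>pts - {fract_X}. den (rep R)) = h * (\<Prod>R\<in>pts - {fract_X}. fixp (rep R))"
proof -
  let ?P = "\<Prod>R\<in>pts - {fract_X}. [:- R, 1:]"
  have "to_fract wronskian = to_fract h * (to_fract (pderiv g) - Q * to_fract (pderiv h))"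
    unfolding wronskian_def using h_nonzero by (simp add: field_simps)
  also have "\<dots> = to_fract h * poly (pderiv min_poly) fract_X"
    by (simp add: min_poly_def pderiv_diff pderiv_smult pderiv_poly_const poly_poly_const)
  also have "min_poly = [:- fract_X, 1:] * ?P"
    unfolding min_poly_eq pts_poly_def using finite_pts X_in_pts by (rule prod.remove)
  also have "poly (pderiv ([:- fract_X, 1:] * ?P)) fract_X = poly ?P fract_X"
    by (simp only: pderiv_mult pderiv_pCons) simp
  also have "\<dots> = (\<Prod>R\<in>pts - {fract_X}. fract_X - R)" by (simp add: poly_prod)
  finally have W: "to_fract wronskian = to_fract h * (\<Prod>R\<in>pts - {fract_X}. fract_X - R)" .
  have "to_fract (wronskian * (\<Prod>R\<in>pts - {fract_X}. den (rep R))) =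
    to_fract h * (\<Prod>R\<in>pts - {fract_X}. (fract_X - R) * to_fract (den (rep R)))"
    unfolding to_fract_mult W to_fract_prod prod.distrib by (simp only: mult.assoc)
  also have "\<dots> = to_fract h * (\<Prod>R\<in>pts - {fract_X}. to_fract (fixp (rep R)))"
  proof (intro arg_cong[of _ _ "\<lambda>x. to_fract h * x"] prod.cong refl)
    fix R assume "R \<in> pts - {fract_X}"
    then have R: "R \<in> pts" by simp
    show "(fract_X - R) * to_fract (den (rep R)) = to_fract (fixp (rep R))"
      unfolding to_fract_fixp[OF lifts_det[OF rep(1)[OF R]]] rep(2)[OF R] ..
  qed
  also have "\<dots> = to_fract (h * (\<Prod>R\<in>pts - {fract_X}. fixp (rep R)))"
    by (simp only: to_fract_mult to_fract_prod)
  finally show ?thesis by (simp only: to_fract_eq_iff)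
qed

lemma fixp_rep_nonzero:
  assumes "R \<in> pts - {fract_X}"
  shows "fixp (rep R) \<noteq> 0"
proof -
  have R: "R \<in> pts" "R \<noteq> fract_X" using assms by auto
  have "to_fract (fixp (rep R)) \<noteq> 0"
    unfolding to_fract_fixp[OF lifts_det[OF rep(1)[OF R(1)]]] rep(2)[OF R(1)]
    using R(2) den_rep_nonzero[OF R(1)] by (simp del: pCons_eq_0_iff)
  then show ?thesis by (simp only: to_fract_eq_0_iff simp_thms)
qed

lemma wronskian_nonzero: "wronskian \<noteq> 0"
proof
  assume "wronskian = 0"
  then have "h * (\<Prod>R\<in>pts - {fract_X}. fixp (rep R)) = 0" using wronskian_prod by simp
  then show False
    using h_nonzero finite_pts fixp_rep_nonzero by (simp del: pCons_eq_0_iff)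
qed

text \<open>\<open>A\<close> and the representative of its class differ by a scalar, so their
  fixed-point polynomials agree after cross-multiplication with denominators. No denominator is
  divisible by \<open>r\<close>, so these cancel here and in \<open>wronskian_prod\<close>.\<close>

lemma fixp_dvd_wronskian:
  assumes A: "A \<in> lifts" "moebius_x A \<noteq> fract_X" and r: "r \<in> off" "r dvd fixp A"
  shows "r dvd wronskian"
proof -
  have prime: "prime_elem r" using r off_iff monic_irreds_prime by blast
  have not_den: "\<not> r dvd den B" if "B \<in> lifts" for B using r(1) that off_iff by blast
  let ?R = "moebius_x A"
  have R: "?R \<in> pts" using A by (simp add: pts_def)
  have "to_fract (fixp A * den (rep ?R)) = to_fract (fixp (rep ?R) * den A)"
    unfolding to_fract_mult to_fract_fixp[OF lifts_det[OF A(1)]]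
      to_fract_fixp[OF lifts_det[OF rep(1)[OF R]]] rep(2)[OF R] by (simp only: mult_ac)
  then have "fixp A * den (rep ?R) = fixp (rep ?R) * den A" by (simp only: to_fract_eq_iff)
  then have "r dvd fixp (rep ?R) * den A" using r(2) by (metis dvd_mult2)
  then have "r dvd fixp (rep ?R)" using prime not_den[OF A(1)] prime_elem_dvd_multD by blast
  also have "fixp (rep ?R) dvd (\<Prod>R\<in>pts - {fract_X}. fixp (rep R))"
    using R A(2) finite_pts by (intro dvd_prodI) auto
  finally have "r dvd wronskian * (\<Prod>R\<in>pts - {fract_X}. den (rep R))"
    unfolding wronskian_prod by (rule dvd_mult)
  moreover have "\<not> r dvd (\<Prod>R\<in>pts - {fract_X}. den (rep R))"
  proof
    assume "r dvd (\<Prod>R\<in>pts - {fract_X}. den (rep R))"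
    then obtain R where "R \<in> pts - {fract_X}" "r dvd den (rep R)" by (rule prime_elem_dvd_prodE[OF prime])
    then show False using not_den rep(1) by blast
  qed
  ultimately show ?thesis using prime prime_elem_dvd_multD by blast
qed

abbreviation ramified :: "nat set" where
  "ramified \<equiv> ramified_degrees G g h"

text \<open>A ramified \<open>F\<close> is recovered from any of its factors \<open>r\<close>, and
  \<open>r\<close> divides the nonzero Wronskian.\<close>

lemma finite_ramified: "finite ramified"
proof -
  let ?f = "\<lambda>r. degree (THE F. F \<in> monic_irreds \<and> r dvd pull F)"
  have "ramified \<subseteq> ?f ` {r. r dvd wronskian}"
  proof
    fix d assume "d \<in> ramified"
    then obtain F r k where F: "d = degree F" "F \<in> monic_irreds" "r \<in> off" "k > 1"
      "pull F = (\<Prod>t\<in>poly_orbit G r. t) ^ k"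
      unfolding ramified_degrees_def by blast
    have r: "r \<in> monic_irreds" using F off_iff by blast
    have "r dvd (\<Prod>t\<in>poly_orbit G r. t)"
      using dvd_prodI[OF finite_poly_orbit poly_orbit_refl[OF F(3)], of "\<lambda>t. t"] by simp
    then have "r ^ k dvd pull F" unfolding F(5) by (rule dvd_power_same)
    moreover have "r\<^sup>2 dvd r ^ k" "r dvd r ^ k" using F(4) by (auto intro: le_imp_power_dvd dvd_power)
    ultimately have r2: "r\<^sup>2 dvd pull F" "r dvd pull F" using dvd_trans by blast+
    have "(THE F. F \<in> monic_irreds \<and> r dvd pull F) = F"
      using F(2) r2(2) pull_unique monic_irreds_prime[OF r] by blast
    then show "d \<in> ?f ` {r. r dvd wronskian}"
      using ramified_dvd_wronskian[OF F(2) r r2(1)] F(1) by auto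
  qed
  then show ?thesis using finite_divisors_poly[OF wronskian_nonzero] finite_surj by blast
qed

lemma orbit_prod_degree:
  assumes "r \<in> off"
  shows "degree ((\<Prod>t\<in>poly_orbit G r. t) ^ j) = j * (card (poly_orbit G r) * degree r)"
proof -
  let ?O = "poly_orbit G r"
  have nz: "\<forall>t\<in>?O. t \<noteq> 0" using poly_orbit_off[OF assms] monic_irreds_nonzero off_iff by blast
  then have "degree (\<Prod>t\<in>?O. t) = (\<Sum>t\<in>?O. degree t)" by (rule degree_prod_eq_sum_degree)
  also have "\<dots> = card ?O * degree r" using poly_orbit_off[OF assms] by simp
  finally show ?thesis using nz finite_poly_orbit[of r] by (simp add: degree_power_eq)
qed

section \<open>Fibres, orbits and the count\<close>

definition fibre :: "'a poly \<Rightarrow> 'a poly set" where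
  "fibre F = {r \<in> monic_irreds. r dvd pull F}"

lemma fibre_off:
  assumes "F \<in> monic_irreds" "r \<in> fibre F"
  shows "r \<in> off"
proof -
  have "\<not> r dvd h"
    using assms by (intro pull_not_dvd_h[of F r] monic_irreds_nonzero monic_irreds_prime) (auto simp: fibre_def)
  then show ?thesis using assms by (simp add: off_iff_not_dvd_h fibre_def)
qed

lemma fibre_nonempty:
  assumes "F \<in> monic_irreds"
  obtains r where "r \<in> fibre F"
proof -
  have "degree (pull F) = degree F * degree g"
    using assms by (intro monic_pull) (simp add: monic_irreds_def)
  then have "degree (pull F) > 0" using monic_irreds_degree_pos[OF assms] degree_less by simp
  then show ?thesis using exists_monic_irreducible_factor that by (auto simp: fibre_def)
qed

lemma fibre_eq_orbit:
  assumes F: "F \<in> monic_irreds" and r: "r \<in> fibre F"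
  shows "fibre F = poly_orbit G r"
proof (intro equalityI subsetI)
  fix s assume "s \<in> fibre F"
  then show "s \<in> poly_orbit G r" using fibre_subset_orbit F r by (auto simp: fibre_def)
next
  fix s assume s: "s \<in> poly_orbit G r"
  have off: "r \<in> off" by (rule fibre_off[OF F r])
  have "s dvd pull F"
    using s poly_act_power_dvd_pull[OF F off, of 1] r by (auto simp: poly_orbit_eq fibre_def)
  then show "s \<in> fibre F" using poly_orbit_off[OF off s] by (simp add: fibre_def off_iff)
qed

lemma fibre_degree:
  assumes F: "F \<in> monic_irreds" and r: "r \<in> fibre F"
  obtains k where "k > 0" "degree F * card G = k * (card (poly_orbit G r) * degree r)"
    "k > 1 \<Longrightarrow> degree F \<in> ramified" "r\<^sup>2 dvd pull F \<Longrightarrow> k > 1"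
proof -
  obtain k where k: "k > 0" "pull F = (\<Prod>t\<in>poly_orbit G r. t) ^ k" "\<And>j. r ^ j dvd pull F \<longleftrightarrow> j \<le> k"
    using pull_eq_orbit_power[OF F] r by (auto simp: fibre_def)
  have off: "r \<in> off" by (rule fibre_off[OF F r])
  have "degree F * card G = k * (card (poly_orbit G r) * degree r)"
    using monic_pull(2)[of F] F orbit_prod_degree[OF off, of k] degree_g
    by (simp add: k(2)[symmetric] monic_irreds_def)
  moreover have "degree F \<in> ramified" if "k > 1"
    using F off k(2) that unfolding ramified_degrees_def by blast
  moreover have "k > 1" if "r\<^sup>2 dvd pull F" using that k(3)[of 2] by simp
  ultimately show ?thesis using that k(1) by blast
qed

text \<open>If \<open>r\<close> is linear with a root \<open>B \<circ> \<infinity>\<close> and the group acts freely on the orbit of \<open>\<infinity>\<close>, then \<open>B\<close>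
  itself has a fixed point outside this orbit, and the fibre through it is ramified.\<close>

lemma orbit_not_off_card:
  assumes r: "r \<in> monic_irreds" "r \<notin> off" and unram: "ramified = {}"
  shows "card (poly_orbit G r) \<noteq> card G"
proof
  assume card: "card (poly_orbit G r) = card G"
  obtain B where B: "B \<in> lifts" "B $ 2 $ 1 \<noteq> 0" "poly r (B $ 1 $ 1 / B $ 2 $ 1) = 0"
    using r unfolding monic_irreds_off_def infinity_orbit_def lifts_iff by (auto split: if_splits)
  define v where "v = B $ 1 $ 1 / B $ 2 $ 1"
  have rv: "r = [:- v, 1:]" using monic_irreds_degree_1 r B by (simp add: v_def)
  have hsub_r: "hsub A r = num A - smult v (den A)" for A :: "'a ^ 2 ^ 2"
    by (simp add: rv hom_subst_def)
  have cong: "poly_act A r = poly_act A' r" if A: "A \<in> lifts" "A' \<in> lifts" "moebius_x A = moebius_x A'" for A A'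
  proof -
    obtain c where c: "c \<noteq> 0" "A = mat c ** A'"
      using A(3) moebius_x_eq_iff[OF lifts_det[OF A(1)] lifts_det[OF A(2)]] by auto
    then have "hsub A r = smult c (hsub A' r)"
      unfolding hsub_r by (simp add: mult_nth2 mat_nth2 algebra_simps)
    then show ?thesis using c(1) unfolding poly_act_eq by (simp add: field_simps)
  qed
  \<comment> \<open>Outside \<open>off\<close> the formula is no longer an action, but it still
    depends only on the class of the matrix. An image of size |G| therefore means injectivity on
    classes.\<close>
  have "poly_orbit G r = (\<lambda>R. poly_act (rep R) r) ` pts"
  proof (intro equalityI subsetI)
    fix s assume "s \<in> poly_orbit G r"
    then obtain A where A: "A \<in> lifts" "s = poly_act A r" by (auto simp: poly_orbit_eq)
    then have "moebius_x A \<in> pts" by (simp add: pts_def)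
    moreover from this have "s = poly_act (rep (moebius_x A)) r"
      unfolding A(2) using A(1) rep by (intro cong) auto
    ultimately show "s \<in> (\<lambda>R. poly_act (rep R) r) ` pts" by blast
  qed (use rep in \<open>auto simp: poly_orbit_eq\<close>)
  then have "inj_on (\<lambda>R. poly_act (rep R) r) pts"
    using card finite_pts by (intro eq_card_imp_inj_on) (simp_all add: card_pts)
  then have inj: "moebius_x A = moebius_x A'"
    if "A \<in> lifts" "A' \<in> lifts" "poly_act A r = poly_act A' r" for A A'
  proof -
    have pts: "moebius_x A \<in> pts" "moebius_x A' \<in> pts" using that by (auto simp: pts_def)
    then have "poly_act (rep (moebius_x A)) r = poly_act (rep (moebius_x A')) r"
      using that cong rep by metis
    then show ?thesis
      using \<open>inj_on (\<lambda>R. poly_act (rep R) r) pts\<close> pts by (auto dest: inj_onD)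
  qed
  \<comment> \<open>The hypothesis says A \<circ> \<infinity> = v; then the transform of the linear
    \<open>r\<close> drops to a nonzero constant, which is normalized to 1.\<close>
  have const: "poly_act A r = 1" if A: "A \<in> lifts" "A $ 1 $ 1 = v * A $ 2 $ 1" for A
  proof -
    have "hsub A r \<noteq> 0" using A(1) monic_irreds_nonzero[OF r(1)] by (intro hsub_nonzero lifts_det)
    moreover have "hsub A r = [:A $ 1 $ 2 - v * A $ 2 $ 2:]" unfolding hsub_r using A(2) by simp
    ultimately show ?thesis unfolding poly_act_eq by (simp add: one_pCons)
  qed
  have free: "moebius_x C = fract_X" if C: "C \<in> lifts" "C $ 2 $ 1 = 0" for C
  proof -
    \<comment> \<open>\<open>C\<close> fixes \<infinity>, so \<open>B ** C\<close> and
      \<open>B\<close> both send it to \<open>v\<close> and both turn \<open>r\<close> into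
      1.\<close>
    have "poly_act (B ** C) r = poly_act B r"
      using B C lifts_mult const by (simp add: mult_nth2 v_def)
    then have "moebius_x (B ** C) = moebius_x B" using inj B C lifts_mult by blast
    then show ?thesis using moebius_x_mult_cancel lifts_det B C by blast
  qed
  have B_X: "moebius_x B \<noteq> fract_X" using moebius_x_eq_X B lifts_det by blast
  obtain s where s: "s \<in> monic_irreds" "s dvd fixp B"
    using exists_monic_irreducible_factor[of "fixp B"] B(2) by auto
  have "\<not> s dvd den C" if C: "C \<in> lifts" for C
  proof
    assume "s dvd den C"
    have "den C \<noteq> 0" by (rule den_nonzero[OF lifts_det[OF C]])
    then have c: "C $ 2 $ 1 \<noteq> 0"
      using dvd_imp_degree_le[OF \<open>s dvd den C\<close>] monic_irreds_degree_pos[OF s(1)] by auto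
    have "[:C $ 2 $ 2 / C $ 2 $ 1, 1:] \<in> monic_irreds"
      by (simp add: monic_irreds_def irreducible_linear_field_poly)
    moreover have "den C = smult (C $ 2 $ 1) [:C $ 2 $ 2 / C $ 2 $ 1, 1:]" using c by simp
    then have "s dvd [:C $ 2 $ 2 / C $ 2 $ 1, 1:]" using \<open>s dvd den C\<close> dvd_smult_cancel[OF _ c] by metis
    ultimately have "s = [:C $ 2 $ 2 / C $ 2 $ 1, 1:]" using s(1) monic_irreds_dvd_eq by blast
    then have "poly (fixp B) (- (C $ 2 $ 2 / C $ 2 $ 1)) = 0"
      using s(2) by (simp only: poly_eq_0_iff_dvd minus_minus)
    then have fix0: "C $ 2 $ 1 * (C $ 2 $ 1 * (- B $ 1 $ 2)) - C $ 2 $ 1 * (C $ 2 $ 2 * (B $ 2 $ 2 - B $ 1 $ 1))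
        + C $ 2 $ 2 * (C $ 2 $ 2 * B $ 2 $ 1) = 0"
      using c by (simp add: field_simps)
    \<comment> \<open>The root of \<open>den C\<close> is the preimage of \<infinity> under
      \<open>C\<close>. If \<open>B\<close> fixes it, then the conjugate \<open>?D\<close> fixes
      \<infinity> and is trivial, and so is \<open>B\<close>.\<close>
    let ?D = "(C ** B) ** adj2 C"
    have D: "?D \<in> lifts" using B C lifts_mult lifts_adj2 by blast
    have "?D $ 2 $ 1 = 0" using fix0 by (simp add: mult_nth2 adj2_nth algebra_simps)
    then have "moebius_x ?D = fract_X" using free D by blast
    then have "moebius_x (?D ** C) = moebius_x C"
      using D C by (simp add: fract_subst_to_fract transcendental_lifts poly_at_pCons lifts_det flip: fsub_moebius_x)
    moreover have "?D ** C = mat (det C) ** (C ** B)"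
      by (simp only: matrix_mul_assoc[symmetric] mult_adj2) (simp add: vec_eq2_iff mult_nth2 mat_nth2 algebra_simps)
    moreover have "moebius_x (mat (det C) ** (C ** B)) = moebius_x (C ** B)"
      using B C lifts_det lifts_mult lifts_mat by (subst moebius_x_eq_iff) auto
    ultimately have "moebius_x (C ** B) = moebius_x C" by simp
    then have "moebius_x B = fract_X" using moebius_x_mult_cancel lifts_det B C by blast
    then show False using B_X by simp
  qed
  then have off: "s \<in> off" using s by (simp add: off_iff)
  have W: "s dvd wronskian" by (rule fixp_dvd_wronskian[OF B(1) B_X off s(2)])
  obtain F where F: "F \<in> monic_irreds" "s dvd pull F"
    using exists_pull_multiple off off_iff_not_dvd_h by blast
  then have "s \<in> fibre F" using s by (simp add: fibre_def)
  then have "degree F \<in> ramified"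
    using fibre_degree F dvd_wronskian_ramified[OF F(1) s(1) F(2) W] by metis
  then show False using unram by simp
qed

lemma count_irreducibles:
  assumes m: "m > (if ramified = {} then 0 else Max ramified)"
  shows "card (monic_irreds_deg m :: 'a poly set) =
    (\<Sum>k | k dvd card G. orbit_count G (m * (card G div k)) k)"
proof -
  let ?n = "card G"
  have n: "?n > 0" by (rule card_G_pos)
  have m0: "m > 0" using m by simp
  \<comment> \<open>All degrees from \<open>m\<close> on are needed: the \<open>F\<close> below a
    counted orbit is at first only known to have a multiple of \<open>m\<close> as its
    degree.\<close>
  have unram: "j \<notin> ramified" if "j \<ge> m" for j
    using m that Max_ge[OF finite_ramified, of j] by (auto split: if_splits)
  define Orb where "Orb k = {poly_orbit G r |r. r \<in> monic_irreds_deg (m * (?n div k)) \<and> card (poly_orbit G r) = k}" for k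
  have fin: "finite (Orb k)" for k
  proof -
    have "Orb k \<subseteq> poly_orbit G ` {p. degree p < Suc (m * (?n div k))}"
      by (auto simp: Orb_def monic_irreds_deg_def)
    then show ?thesis using finite_degree_less finite_surj by blast
  qed
  have fin': "finite {k. k dvd ?n}" using n by (rule finite_divisors_nat)
  have "(\<Sum>k | k dvd ?n. orbit_count G (m * (?n div k)) k) = (\<Sum>k | k dvd ?n. card (Orb k))"
    by (simp add: orbit_count_def Orb_def)
  also have "\<dots> = card (\<Union>k\<in>{k. k dvd ?n}. Orb k)"
    using fin fin' by (intro card_UN_disjoint[symmetric]) (auto simp: Orb_def)
  also have "\<dots> = card (fibre ` monic_irreds_deg m)"
  proof (intro arg_cong[of _ _ card] equalityI subsetI)
    fix S assume "S \<in> fibre ` monic_irreds_deg m"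
    then obtain F where F: "F \<in> monic_irreds" "degree F = m" "S = fibre F"
      by (auto simp: monic_irreds_deg_def)
    obtain r where r: "r \<in> fibre F" by (rule fibre_nonempty[OF F(1)])
    let ?c = "card (poly_orbit G r)"
    obtain k where "k > 0" "m * ?n = k * (?c * degree r)" "k > 1 \<Longrightarrow> degree F \<in> ramified"
      using fibre_degree[OF F(1) r] unfolding F(2) by blast
    then have "m * ?n = ?c * degree r" using unram F(2) by (cases "k = 1") auto
    moreover have dvd: "?c dvd ?n" by (rule card_poly_orbit_dvd[OF fibre_off[OF F(1) r]])
    moreover have "?c > 0" using dvd n dvd_pos_nat by blast
    ultimately have "degree r = m * (?n div ?c)"
      by (metis div_mult_swap nonzero_mult_div_cancel_left neq0_conv)
    then have "poly_orbit G r \<in> Orb ?c" using r unfolding Orb_def by (auto simp: monic_irreds_deg_def fibre_def)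
    then show "S \<in> (\<Union>k\<in>{k. k dvd ?n}. Orb k)" using dvd fibre_eq_orbit[OF F(1) r] F(3) by auto
  next
    fix S assume "S \<in> (\<Union>k\<in>{k. k dvd ?n}. Orb k)"
    then obtain k r where k: "k dvd ?n" "S = poly_orbit G r" "r \<in> monic_irreds"
      "degree r = m * (?n div k)" "card (poly_orbit G r) = k"
      by (auto simp: Orb_def monic_irreds_deg_def)
    have off: "r \<in> off"
    proof (rule ccontr)
      assume not: "r \<notin> off"
      then obtain v where "poly r v = 0" using k(3) by (auto simp: monic_irreds_off_def)
      then have "r = [:- v, 1:]" by (rule monic_irreds_degree_1[OF k(3)])
      \<comment> \<open>Degree 1 forces \<open>m\<close> = 1 and an orbit of size |G|. As ramified
        degrees are at least 1, \<open>m\<close> = 1 also means that there are none, and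
        \<open>orbit_not_off_card\<close> applies.\<close>
      then have "degree r = 1" by (metis degree_pCons_eq_if one_pCons one_neq_zero degree_1 One_nat_def)
      then have "m = 1" "?n div k = 1" using k(4) by auto
      then have "k = ?n" using k(1) by (metis dvd_mult_div_cancel mult.right_neutral)
      moreover have "ramified = {}"
      proof (rule ccontr)
        assume "ramified \<noteq> {}"
        then obtain d where d: "d \<in> ramified" by blast
        then have "d \<ge> m"
          using \<open>m = 1\<close> by (auto simp: ramified_degrees_def Suc_le_eq monic_irreds_degree_pos)
        then show False using unram d by blast
      qed
      ultimately show False using orbit_not_off_card[OF k(3) not] k(5) by simp
    qed
    obtain F where F: "F \<in> monic_irreds" "r dvd pull F"
      using exists_pull_multiple off off_iff_not_dvd_h by blast
    then have r: "r \<in> fibre F" using k(3) by (simp add: fibre_def)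
    obtain j where j: "j > 0" "degree F * ?n = j * (k * degree r)" "j > 1 \<Longrightarrow> degree F \<in> ramified"
      using fibre_degree[OF F(1) r] unfolding k(5) by blast
    have "k * degree r = m * ?n" unfolding k(4) using k(1) by (simp add: mult.left_commute)
    \<comment> \<open>An exponent \<open>j\<close> > 1 would put \<open>j * m\<close> among the
      ramified degrees, although it is at least \<open>m\<close>.\<close>
    then have "degree F = j * m" using j(2) n by (auto simp: mult.assoc[symmetric])
    moreover have "j * m \<ge> m" using j(1) by simp
    ultimately have "degree F = m" using unram j(1,3) by (cases "j = 1") auto
    then show "S \<in> fibre ` monic_irreds_deg m"
      using F(1) fibre_eq_orbit[OF F(1) r] k(2) by (auto simp: monic_irreds_deg_def)
  qed
  also have "\<dots> = card (monic_irreds_deg m :: 'a poly set)"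
  proof (rule card_image, rule inj_onI)
    fix F F' assume F: "F \<in> monic_irreds_deg m" "F' \<in> monic_irreds_deg m" "fibre F = fibre F'"
    then have irr: "F \<in> monic_irreds" "F' \<in> monic_irreds" by (auto simp: monic_irreds_deg_def)
    obtain r where "r \<in> fibre F" by (rule fibre_nonempty[OF irr(1)])
    then have "r \<in> monic_irreds" "r dvd pull F" "r dvd pull F'" using F(3) by (auto simp: fibre_def)
    then show "F = F'" using pull_unique irr monic_irreds_prime by blast
  qed
  finally show ?thesis by simp
qed

end

text \<open>Q belongs to the field that it generates, hence is invariant. This transfers the count
  to whichever quotient map the choice in \<open>d_of\<close> returns.\<close>

lemma (in pgl2_subgroup) quotient_mapI:
  assumes "is_quotient_map G g h"
  shows "quotient_map G g h"
proof -
  interpret rational_map g h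
    using assms unfolding is_quotient_map_def by unfold_locales auto
  have "Q \<in> K" by (rule K_Q)
  then have "Q \<in> invariant_field G"
    using assms unfolding is_quotient_map_def Fract_conv_to_fract generated_field_eq by simp
  then show ?thesis
    using assms unfolding invariant_field_eq is_quotient_map_def by unfold_locales auto
qed

theorem theorem15:
  fixes G :: "('a::{field,finite} ^ 2 ^ 2) set set" and m :: nat
  assumes "subgroup G PGL2"
    and "m > d_of G"
  shows "num_irreds TYPE('a) m =
    (\<Sum>k | k dvd card G. orbit_count G (m * (card G div k)) k)"
proof -
  interpret pgl2_subgroup G by (rule pgl2_subgroup.intro) (rule assms(1))
  obtain g h where gh: "(SOME (g, h). is_quotient_map G g h) = (g, h)" by fastforce
  have "\<exists>gh. case gh of (g, h) \<Rightarrow> is_quotient_map G g h"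
    using exists_quotient_map quotient_map.is_quotient_map by fast
  then have "case (SOME (g, h). is_quotient_map G g h) of (g, h) \<Rightarrow> is_quotient_map G g h"
    by (rule someI_ex)
  then have "is_quotient_map G g h" by (simp add: gh)
  then interpret quotient_map G g h by (rule quotient_mapI)
  have "m > (if ramified = {} then 0 else Max ramified)"
    using assms(2) unfolding d_of_def gh Let_def by simp
  then show ?thesis unfolding num_irreds_def by (rule count_irreducibles)
qed

end
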